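(* Let $\boldsymbol{x}_0\in\Omega$ and let $\Omega'\subseteq\Omega$ be a closed ball centered in $\boldsymbol{x}_0$ with conveniently small radius. Let $f\in W^{s,p}(\Omega')$, with $1\le p<\infty$ and $s>d/p$. Assume that the samplets satisfy the vanishing moment condition $(\sigma_{j,k},P)_\Omega=0$ for all $P\in\mathcal{P}_q(\Omega)$ with some $q\ge\lfloor s-d/p\rfloor$. Then, for every cluster $\tau$ that contains $\boldsymbol{x}_0$ (and the samplets $\sigma_{j,k}$ supported on $\tau$), there holds $$|(\sigma_{j,k},f)_\Omega|\lesssim\operatorname{diam}(\tau)^{s-d/p-\varepsilon}\sqrt{\#\tau}$$ for every $0<\varepsilon<s-d/p-\lfloor s-d/p\rfloor$. In particular, in the framework of balanced $2^d$-trees, where $\Omega=[0,1]^d$, if $p=2$, then for every $0<\varepsilon<s-d/2-\lfloor s-d/2\rfloor$ there holds $$|(\sigma_{j,k},f)_\Omega|\lesssim\sqrt{N d^{\,s-d/2-\varepsilon}}\;2^{-j(s-\varepsilon)},$$ where $N$ is the number of data sites.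
   Context: Notation. $\Omega\subset\mathbb{R}^d$ is a region and $f$ is a real-valued function on $\Omega$ (on $\Omega'$ identified with its continuous representative). $A\lesssim B$ means that $A$ is bounded by a uniform constant times $B$, where the constant does not depend on any parameters which $A$ and $B$ might depend on; $A\sim B$ means $A\lesssim B$ and $B\lesssim A$. Sobolev–Slobodeckij spaces. For $1\le p<\infty$, $0<\rho<1$ and $f\in L^p(\Omega')$ the Slobodeckij (Gagliardo) seminorm is $$[f]_{\rho,p,\Omega'}=\Big(\int_{\Omega'}\int_{\Omega'}\frac{|f(\boldsymbol{x})-f(\boldsymbol{y})|^p}{|\boldsymbol{x}-\boldsymbol{y}|^{\rho p+d}}\,d\boldsymbol{x}\,d\boldsymbol{y}\Big)^{1/p}.$$ For $s>0$, $f\in W^{s,p}(\Omega')$ if $f$ is in the Sobolev space $W^{\lfloor s\rfloor,p}(\Omega')$ and $\max_{|\boldsymbol{\beta}|=\lfloor s\rfloor}[\partial^{\boldsymbol{\beta}}f]_{s-\lfloor s\rfloor,p,\Omega'}<\infty$; for integer $s$, $W^{s,p}(\Omega')$ is the usual Sobolev space. Cluster trees. Let $X=\{\boldsymbol{x}_1,\dots,\boldsymbol{x}_N\}\subset\Omega$ be a set of $N$ data sites, assumed quasi-uniform (fill distance similar to separation radius). A cluster tree $\mathcal{T}$ for $X$ is a tree whose nodes (clusters) are subsets of $X$, whose root is $X$, and in which every non-leaf node is the disjoint union of its children. The level $j_\tau$ of $\tau$ is the number of edges from the root to $\tau$; the depth $J$ is the maximal level. $\#\tau$ is the cardinality of $\tau$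 and $\operatorname{diam}(\tau)=\max_{\boldsymbol{x}_i,\boldsymbol{x}_j\in\tau}\|\boldsymbol{x}_i-\boldsymbol{x}_j\|_2$. A $2^d$-tree is a cluster tree of depth $J$ in which every cluster $\tau$ with $j_\tau<J$ has exactly $2^d$ children. It is balanced if $\#\tau\sim N2^{-j_\tau d}$. The $2^d$-tree is obtained by geometric clustering, i.e. recursive dyadic subdivision of the edges of the bounding box; for $\Omega=[0,1]^d$, a cluster on level $j$ is then contained in a dyadic cube of side length $2^{-j}$ (diameter $\sqrt d\,2^{-j}$). Samplets. For a functional $\sigma=\sum_{i=1}^N\omega_i\delta_{\boldsymbol{x}_i}$ put $(\sigma,f)_\Omega=\sum_{i=1}^N\omega_i f(\boldsymbol{x}_i)$. The span $\mathcal{X}'$ of $\delta_{\boldsymbol{x}_1},\dots,\delta_{\boldsymbol{x}_N}$ carries the inner product $\langle\sum u_i\delta_{\boldsymbol{x}_i},\sum v_i\delta_{\boldsymbol{x}_i}\rangle=\sum u_iv_i$. $\mathcal{P}_q(\Omega)$ denotes the polynomials of total degree at most $q$. Samplets are built recursively from the leaves to the root of $\mathcal{T}$: for a cluster $\tau$ on level $j$, one collects the scaling distributions $\boldsymbol{\Phi}^\tau_{j+1}$ of its children (for a leaf: the $\delta_{\boldsymbol{x}_i}$, $\boldsymbol{x}_i\in\tau$), takes the orthogonal factor $\boldsymbol{Q}^\tau_j=[\boldsymbol{Q}^\tau_{j,\Phi},\boldsymbol{Q}^\tau_{j,\Sigma}]$ of a QR decomposition of the transpose of the moment matrix $[(\boldsymbol{x}^{\boldsymbol{\beta}},\boldsymbol{\Phi}^\tau_{j+1})_\Omega]_{|\boldsymbol{\beta}|\le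 q}$, and sets $[\boldsymbol{\Phi}^\tau_j,\boldsymbol{\Sigma}^\tau_j]=\boldsymbol{\Phi}^\tau_{j+1}\boldsymbol{Q}^\tau_j$; the elements of $\boldsymbol{\Sigma}^\tau_j$ are the samplets $\sigma_{j,k}$ of $\tau$ (with $j$ the level and $k$ an index within the level), those of $\boldsymbol{\Phi}_j^\tau$ its scaling distributions. A samplet $\sigma_{j,k}$ supported on $\tau$ has the form $\sigma_{j,k}=\sum_{\boldsymbol{x}_\ell\in\tau}\omega^{(\ell)}_{j,k}\delta_{\boldsymbol{x}_\ell}$ with $\sum_\ell|\omega^{(\ell)}_{j,k}|^2=1$, and the samplets are orthonormal in $\mathcal{X}'$.
   Formalization: Since f is controlled only on Ω', a constant uniform over all data sets fails if f is unbounded elsewhere; the formal bound is for clusters with |f| ≤ M at their sites outside Ω', with a constant that may depend on M (no condition for clusters inside Ω'). *)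

theory Defs
  imports "HOL-Analysis.Analysis"
begin

section \<open>Multi-indices, polynomials, partial derivatives\<close>

definition order_of :: "('d::finite \<Rightarrow> nat) \<Rightarrow> nat" where
  "order_of \<beta> = (\<Sum>i\<in>UNIV. \<beta> i)"

definition monomial :: "('d::finite \<Rightarrow> nat) \<Rightarrow> real^'d \<Rightarrow> real" where
  "monomial \<beta> x = (\<Prod>i\<in>UNIV. (x $ i) ^ \<beta> i)"

definition polys :: "nat \<Rightarrow> (real^'d::finite \<Rightarrow> real) set" where
  "polys q = {P. \<exists>c. P = (\<lambda>x. \<Sum>\<beta> | order_of \<beta> \<le> q. c \<beta> * monomial \<beta> x)}"

primrec partials :: "'d::finite list \<Rightarrow> (real^'d \<Rightarrow> real) \<Rightarrow> real^'d \<Rightarrow> real" where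
  "partials [] g = g"
| "partials (i # is) g = (\<lambda>x. frechet_derivative (partials is g) (at x) (axis i 1))"

text \<open>If all iterated partial derivatives exist and are (Frechet) differentiable, then they are all
  continuous; so this is smoothness.\<close>

definition smooth :: "(real^'d::finite \<Rightarrow> real) \<Rightarrow> bool" where
  "smooth g \<longleftrightarrow> (\<forall>is x. partials is g differentiable (at x))"

definition test_function :: "(real^'d::finite) set \<Rightarrow> (real^'d \<Rightarrow> real) \<Rightarrow> bool" where
  "test_function U \<phi> \<longleftrightarrow> smooth \<phi> \<and> compact (closure {x. \<phi> x \<noteq> 0}) \<and> closure {x. \<phi> x \<noteq> 0} \<subseteq> U"


section \<open>Sobolev--Slobodeckij spaces\<close>

definition Lp :: "real \<Rightarrow> (real^'d::finite) set \<Rightarrow> (real^'d \<Rightarrow> real) set" where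
  "Lp p U = {f \<in> borel_measurable (lebesgue_on U). integrable (lebesgue_on U) (\<lambda>x. \<bar>f x\<bar> powr p)}"

text \<open>Test functions are supported in the interior, so that the domain may be a closed ball. Every
  list \<open>is\<close> in which each \<open>i\<close> occurs \<open>\<beta> i\<close> times yields the same derivative \<open>\<partial>\<^sup>\<beta> \<phi>\<close> of the smooth
  function \<open>\<phi>\<close>.\<close>

definition weak_deriv ::
    "(real^'d::finite) set \<Rightarrow> ('d \<Rightarrow> nat) \<Rightarrow> (real^'d \<Rightarrow> real) \<Rightarrow> (real^'d \<Rightarrow> real) \<Rightarrow> bool" where
  "weak_deriv U \<beta> f g \<longleftrightarrow>
     (\<forall>\<phi> is. test_function (interior U) \<phi> \<longrightarrow> (\<forall>i. count_list is i = \<beta> i) \<longrightarrow>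
        (LINT x|lebesgue_on U. f x * partials is \<phi> x) =
        (-1) ^ order_of \<beta> * (LINT x|lebesgue_on U. g x * \<phi> x))"

definition sobolev_nat :: "nat \<Rightarrow> real \<Rightarrow> (real^'d::finite) set \<Rightarrow> (real^'d \<Rightarrow> real) set" where
  "sobolev_nat k p U =
     {f \<in> Lp p U. \<forall>\<beta>. order_of \<beta> \<le> k \<longrightarrow> (\<exists>g\<in>Lp p U. weak_deriv U \<beta> f g)}"

text \<open>The \<open>p\<close>-th power of the Slobodeckij seminorm. On the diagonal the integrand is \<open>0 / 0 = 0\<close>.\<close>

definition slobodeckij_pow ::
    "real \<Rightarrow> real \<Rightarrow> (real^'d::finite) set \<Rightarrow> (real^'d \<Rightarrow> real) \<Rightarrow> ennreal" where
  "slobodeckij_pow \<rho> p U f =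
     (\<integral>\<^sup>+x. \<integral>\<^sup>+y. ennreal (\<bar>f x - f y\<bar> powr p / norm (x - y) powr (\<rho> * p + real CARD('d)))
        \<partial>lebesgue_on U \<partial>lebesgue_on U)"

text \<open>Weak derivatives are unique almost everywhere, and the seminorm does not depend on the
  representative.\<close>

definition sobolev :: "real \<Rightarrow> real \<Rightarrow> (real^'d::finite) set \<Rightarrow> (real^'d \<Rightarrow> real) set" where
  "sobolev s p U =
     {f \<in> sobolev_nat (nat \<lfloor>s\<rfloor>) p U.
        s \<notin> \<int> \<longrightarrow> (\<forall>\<beta>. order_of \<beta> = nat \<lfloor>s\<rfloor> \<longrightarrow>
          (\<exists>g\<in>Lp p U. weak_deriv U \<beta> f g \<and> slobodeckij_pow (s - of_int \<lfloor>s\<rfloor>) p U g < \<infinity>))}"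


section \<open>Regions and data sites\<close>

text \<open>An open connected set together with some of its boundary points; this includes the closed
  unit cube.\<close>

definition region :: "(real^'d::finite) set \<Rightarrow> bool" where
  "region \<Omega> \<longleftrightarrow> (\<exists>U. open U \<and> connected U \<and> U \<noteq> {} \<and> U \<subseteq> \<Omega> \<and> \<Omega> \<subseteq> closure U)"

text \<open>Values in \<open>ennreal\<close>: the fill distance may be infinite, and the separation radius of a
  singleton is infinite.\<close>

definition fill_distance :: "(real^'d::finite) set \<Rightarrow> (real^'d) set \<Rightarrow> ennreal" where
  "fill_distance \<Omega> X = (SUP x\<in>\<Omega>. INF y\<in>X. ennreal (dist x y))"

definition separation_radius :: "(real^'d::finite) set \<Rightarrow> ennreal" where
  "separation_radius X = (INF x\<in>X. INF y\<in>X - {x}. ennreal (dist x y / 2))"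

definition quasi_uniform :: "real \<Rightarrow> (real^'d::finite) set \<Rightarrow> (real^'d) set \<Rightarrow> bool" where
  "quasi_uniform \<kappa> \<Omega> X \<longleftrightarrow>
     fill_distance \<Omega> X \<le> ennreal \<kappa> * separation_radius X \<and>
     separation_radius X \<le> ennreal \<kappa> * fill_distance \<Omega> X"

definition data_sites :: "real \<Rightarrow> (real^'d::finite) set \<Rightarrow> (real^'d) set \<Rightarrow> bool" where
  "data_sites \<kappa> \<Omega> X \<longleftrightarrow> finite X \<and> X \<subseteq> \<Omega> \<and> quasi_uniform \<kappa> \<Omega> X"


section \<open>Cluster trees\<close>

datatype 'd cluster_tree =
  Cluster (sites: "(real^'d) set") (children: "'d cluster_tree list")

primrec nodes_at :: "nat \<Rightarrow> 'd::finite cluster_tree \<Rightarrow> 'd cluster_tree set" where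
  "nodes_at 0 T = {T}"
| "nodes_at (Suc j) T = (\<Union>S\<in>set (children T). nodes_at j S)"

definition nodes :: "'d::finite cluster_tree \<Rightarrow> 'd cluster_tree set" where
  "nodes T = (\<Union>j. nodes_at j T)"

definition depth :: "'d::finite cluster_tree \<Rightarrow> nat" where
  "depth T = Max {j. nodes_at j T \<noteq> {}}"

definition is_cluster_tree :: "(real^'d::finite) set \<Rightarrow> 'd cluster_tree \<Rightarrow> bool" where
  "is_cluster_tree X T \<longleftrightarrow> sites T = X \<and>
     (\<forall>S\<in>nodes T. children S \<noteq> [] \<longrightarrow>
        disjoint_family_on (\<lambda>i. sites (children S ! i)) {..<length (children S)} \<and>
        sites S = (\<Union>c\<in>set (children S). sites c))"

definition is_2d_tree :: "'d::finite cluster_tree \<Rightarrow> bool" where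
  "is_2d_tree T \<longleftrightarrow> (\<forall>j<depth T. \<forall>S\<in>nodes_at j T. length (children S) = 2 ^ CARD('d))"

definition balanced :: "real \<Rightarrow> 'd::finite cluster_tree \<Rightarrow> bool" where
  "balanced K T \<longleftrightarrow> (\<forall>j. \<forall>S\<in>nodes_at j T.
     real (card (sites S)) \<le> K * (real (card (sites T)) * 2 powr (- real j * real CARD('d))) \<and>
     real (card (sites T)) * 2 powr (- real j * real CARD('d)) \<le> K * real (card (sites S)))"

text \<open>\<open>geometric a h T\<close>: the tree arises from dyadic subdivision of the cube with lower corner \<open>a\<close>
  and side length \<open>h\<close>, one child for each of the \<open>2^d\<close> subcubes. A site on a face shared by
  several subcubes may be assigned to any one of them.\<close>

inductive geometric :: "real^'d::finite \<Rightarrow> real \<Rightarrow> 'd cluster_tree \<Rightarrow> bool" where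
  leaf: "Y \<subseteq> cbox a (a + h *\<^sub>R 1) \<Longrightarrow> geometric a h (Cluster Y [])"
| node: "Y \<subseteq> cbox a (a + h *\<^sub>R 1) \<Longrightarrow>
         bij_betw v {..<length cs} {e. \<forall>i. e $ i = 0 \<or> e $ i = 1} \<Longrightarrow>
         (\<forall>k<length cs. geometric (a + (h / 2) *\<^sub>R v k) (h / 2) (cs ! k)) \<Longrightarrow>
         geometric a h (Cluster Y cs)"


section \<open>Samplets\<close>

text \<open>The functional \<open>\<Sum>x\<in>X. \<omega> x * \<delta>\<^sub>x\<close> is represented by its weight function \<open>\<omega>\<close>, so that \<open>\<delta>\<^sub>x\<close> is
  \<open>indicator {x}\<close>.\<close>

type_synonym 'd functional = "real^'d \<Rightarrow> real"

definition pairing :: "(real^'d::finite) set \<Rightarrow> 'd functional \<Rightarrow> (real^'d \<Rightarrow> real) \<Rightarrow> real" where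
  "pairing X \<omega> f = (\<Sum>x\<in>X. \<omega> x * f x)"

text \<open>\<open>A = Q R\<close> for an \<open>n \<times> m\<close> matrix \<open>A\<close>, with \<open>Q\<close> orthogonal of size \<open>n \<times> n\<close> and \<open>R\<close> upper
  triangular of size \<open>n \<times> m\<close>; entries outside these ranges are irrelevant.\<close>

definition is_QR ::
    "nat \<Rightarrow> nat \<Rightarrow> (nat \<Rightarrow> nat \<Rightarrow> real) \<Rightarrow> (nat \<Rightarrow> nat \<Rightarrow> real) \<Rightarrow> (nat \<Rightarrow> nat \<Rightarrow> real) \<Rightarrow> bool" where
  "is_QR n m A Q R \<longleftrightarrow>
     (\<forall>i<n. \<forall>j<n. (\<Sum>k<n. Q k i * Q k j) = (if i = j then 1 else 0)) \<and>
     (\<forall>i<n. \<forall>j<m. j < i \<longrightarrow> R i j = 0) \<and>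
     (\<forall>i<n. \<forall>j<m. A i j = (\<Sum>k<n. Q i k * R k j))"

text \<open>One step of the construction: \<open>\<Gamma>\<close> lists the distributions collected at a cluster and \<open>A\<close> is
  the transposed moment matrix, for some enumeration \<open>\<beta>s\<close> of the multi-indices. The number of
  columns of the first block of \<open>Q\<close> is left open: the scaling distributions \<open>\<phi>\<close> may be any initial
  part of the transformed distributions; it is the vanishing moment condition that forces the
  remaining part to consist of samplets in the usual sense.\<close>

definition samplet_step ::
    "nat \<Rightarrow> (real^'d::finite) set \<Rightarrow> 'd functional list \<Rightarrow> 'd functional list \<Rightarrow> 'd functional list \<Rightarrow> bool"
  where
  "samplet_step q X \<Gamma> \<phi> \<sigma> \<longleftrightarrow>
     (\<exists>\<beta>s Q R. distinct \<beta>s \<and> set \<beta>s = {\<beta>. order_of \<beta> \<le> q} \<and>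
        is_QR (length \<Gamma>) (length \<beta>s) (\<lambda>i l. pairing X (\<Gamma> ! i) (monomial (\<beta>s ! l))) Q R \<and>
        \<phi> @ \<sigma> = map (\<lambda>l x. \<Sum>i<length \<Gamma>. Q i l * (\<Gamma> ! i) x) [0..<length \<Gamma>])"

text \<open>\<open>\<Phi> S\<close> and \<open>\<Psi> S\<close> are the scaling distributions and the samplets of the node \<open>S\<close>. A QR
  decomposition is not unique, hence a relation rather than a function.\<close>

definition samplet_system ::
    "nat \<Rightarrow> (real^'d::finite) set \<Rightarrow> 'd cluster_tree \<Rightarrow>
     ('d cluster_tree \<Rightarrow> 'd functional list) \<Rightarrow> ('d cluster_tree \<Rightarrow> 'd functional list) \<Rightarrow> bool" where
  "samplet_system q X T \<Phi> \<Psi> \<longleftrightarrow>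
     (\<forall>S\<in>nodes T.
        if children S = []
        then \<exists>xs. distinct xs \<and> set xs = sites S \<and>
               samplet_step q X (map (\<lambda>x. indicator {x}) xs) (\<Phi> S) (\<Psi> S)
        else samplet_step q X (concat (map \<Phi> (children S))) (\<Phi> S) (\<Psi> S))"

definition vanishing_moments ::
    "nat \<Rightarrow> (real^'d::finite) set \<Rightarrow> 'd cluster_tree \<Rightarrow> ('d cluster_tree \<Rightarrow> 'd functional list) \<Rightarrow> bool"
  where
  "vanishing_moments q X T \<Psi> \<longleftrightarrow>
     (\<forall>S\<in>nodes T. \<forall>\<sigma>\<in>set (\<Psi> S). \<forall>P\<in>polys q. pairing X \<sigma> P = 0)"

end

theory Submission
  imports Defs
begin

text \<open>
  Put \<open>t = s - d / p\<close>. A samplet \<open>\<sigma>\<close> of a cluster is a unit vector of weights on the sites of the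
  cluster, so by the Cauchy--Schwarz inequality \<open>\<bar>(\<sigma>, u)\<bar>\<close> is at most \<open>sqrt (#\<tau>)\<close> times the maximum
  of \<open>\<bar>u\<bar>\<close> over the cluster. Since \<open>\<sigma>\<close> annihilates polynomials of degree at most \<open>q\<close>, one may subtract
  such a polynomial from \<open>f\<close> first. Everything therefore rests on a local approximation property of \<open>f\<close>:
  for every small \<open>h\<close> some polynomial of degree at most \<open>\<lfloor>t\<rfloor>\<close> is within \<open>C h\<^sup>t\<close> of \<open>f\<close> on the ball
  of radius \<open>h\<close> around \<open>x0\<close>. When \<open>diam \<tau>\<close> is at most 1, \<open>h\<^sup>t\<close> is at most \<open>h\<close> to the power
  \<open>t - \<epsilon>\<close>, whence one constant serves all \<open>\<epsilon>\<close>. Clusters that are not small only need that \<open>f\<close> is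
  bounded on their sites, and for a cluster of diameter 0, which is \<open>{x0}\<close>, subtracting the constant \<open>f x0\<close> gives 0.

  The approximation property (\<open>sobolev_local_polynomial_approximation\<close>) is proved by a dyadic
  decomposition of the point evaluation. For a kernel \<open>\<phi>\<close> of integral 1 let \<open>\<phi>\<^sub>\<rho>\<close> be its \<open>L\<^sup>1\<close>-normalised
  dilation by \<open>\<rho>\<close> and \<open>f\<^sub>\<rho>\<close> the corresponding mollification of \<open>f\<close>. The kernel is chosen such that
  \<open>\<phi> - \<phi>\<^sub>1\<^sub>/\<^sub>2\<close> is a sum of pure partial derivatives of order \<open>\<lfloor>s\<rfloor> + 1\<close> of test functions
  (\<open>exists_kernel\<close>). Integration by parts moves \<open>\<lfloor>s\<rfloor>\<close> of these derivatives to \<open>f\<close>; the remaining one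
  makes the integral of the test function vanish, and this lets the Slobodeckij seminorm of the weak
  derivative enter (\<open>sobolev_duality\<close>). The outcome is that \<open>f\<^sub>\<rho> - f\<^sub>\<rho>\<^sub>/\<^sub>2\<close> is \<open>O(\<rho>\<^sup>t)\<close>, and that its
  Taylor remainder of order \<open>n\<close> at distance \<open>\<bar>v\<bar> \<le> \<rho>\<close> is \<open>O(\<bar>v\<bar>\<^sup>n \<rho>\<close> to the power \<open>t - n)\<close>.
  For \<open>n = \<lfloor>t\<rfloor> + 1 > t\<close> the remainders of all scales \<open>\<rho>\<close> above \<open>h\<close> sum to \<open>O(h\<^sup>t)\<close>, and so do the
  full differences of all scales below \<open>h\<close>, as \<open>t > 0\<close>. Hence the Taylor polynomial of \<open>f\<^sub>h\<close> of
  degree \<open>\<lfloor>t\<rfloor>\<close> is the desired approximation.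

  Taylor remainders are taken of the kernel and not of \<open>f\<^sub>\<rho>\<close>. In this way a remainder is again the
  pairing of \<open>f\<close> with derivatives of a test function, of which only the supremum norm matters. This
  needs partial derivatives to commute, which is evident for tensor products of functions of one
  variable; so all kernels are built from these.

  The bound for balanced \<open>2\<^sup>d\<close>-trees follows by inserting \<open>diam \<tau> \<le> sqrt d 2\<^sup>-\<^sup>j\<close>
  (\<open>geometric_diameter\<close>) and the bound on \<open>#\<tau>\<close> that balance provides.
\<close>

section \<open>Smooth functions of one variable\<close>

definition smooth1 :: "(real \<Rightarrow> real) \<Rightarrow> bool" where
  "smooth1 h \<longleftrightarrow> (\<forall>n x. (deriv ^^ n) h field_differentiable at x)"

lemma smooth1_diff: "smooth1 h \<Longrightarrow> (deriv ^^ n) h field_differentiable at x"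
  by (simp add: smooth1_def)

lemma smooth1_DERIV: "smooth1 h \<Longrightarrow> ((deriv ^^ n) h has_real_derivative (deriv ^^ Suc n) h x) (at x)"
  by (simp add: DERIV_deriv_iff_field_differentiable smooth1_diff)

lemma smooth1_deriv_pow: "smooth1 h \<Longrightarrow> smooth1 ((deriv ^^ n) h)"
  unfolding smooth1_def by (metis funpow_add o_apply)

lemma smooth1_continuous: "smooth1 h \<Longrightarrow> continuous_on S h"
  using smooth1_diff[of h 0]
  by (simp add: continuous_at_imp_continuous_on field_differentiable_imp_continuous_at)

lemma smooth1I:
  assumes "\<And>x. (h has_real_derivative h' x) (at x)" and "smooth1 h'"
  shows "smooth1 h"
proof -
  have d: "deriv h = h'" using assms(1) by (auto intro!: DERIV_imp_deriv)
  have "(deriv ^^ n) h field_differentiable at x" for n x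
  proof (cases n)
    case 0 then show ?thesis using assms(1) by (auto simp: field_differentiable_def)
  next
    case (Suc m)
    then have "(deriv ^^ n) h = (deriv ^^ m) h'" by (simp add: funpow_swap1 d)
    then show ?thesis using assms(2) by (simp add: smooth1_def)
  qed
  then show ?thesis by (simp add: smooth1_def)
qed

lemma deriv_pow_lincomb:
  assumes "smooth1 h" "smooth1 k"
  shows "(deriv ^^ n) (\<lambda>t. a * h t + b * k t) = (\<lambda>t. a * (deriv ^^ n) h t + b * (deriv ^^ n) k t)"
proof (induction n)
  case (Suc n)
  have "((\<lambda>t. a * (deriv ^^ n) h t + b * (deriv ^^ n) k t) has_real_derivative
      a * (deriv ^^ Suc n) h t + b * (deriv ^^ Suc n) k t) (at t)" for t
    using assms by (intro DERIV_add DERIV_cmult smooth1_DERIV)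
  then show ?case by (auto simp: Suc intro!: DERIV_imp_deriv)
qed simp

lemma smooth1_lincomb:
  assumes "smooth1 h" "smooth1 k" shows "smooth1 (\<lambda>t. a * h t + b * k t)"
  unfolding smooth1_def deriv_pow_lincomb[OF assms]
  by (intro allI field_differentiable_add field_differentiable_mult field_differentiable_const
      smooth1_diff assms)

lemma deriv_pow_affine:
  assumes "smooth1 h"
  shows "(deriv ^^ n) (\<lambda>t. h (c * t + a)) = (\<lambda>t. c ^ n * (deriv ^^ n) h (c * t + a))"
proof (induction n)
  case (Suc n)
  have "((\<lambda>t. c ^ n * (deriv ^^ n) h (c * t + a)) has_real_derivative
      c ^ Suc n * (deriv ^^ Suc n) h (c * t + a)) (at t)" for t
    by (rule derivative_eq_intros DERIV_chain2[OF smooth1_DERIV[OF assms]] refl)+ simp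
  then show ?case by (auto simp: Suc intro!: DERIV_imp_deriv)
qed simp

lemma smooth1_affine:
  assumes "smooth1 h" shows "smooth1 (\<lambda>t. h (c * t + a))"
  unfolding smooth1_def deriv_pow_affine[OF assms]
proof (intro allI)
  fix n x
  have "((\<lambda>t. c ^ n * (deriv ^^ n) h (c * t + a)) has_real_derivative
      c ^ Suc n * (deriv ^^ Suc n) h (c * x + a)) (at x)"
    by (rule derivative_eq_intros DERIV_chain2[OF smooth1_DERIV[OF assms]] refl)+ simp
  then show "(\<lambda>t. c ^ n * (deriv ^^ n) h (c * t + a)) field_differentiable at x"
    by (auto simp: field_differentiable_def)
qed

lemma smooth1_mult:
  assumes "smooth1 h" "smooth1 k" shows "smooth1 (\<lambda>t. h t * k t)"
proof -
  define D where "D n g \<longleftrightarrow> (\<forall>m<n. \<forall>x. (deriv ^^ m) g field_differentiable at x)"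
    for n and g :: "real \<Rightarrow> real"
  have D_Suc: "D (Suc n) g \<longleftrightarrow> (\<forall>x. g field_differentiable at x) \<and> D n (deriv g)" for n g
    unfolding D_def by (auto simp: less_Suc_eq_0_disj funpow_swap1)
  have D_less: "D n g" if "D (Suc n) g" for n g using that by (simp add: D_def)
  have D_add: "D n (\<lambda>t. u t + v t)" if "D n u" "D n v" for n u v
    using that
  proof (induction n arbitrary: u v)
    case 0 then show ?case by (simp add: D_def)
  next
    case (Suc n)
    from Suc.prems have uv: "\<And>x. u field_differentiable at x" "\<And>x. v field_differentiable at x"
      by (auto simp: D_Suc)
    have "deriv (\<lambda>t. u t + v t) = (\<lambda>t. deriv u t + deriv v t)"
      by (rule ext) (rule deriv_add[OF uv])
    with Suc uv show ?case by (auto simp: D_Suc intro!: field_differentiable_add)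
  qed
  have D_mult: "D n (\<lambda>t. u t * v t)" if "D n u" "D n v" for n u v
    using that
  proof (induction n arbitrary: u v)
    case 0 then show ?case by (simp add: D_def)
  next
    case (Suc n)
    from Suc.prems have uv: "\<And>x. u field_differentiable at x" "\<And>x. v field_differentiable at x"
      by (auto simp: D_Suc)
    have "deriv (\<lambda>t. u t * v t) = (\<lambda>t. u t * deriv v t + deriv u t * v t)"
      by (rule ext) (rule deriv_mult[OF uv])
    moreover have "D n (\<lambda>t. u t * deriv v t + deriv u t * v t)"
      using Suc.prems D_less[of n u] D_less[of n v] by (intro D_add Suc.IH) (auto simp: D_Suc)
    ultimately show ?case using uv by (auto simp: D_Suc intro!: field_differentiable_mult)
  qed
  have "D n h" "D n k" for n using assms by (auto simp: D_def smooth1_def)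
  then have "D n (\<lambda>t. h t * k t)" for n by (rule D_mult)
  then show ?thesis unfolding D_def smooth1_def by blast
qed

text \<open>The functions \<open>P (1 / t) exp (- 1 / t)\<close>, extended by 0 to the left half line. The family is closed
  under differentiation, which makes each member smooth.\<close>

definition flat :: "real poly \<Rightarrow> real \<Rightarrow> real" where
  "flat P t = (if t > 0 then poly P (1 / t) * exp (- (1 / t)) else 0)"

lemma poly_exp_neg_tendsto_0: "((\<lambda>x::real. poly P x * exp (- x)) \<longlongrightarrow> 0) at_top"
proof -
  have "((\<lambda>x. \<Sum>i\<le>degree P. coeff P i * (x ^ i / exp x)) \<longlongrightarrow> (\<Sum>i\<le>degree P. coeff P i * 0)) at_top"
    by (intro tendsto_intros tendsto_power_div_exp_0)
  then show ?thesis
    by (simp add: poly_altdef sum_distrib_right exp_minus divide_inverse mult.assoc)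
qed

lemma flat_DERIV: "(flat P has_real_derivative flat (monom 1 2 * (P - pderiv P)) t) (at t)"
proof -
  consider "t > 0" | "t < 0" | "t = 0" by linarith
  then show ?thesis
  proof cases
    case 1
    have "((\<lambda>t. poly P (1 / t) * exp (- (1 / t))) has_real_derivative
        flat (monom 1 2 * (P - pderiv P)) t) (at t)"
      using 1 by (auto intro!: derivative_eq_intros DERIV_chain2[OF poly_DERIV]
          simp: flat_def poly_monom field_simps power2_eq_square)
    then show ?thesis
      by (rule has_field_derivative_transform_within_open[where S="{0<..}"]) (use 1 in \<open>auto simp: flat_def\<close>)
  next
    case 2
    have "((\<lambda>t. 0) has_real_derivative flat (monom 1 2 * (P - pderiv P)) t) (at t)"
      using 2 by (auto simp: flat_def)
    then show ?thesis
      by (rule has_field_derivative_transform_within_open[where S="{..<0}"]) (use 2 in \<open>auto simp: flat_def\<close>)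
  next
    case 3
    have r: "((\<lambda>h. flat P h / h) \<longlongrightarrow> 0) (at_right 0)"
    proof (rule Lim_transform_eventually)
      have "((\<lambda>x. poly (pCons 0 P) x * exp (- x)) \<longlongrightarrow> 0) at_top"
        by (rule poly_exp_neg_tendsto_0)
      then show "((\<lambda>h. poly (pCons 0 P) (inverse h) * exp (- inverse h)) \<longlongrightarrow> 0) (at_right 0)"
        by (rule filterlim_compose[OF _ filterlim_inverse_at_top_right])
      show "\<forall>\<^sub>F h in at_right 0. poly (pCons 0 P) (inverse h) * exp (- inverse h) = flat P h / h"
        by (auto simp: eventually_at_filter flat_def field_simps)
    qed
    have l: "((\<lambda>h. flat P h / h) \<longlongrightarrow> 0) (at_left 0)"
      by (rule Lim_transform_eventually[OF tendsto_const]) (auto simp: eventually_at_filter flat_def)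
    have "((\<lambda>h. flat P h / h) \<longlongrightarrow> 0) (at 0)"
      using l r by (simp add: filterlim_at_split)
    then show ?thesis using 3 by (simp add: DERIV_def flat_def)
  qed
qed

lemma smooth1_flat: "smooth1 (flat P)"
proof -
  have "\<exists>Q. (deriv ^^ n) (flat P) = flat Q" for n
  proof (induction n)
    case (Suc n)
    then obtain Q where "(deriv ^^ n) (flat P) = flat Q" by blast
    then have "(deriv ^^ Suc n) (flat P) = flat (monom 1 2 * (Q - pderiv Q))"
      by (auto intro!: DERIV_imp_deriv flat_DERIV)
    then show ?case by blast
  qed auto
  then show ?thesis unfolding smooth1_def using flat_DERIV field_differentiable_def by metis
qed

section \<open>A mollifier whose dyadic differences are high derivatives\<close>

lemma integrable_compact_support:
  fixes g :: "'a::euclidean_space \<Rightarrow> real"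
  assumes "continuous_on UNIV g" "compact S" "\<And>x. x \<notin> S \<Longrightarrow> g x = 0"
  shows "integrable lborel g"
proof -
  have "integrable lborel (\<lambda>x. indicator S x *\<^sub>R g x)"
    using assms by (intro borel_integrable_compact) (auto intro: continuous_on_subset)
  moreover have "(\<lambda>x. indicator S x *\<^sub>R g x) = g" using assms(3) by (force simp: indicator_def)
  ultimately show ?thesis by simp
qed

lemma exists_bump:
  "\<exists>b. smooth1 b \<and> (\<forall>t. \<bar>t\<bar> \<ge> 1 \<longrightarrow> b t = 0) \<and> (LINT t|lborel. b t) = 1"
proof -
  define g where "g t = flat 1 (1 * t + 1) * flat 1 (- 1 * t + 1)" for t
  have sm: "smooth1 g" unfolding g_def by (intro smooth1_mult smooth1_affine smooth1_flat)
  have supp: "g t = 0" if "\<bar>t\<bar> \<ge> 1" for t using that by (auto simp: g_def flat_def)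
  have pos: "g t > 0" if "\<bar>t\<bar> < 1" for t using that by (auto simp: g_def flat_def)
  have nn: "g t \<ge> 0" for t using supp[of t] pos[of t] by (cases "\<bar>t\<bar> < 1") auto
  have int: "integrable lborel g"
    by (rule integrable_compact_support[OF smooth1_continuous[OF sm], of "{-1..1}"])
      (auto intro!: supp)
  define I where "I = (LINT t|lborel. g t)"
  \<comment> \<open>A vanishing integral would make the nonnegative function \<open>g\<close> vanish almost everywhere,
    although it is positive on an interval.\<close>
  have "I \<noteq> 0"
  proof
    assume "I = 0"
    then have "AE t in lborel. g t = 0"
      using integral_nonneg_eq_0_iff_AE[OF int] nn by (auto simp: I_def)
    then have "AE t in lborel. t \<notin> {-1<..<(1::real)}"
      by eventually_elim (use pos in \<open>metis abs_less_iff greaterThanLessThan_iff less_irrefl minus_less_iff\<close>)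
    then have "{-1<..<(1::real)} \<in> null_sets lborel" by (subst AE_iff_null_sets) auto
    then show False by (auto simp: null_sets_def)
  qed
  define b where "b t = (1 / I) * g t + 0 * g t" for t
  have "smooth1 b" unfolding b_def by (intro smooth1_lincomb sm)
  moreover have "(LINT t|lborel. b t) = 1" using \<open>I \<noteq> 0\<close> by (simp add: b_def flip: I_def)
  ultimately show ?thesis using supp by (intro exI[of _ b]) (auto simp: b_def)
qed

text \<open>An antiderivative that vanishes to the left of the support also vanishes to its right, because
  the integral over the support is 0.\<close>

lemma compact_antiderivative:
  assumes sm: "smooth1 k" and supp: "\<And>t. \<bar>t\<bar> \<ge> A \<Longrightarrow> k t = 0" and int: "(LINT t|lborel. k t) = 0"
  shows "\<exists>H. smooth1 H \<and> (\<forall>t. \<bar>t\<bar> \<ge> A \<longrightarrow> H t = 0) \<and> deriv H = k"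
proof (cases "A > 0")
  case True
  obtain F where "\<And>x. (F has_vector_derivative k x) (at x)"
    using einterval_antiderivative[of "-\<infinity>" "\<infinity>" k] smooth1_diff[OF sm, of 0]
    by (auto simp: field_differentiable_imp_continuous_at)
  then have F: "\<And>x. (F has_real_derivative k x) (at x)"
    by (simp add: has_real_derivative_iff_has_vector_derivative)
  define H where "H x = F x - F (- A)" for x
  have H: "(H has_real_derivative k x) (at x)" for x
    unfolding H_def by (auto intro!: derivative_eq_intros F)
  have "F A - F (- A) = (LINT t|lborel. k t * indicator {-A..A} t)"
    using True F by (intro integral_FTC_Icc_real[symmetric])
      (auto intro!: field_differentiable_imp_continuous_at smooth1_diff[OF sm, of 0, simplified])
  also have "(\<lambda>t. k t * indicator {-A..A} t) = k"
  proof
    fix t show "k t * indicator {-A..A} t = k t" using supp[of t] by (auto simp: indicator_def abs_le_iff split: if_splits) (smt (verit))+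
  qed
  finally have HA: "H A = 0" "H (- A) = 0" by (simp_all add: int H_def)
  have "H t = 0" if "\<bar>t\<bar> \<ge> A" for t
  proof (cases "t \<ge> A")
    case True
    have "H t = H A"
    proof (rule has_field_derivative_zero_constant[of "{A..}" H, THEN exE])
      fix x assume "x \<in> {A..}"
      then show "(H has_real_derivative 0) (at x within {A..})"
        using H[of x] supp[of x] by (auto intro: has_field_derivative_at_within)
    qed (use True in auto)
    then show ?thesis using HA by simp
  next
    case False
    have "H t = H (- A)"
    proof (rule has_field_derivative_zero_constant[of "{..-A}" H, THEN exE])
      fix x assume "x \<in> {..-A}"
      then show "(H has_real_derivative 0) (at x within {..-A})"
        using H[of x] supp[of x] \<open>A > 0\<close> by (auto intro: has_field_derivative_at_within)
    qed (use False that \<open>A > 0\<close> in auto)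
    then show ?thesis using HA by simp
  qed
  moreover have "deriv H = k" using H by (auto intro!: DERIV_imp_deriv)
  ultimately show ?thesis using smooth1I[OF H sm] by blast
next
  case False
  then have "k = (\<lambda>t. 0)" using supp by auto
  then show ?thesis using sm by (intro exI[of _ "\<lambda>t. 0"]) auto
qed

text \<open>Induction on the order. If \<open>b(t) - 2 b(2t)\<close> is the derivative of order \<open>N + 1\<close> of \<open>h\<close>, then
  replacing \<open>b\<close> by a combination of \<open>b\<close> and its dilation by 2 replaces \<open>h\<close> in the same way, and the
  two coefficients can be chosen such that the new \<open>h\<close> has integral 0 while \<open>b\<close> keeps integral 1.
  Such an \<open>h\<close> is itself the derivative of a compactly supported function.\<close>

lemma exists_mollifier:
  "\<exists>b h A. A > 0 \<and> smooth1 b \<and> smooth1 h \<and> (\<forall>t. \<bar>t\<bar> \<ge> A \<longrightarrow> b t = 0) \<and> (\<forall>t. \<bar>t\<bar> \<ge> A \<longrightarrow> h t = 0) \<and>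
     (LINT t|lborel. b t) = 1 \<and> (\<forall>t. b t - 2 * b (2 * t) = (deriv ^^ Suc N) h t)"
proof (induction N)
  case 0
  obtain b where b: "smooth1 b" "\<And>t. \<bar>t\<bar> \<ge> 1 \<Longrightarrow> b t = 0" "(LINT t|lborel. b t) = 1"
    using exists_bump by blast
  define k where "k t = 1 * b t + (- 2) * b (2 * t + 0)" for t
  have "smooth1 k" unfolding k_def by (intro smooth1_lincomb smooth1_affine b)
  moreover have "k t = 0" if "\<bar>t\<bar> \<ge> 1" for t using that b(2) by (simp add: k_def)
  moreover have "(LINT t|lborel. k t) = 0"
  proof -
    have i: "integrable lborel b"
      by (rule integrable_compact_support[OF smooth1_continuous[OF b(1)], of "{-1..1}"])
        (auto intro!: b(2))
    have i2: "integrable lborel (\<lambda>t. b (2 * t))"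
      using lborel_integrable_real_affine[OF i, of 2 0] by simp
    have "1 = 2 * (LINT t|lborel. b (2 * t))"
      using lborel_integral_real_affine[of 2 b 0] b(3) by simp
    then show ?thesis using i i2 b(3) by (simp add: k_def)
  qed
  ultimately obtain H where H: "smooth1 H" "\<forall>t. \<bar>t\<bar> \<ge> 1 \<longrightarrow> H t = 0" "deriv H = k"
    using compact_antiderivative[of k 1] by blast
  have "b t - 2 * b (2 * t) = (deriv ^^ Suc 0) H t" for t by (simp add: H k_def)
  with b H show ?case by (intro exI[of _ b] exI[of _ H] exI[of _ 1]) auto
next
  case (Suc N)
  then obtain b h A where *: "A > 0" "smooth1 b" "smooth1 h" "\<And>t. \<bar>t\<bar> \<ge> A \<Longrightarrow> b t = 0"
    "\<And>t. \<bar>t\<bar> \<ge> A \<Longrightarrow> h t = 0" "(LINT t|lborel. b t) = 1"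
    "\<And>t. b t - 2 * b (2 * t) = (deriv ^^ Suc N) h t" by blast
  define q :: real where "q = 2 ^ Suc N"
  have "q \<ge> 2" using power_increasing[of 1 "Suc N" "2::real"] by (simp add: q_def)
  \<comment> \<open>The solution of \<open>\<alpha> + \<beta> = 1\<close>, which preserves the integral of \<open>b\<close>, and \<open>\<alpha> + q \<beta> = 0\<close>, which
    annihilates that of \<open>h\<close>.\<close>
  define \<beta> where "\<beta> = - 1 / (q - 1)"
  define \<alpha> where "\<alpha> = 1 - \<beta>"
  have \<alpha>\<beta>: "\<alpha> + q * \<beta> = 0" using \<open>q \<ge> 2\<close> by (simp add: \<alpha>_def \<beta>_def field_simps)
  define b' where "b' t = \<alpha> * b t + (\<beta> / 2) * b ((1/2) * t + 0)" for t
  define k where "k t = \<alpha> * h t + (\<beta> * q / 2) * h ((1/2) * t + 0)" for t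
  have sm: "smooth1 b'" "smooth1 k"
    unfolding b'_def k_def by (intro smooth1_lincomb smooth1_affine *)+
  have supp: "b' t = 0" "k t = 0" if "\<bar>t\<bar> \<ge> 2 * A" for t
    using that *(1,4,5) by (auto simp: b'_def k_def)
  have int: "(LINT t|lborel. \<alpha> * g t + c * g ((1/2) * t + 0)) = (\<alpha> + 2 * c) * (LINT t|lborel. g t)"
    if g: "smooth1 g" "\<And>t. \<bar>t\<bar> \<ge> A \<Longrightarrow> g t = 0" for g c
  proof -
    have i: "integrable lborel g"
      by (rule integrable_compact_support[OF smooth1_continuous[OF g(1)], of "{-A..A}"])
        (auto intro!: g(2))
    have i2: "integrable lborel (\<lambda>t. g ((1/2) * t))"
      using lborel_integrable_real_affine[OF i, of "1/2" 0] by simp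
    have "(LINT t|lborel. g t) = 1/2 * (LINT t|lborel. g ((1/2) * t))"
      using lborel_integral_real_affine[of "1/2" g 0] by simp
    then show ?thesis using i i2 by (simp add: algebra_simps)
  qed
  have "(LINT t|lborel. k t) = 0" unfolding k_def using \<alpha>\<beta> by (subst int) (use *(3,5) in \<open>auto simp: algebra_simps\<close>)
  moreover have b'1: "(LINT t|lborel. b' t) = 1" unfolding b'_def by (subst int) (use *(2,4,6) in \<open>auto simp: \<alpha>_def\<close>)
  ultimately obtain H where H: "smooth1 H" "\<forall>t. \<bar>t\<bar> \<ge> 2 * A \<longrightarrow> H t = 0" "deriv H = k"
    using compact_antiderivative[OF sm(2), of "2 * A"] supp by blast
  have "b' t - 2 * b' (2 * t) = (deriv ^^ Suc (Suc N)) H t" for t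
  proof -
    have "b' t - 2 * b' (2 * t) = \<alpha> * (b t - 2 * b (2 * t)) + (\<beta> / 2) * (b (t/2) - 2 * b (2 * (t/2)))"
      by (simp add: b'_def algebra_simps)
    also have "\<dots> = \<alpha> * (deriv ^^ Suc N) h t + (\<beta> / 2) * (deriv ^^ Suc N) h (t/2)"
      by (simp only: *(7))
    also have "\<dots> = (deriv ^^ Suc N) k t"
    proof -
      have "(deriv ^^ Suc N) k t = \<alpha> * (deriv ^^ Suc N) h t +
          (\<beta> * q / 2) * ((1/2) ^ Suc N * (deriv ^^ Suc N) h ((1/2) * t + 0))"
        unfolding k_def by (subst deriv_pow_lincomb, intro *, intro smooth1_affine *,
            subst deriv_pow_affine, intro *, rule refl)
      moreover have "q * (1/2) ^ Suc N = 1" by (simp add: q_def power_divide)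
      ultimately show ?thesis by (simp add: algebra_simps del: funpow.simps power_Suc)
    qed
    also have "\<dots> = (deriv ^^ Suc (Suc N)) H t" using H(3) by (simp add: funpow_swap1)
    finally show ?thesis .
  qed
  with *(1) sm supp H b'1 show ?case
    by (intro exI[of _ b'] exI[of _ H] exI[of _ "2 * A"]) auto
qed

section \<open>Iterated partial derivatives\<close>

lemma frechet_partial:
  "(g has_derivative D) (at x) \<Longrightarrow> frechet_derivative g (at x) v = D v"
  by (metis frechet_derivative_at)

lemma partials_append: "partials (L @ M) g = partials L (partials M g)"
  by (induction L) auto

lemma smooth_partials: "smooth g \<Longrightarrow> smooth (partials M g)"
  unfolding smooth_def by (metis partials_append)

lemma smooth_differentiable: "smooth g \<Longrightarrow> g differentiable (at x)"
  unfolding smooth_def by (metis partials.simps(1))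

lemma smooth_continuous: "smooth g \<Longrightarrow> continuous_on S g"
  by (intro continuous_at_imp_continuous_on ballI differentiable_imp_continuous_within smooth_differentiable)

lemma smooth_has_derivative:
  assumes "smooth g"
  shows "(g has_derivative (\<lambda>v. \<Sum>i\<in>UNIV. v $ i * partials [i] g x)) (at x)"
proof -
  let ?D = "frechet_derivative g (at x)"
  have D: "(g has_derivative ?D) (at x)"
    using smooth_differentiable[OF assms] by (simp add: frechet_derivative_works)
  then have lin: "linear ?D" by (rule has_derivative_linear)
  have eq: "?D = (\<lambda>v. \<Sum>i\<in>UNIV. v $ i * partials [i] g x)"
  proof
    fix v
    have "?D v = ?D (\<Sum>i\<in>UNIV. v $ i *\<^sub>R axis i 1)"
      by (simp add: basis_expansion flip: scalar_mult_eq_scaleR)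
    then show "?D v = (\<Sum>i\<in>UNIV. v $ i * partials [i] g x)"
      by (simp add: linear_sum[OF lin] linear_cmul[OF lin])
  qed
  show ?thesis
    by (rule arg_cong[where f="\<lambda>D. (g has_derivative D) (at x)", OF eq, THEN iffD1, OF D])
qed

lemma partials_sum:
  assumes "finite I" and "\<And>a. a \<in> I \<Longrightarrow> smooth (\<psi> a)"
  shows "partials L (\<lambda>y. \<Sum>a\<in>I. c a * \<psi> a y) = (\<lambda>y. \<Sum>a\<in>I. c a * partials L (\<psi> a) y)"
proof (induction L)
  case (Cons i L)
  have "((\<lambda>y. \<Sum>a\<in>I. c a * partials L (\<psi> a) y) has_derivative
      (\<lambda>v. \<Sum>a\<in>I. c a * frechet_derivative (partials L (\<psi> a)) (at x) v)) (at x)" for x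
    using assms
    by (intro has_derivative_sum has_derivative_mult_right)
      (auto simp: smooth_def simp flip: frechet_derivative_works)
  from frechet_partial[OF this] show ?case by (simp add: Cons)
qed simp

lemma smooth_sum:
  assumes "finite I" and "\<And>a. a \<in> I \<Longrightarrow> smooth (\<psi> a)"
  shows "smooth (\<lambda>y. \<Sum>a\<in>I. c a * \<psi> a y)"
  unfolding smooth_def
proof (intro allI)
  fix L x
  have "(\<lambda>y. \<Sum>a\<in>I. c a * partials L (\<psi> a) y) differentiable (at x)"
    using assms by (intro differentiable_sum differentiable_mult differentiable_const ballI)
      (auto simp: smooth_def)
  then show "partials L (\<lambda>y. \<Sum>a\<in>I. c a * \<psi> a y) differentiable (at x)"
    by (simp add: partials_sum[OF assms])
qed

lemma partials_lincomb:
  assumes "smooth u" "smooth w"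
  shows "partials L (\<lambda>y. a * u y + b * w y) = (\<lambda>y. a * partials L u y + b * partials L w y)"
  using partials_sum[of "{True, False}" "\<lambda>t. if t then u else w" L "\<lambda>t. if t then a else b"] assms
  by simp

lemma smooth_lincomb:
  assumes "smooth u" "smooth w" shows "smooth (\<lambda>y. a * u y + b * w y)"
  using smooth_sum[of "{True, False}" "\<lambda>t. if t then u else w" "\<lambda>t. if t then a else b"] assms
  by simp

lemma partials_cmult: "smooth u \<Longrightarrow> partials L (\<lambda>y. a * u y) = (\<lambda>y. a * partials L u y)"
  using partials_lincomb[of u u L a 0] by simp

lemma smooth_cmult: "smooth u \<Longrightarrow> smooth (\<lambda>y. a * u y)"
  using smooth_lincomb[of u u a 0] by simp

lemma has_derivative_affine:
  assumes "smooth g"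
  shows "((\<lambda>y. g (c *\<^sub>R (y - z))) has_derivative
      (\<lambda>v. frechet_derivative g (at (c *\<^sub>R (x - z))) (c *\<^sub>R v))) (at x)"
proof -
  have g: "(g has_derivative frechet_derivative g (at (c *\<^sub>R (x - z)))) (at (c *\<^sub>R (x - z)))"
    using smooth_differentiable[OF assms] by (simp add: frechet_derivative_works)
  have "((\<lambda>y. c *\<^sub>R (y - z)) has_derivative (\<lambda>v. c *\<^sub>R v)) (at x)"
    by (auto intro!: derivative_eq_intros)
  from has_derivative_compose[OF this g] show ?thesis .
qed

lemma partials_affine:
  assumes "smooth g"
  shows "partials L (\<lambda>y. g (c *\<^sub>R (y - z))) = (\<lambda>y. c ^ length L * partials L g (c *\<^sub>R (y - z)))"
proof (induction L)
  case (Cons i L)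
  have "((\<lambda>y. c ^ length L * partials L g (c *\<^sub>R (y - z))) has_derivative
     (\<lambda>v. c ^ length L * frechet_derivative (partials L g) (at (c *\<^sub>R (x - z))) (c *\<^sub>R v))) (at x)" for x
    by (intro has_derivative_mult_right has_derivative_affine smooth_partials assms)
  note D = this
  have "linear (frechet_derivative (partials L g) (at x))" for x
    using assms by (auto simp: smooth_def intro: linear_frechet_derivative)
  then show ?case by (simp add: Cons frechet_partial[OF D] linear_cmul mult_ac)
qed simp

lemma smooth_affine:
  assumes "smooth g" shows "smooth (\<lambda>y. g (c *\<^sub>R (y - z)))"
  unfolding smooth_def
proof (intro allI)
  fix L x
  have "(\<lambda>y. c ^ length L * partials L g (c *\<^sub>R (y - z))) differentiable (at x)"
    by (rule differentiableI[OF has_derivative_mult_right[OF has_derivative_affine[OF smooth_partials[OF assms]]]])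
  then show "partials L (\<lambda>y. g (c *\<^sub>R (y - z))) differentiable (at x)"
    by (simp add: partials_affine[OF assms])
qed

lemma partials_translate:
  assumes "smooth g" shows "partials L (\<lambda>y. g (y - z)) = (\<lambda>y. partials L g (y - z))"
  using partials_affine[OF assms, of L 1 z] by simp

lemma smooth_translate: "smooth g \<Longrightarrow> smooth (\<lambda>y. g (y - z))"
  using smooth_affine[of g 1 z] by simp

text \<open>Partial derivatives of these products are products of derivatives of the factors and hence
  commute.\<close>

definition tensor :: "('d::finite \<Rightarrow> real \<Rightarrow> real) \<Rightarrow> real^'d \<Rightarrow> real" where
  "tensor F y = (\<Prod>j\<in>UNIV. F j (y $ j))"

lemma partials_tensor:
  assumes "\<And>j. smooth1 (F j)"
  shows "partials L (tensor F) = tensor (\<lambda>j. (deriv ^^ count_list L j) (F j))"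
    and "tensor F differentiable (at x)"
proof -
  have D: "(tensor G has_derivative
      (\<lambda>v. \<Sum>j\<in>UNIV. (deriv (G j) (x $ j) * v $ j) * (\<Prod>k\<in>UNIV - {j}. G k (x $ k)))) (at x)"
    if G: "\<And>j. smooth1 (G j)" for G and x :: "real^'d"
  proof -
    have "((\<lambda>y. G j (y $ j)) has_derivative (\<lambda>v. deriv (G j) (x $ j) * v $ j)) (at x)" for j
    proof -
      have "(G j has_derivative (*) (deriv (G j) (x $ j))) (at (x $ j))"
        using smooth1_DERIV[OF G, of 0 j] by (simp add: has_field_derivative_def)
      from has_derivative_compose[OF bounded_linear_imp_has_derivative[OF bounded_linear_vec_nth] this]
      show ?thesis .
    qed
    then show ?thesis unfolding tensor_def[abs_def] by (intro has_derivative_prod) auto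
  qed
  show "tensor F differentiable (at x)" using D[of F x] assms by (auto simp: differentiable_def)
  show "partials L (tensor F) = tensor (\<lambda>j. (deriv ^^ count_list L j) (F j))"
  proof (induction L)
    case (Cons i L)
    let ?G = "\<lambda>j. (deriv ^^ count_list L j) (F j)"
    let ?G' = "\<lambda>j. (deriv ^^ count_list (i # L) j) (F j)"
    have "partials (i # L) (tensor F) x = tensor ?G' x" for x
    proof -
      have "partials (i # L) (tensor F) x =
          (\<Sum>j\<in>UNIV. (deriv (?G j) (x $ j) * axis i 1 $ j) * (\<Prod>k\<in>UNIV - {j}. ?G k (x $ k)))"
        by (simp add: Cons frechet_partial[OF D] smooth1_deriv_pow assms)
      also have "\<dots> = (\<Sum>j\<in>UNIV. if j = i then deriv (?G j) (x $ j) * (\<Prod>k\<in>UNIV - {j}. ?G k (x $ k)) else 0)"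
        by (intro sum.cong) (auto simp: axis_def)
      also have "\<dots> = deriv (?G i) (x $ i) * (\<Prod>k\<in>UNIV - {i}. ?G k (x $ k))"
        by simp
      also have "\<dots> = ?G' i (x $ i) * (\<Prod>k\<in>UNIV - {i}. ?G' k (x $ k))"
        by (intro arg_cong2[where f="(*)"] prod.cong) auto
      also have "\<dots> = tensor ?G' x"
        unfolding tensor_def by (subst prod.remove[of UNIV i]) auto
      finally show ?thesis .
    qed
    then show ?case by blast
  qed simp
qed

lemma smooth_tensor: "(\<And>j. smooth1 (F j)) \<Longrightarrow> smooth (tensor F)"
  unfolding smooth_def by (simp add: partials_tensor smooth1_deriv_pow)

lemma partials_tensor_commute:
  assumes "\<And>j. smooth1 (F j)"
  shows "partials L (partials M (tensor F)) = partials M (partials L (tensor F))"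
  unfolding partials_append[symmetric]
  by (simp add: partials_tensor(1)[OF assms] add.commute)

lemma partials_zero_on_open:
  assumes "open S" "\<And>y. y \<in> S \<Longrightarrow> \<psi> y = 0" "y \<in> S"
  shows "partials L \<psi> y = 0"
  using assms(3)
proof (induction L arbitrary: y)
  case (Cons i L)
  have "(partials L \<psi> has_derivative (\<lambda>v. 0)) (at y)"
    by (rule has_derivative_transform_within_open[OF has_derivative_const assms(1) Cons.prems])
      (simp add: Cons.IH)
  then show ?case by (simp add: frechet_partial)
qed (use assms in auto)

lemma partials_zero_outside_cball:
  assumes "\<And>y. y \<notin> cball z R \<Longrightarrow> \<psi> y = 0" "y \<notin> cball z R"
  shows "partials L \<psi> y = 0"
  by (rule partials_zero_on_open[of "- cball z R"]) (use assms in \<open>auto simp: open_Compl\<close>)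

text \<open>One bound serves all partial derivatives of a given order, as there are finitely many index
  lists of that length.\<close>

lemma smooth_bounded:
  fixes \<psi> :: "real^'d::finite \<Rightarrow> real"
  assumes "smooth \<psi>" "\<And>y. y \<notin> cball z R \<Longrightarrow> \<psi> y = 0"
  shows "\<exists>B\<ge>0. \<forall>L y. length L = n \<longrightarrow> \<bar>partials L \<psi> y\<bar> \<le> B"
proof -
  have "\<exists>B. \<forall>y. \<bar>partials L \<psi> y\<bar> \<le> B" for L
  proof -
    have "bounded (partials L \<psi> ` cball z R)"
      by (intro compact_imp_bounded compact_continuous_image smooth_continuous smooth_partials assms) simp
    then obtain B where "\<forall>y\<in>cball z R. \<bar>partials L \<psi> y\<bar> \<le> B" by (auto simp: bounded_iff)
    then have "\<bar>partials L \<psi> y\<bar> \<le> max B 0" for y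
      using partials_zero_outside_cball[where z=z and R=R and \<psi>=\<psi> and y=y and L=L] assms(2) by (cases "y \<in> cball z R") force+
    then show ?thesis by blast
  qed
  then obtain B where B: "\<And>L y. \<bar>partials L \<psi> y\<bar> \<le> B L" by metis
  have fin: "finite {L :: 'd list. length L = n}" using finite_lists_length_eq[of "UNIV :: 'd set" n] by simp
  have "B L \<le> (\<Sum>L | length L = n. B L)" if "length L = n" for L
  proof -
    have "0 \<le> B L" for L using B[of L z] by linarith
    then show ?thesis using fin that by (intro member_le_sum) auto
  qed
  moreover have "0 \<le> (\<Sum>L | length L = n. B L)"
    using B[of _ z] by (intro sum_nonneg) (metis abs_ge_zero order_trans)
  ultimately show ?thesis using B by (meson order_trans)
qed

section \<open>The Taylor remainder as an operator on kernels\<close>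

text \<open>The coefficient of \<open>partials L \<psi> y\<close> in the Taylor expansion of \<open>\<psi> (y - v)\<close>. Summing over lists of
  indices instead of multi-indices turns the multinomial coefficients into multiplicities.\<close>

definition taylor_coeff :: "real^'d::finite \<Rightarrow> 'd list \<Rightarrow> real" where
  "taylor_coeff v L = (\<Prod>i\<leftarrow>L. - v $ i) / fact (length L)"

text \<open>The remainder as an operator on \<open>\<psi>\<close>. Order 0 means no Taylor terms at all, so that
  \<open>taylor_rem 0 v \<psi>\<close> is the translate of \<open>\<psi>\<close>; the two halves of the dyadic decomposition can thus be
  treated by the same estimate.\<close>

definition taylor_rem :: "nat \<Rightarrow> real^'d::finite \<Rightarrow> (real^'d \<Rightarrow> real) \<Rightarrow> real^'d \<Rightarrow> real" where
  "taylor_rem n v \<psi> y = \<psi> (y - v) - (\<Sum>L | length L < n. taylor_coeff v L * partials L \<psi> y)"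

lemma finite_lists_less: "finite {L :: 'd::finite list. length L < n}"
  by (rule finite_subset[OF _ finite_lists_length_le[of UNIV n]]) auto

text \<open>Lagrange's form of the remainder for the function \<open>\<tau> \<mapsto> \<psi> (y - \<tau> v)\<close> on the unit interval.\<close>

lemma taylor_rem_bound:
  fixes \<psi> :: "real^'d::finite \<Rightarrow> real"
  assumes sm: "smooth \<psi>" and B: "\<And>L y. length L = n \<Longrightarrow> \<bar>partials L \<psi> y\<bar> \<le> B"
  shows "\<bar>taylor_rem n v \<psi> y\<bar> \<le> (real CARD('d) * norm v) ^ n * B"
proof -
  define G where "G l \<tau> = (\<Sum>L | length L = l. (\<Prod>i\<leftarrow>L. - v $ i) * partials L \<psi> (y - \<tau> *\<^sub>R v))" for l \<tau>
  have fin: "finite {L :: 'd list. length L = n}" for n using finite_lists_length_eq[of "UNIV :: 'd set" n] by simp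
  have lists_Suc: "{L :: 'd list. length L = Suc l} = (\<lambda>(i, L). i # L) ` (UNIV \<times> {L. length L = l})" for l
    by (auto simp: length_Suc_conv image_iff)
  have G': "(G l has_real_derivative G (Suc l) \<tau>) (at \<tau>)" for l \<tau>
  proof -
    have 1: "((\<lambda>\<tau>. partials L \<psi> (y - \<tau> *\<^sub>R v)) has_real_derivative
        (\<Sum>i\<in>UNIV. - v $ i * partials (i # L) \<psi> (y - \<tau> *\<^sub>R v))) (at \<tau>)" for L
    proof -
      have "((\<lambda>\<tau>. y - \<tau> *\<^sub>R v) has_derivative (\<lambda>h. - (h *\<^sub>R v))) (at \<tau>)"
        by (auto intro!: derivative_eq_intros)
      from has_derivative_compose[OF this smooth_has_derivative[OF smooth_partials[OF sm]]]
      have "((\<lambda>\<tau>. partials L \<psi> (y - \<tau> *\<^sub>R v)) has_derivative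
        (\<lambda>h. \<Sum>i\<in>UNIV. (- (h *\<^sub>R v)) $ i * partials [i] (partials L \<psi>) (y - \<tau> *\<^sub>R v))) (at \<tau>)" .
      then show ?thesis
        by (rule has_derivative_imp_has_field_derivative) (simp add: sum_distrib_right sum_distrib_left mult_ac)
    qed
    have "(G l has_real_derivative (\<Sum>L | length L = l. (\<Prod>i\<leftarrow>L. - v $ i) *
        (\<Sum>i\<in>UNIV. - v $ i * partials (i # L) \<psi> (y - \<tau> *\<^sub>R v)))) (at \<tau>)"
      unfolding G_def by (intro DERIV_sum DERIV_cmult 1)
    also have "(\<Sum>L | length L = l. (\<Prod>i\<leftarrow>L. - v $ i) *
        (\<Sum>i\<in>UNIV. - v $ i * partials (i # L) \<psi> (y - \<tau> *\<^sub>R v))) = G (Suc l) \<tau>"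
      unfolding G_def lists_Suc
      by (subst sum.reindex)
        (auto simp: inj_on_def sum.cartesian_product' sum_distrib_left mult_ac intro!: sum.swap)
    finally show ?thesis .
  qed
  obtain t where "G 0 1 = (\<Sum>m<n. (G m 0 / fact m) * 1 ^ m) + (G n t / fact n) * 1 ^ n"
    using Maclaurin_all_le[of G "G 0" 1 n] G' by blast
  moreover have "(\<Sum>L | length L < n. taylor_coeff v L * partials L \<psi> y) = (\<Sum>m<n. G m 0 / fact m)"
  proof -
    have "(\<Sum>L | length L < n. taylor_coeff v L * partials L \<psi> y) =
        (\<Sum>m<n. \<Sum>L | L \<in> {L. length L < n} \<and> length L = m. taylor_coeff v L * partials L \<psi> y)"
      by (intro sum.group[symmetric] finite_lists_less) auto
    also have "\<dots> = (\<Sum>m<n. G m 0 / fact m)"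
      unfolding G_def by (intro sum.cong refl)
        (auto simp: sum_divide_distrib taylor_coeff_def intro!: sum.cong)
    finally show ?thesis .
  qed
  moreover have "G 0 1 = \<psi> (y - v)" by (simp add: G_def)
  ultimately have "taylor_rem n v \<psi> y = G n t / fact n" by (simp add: taylor_rem_def)
  then have "\<bar>taylor_rem n v \<psi> y\<bar> \<le> \<bar>G n t\<bar> / 1"
    by (simp add: abs_divide divide_le_eq mult_le_cancel_left1 fact_ge_1)
  also have "\<bar>G n t\<bar> \<le> (\<Sum>L :: 'd list | length L = n. norm v ^ n * B)"
    unfolding G_def
  proof (rule order_trans[OF sum_abs], rule sum_mono)
    fix L :: "'d list" assume L: "L \<in> {L. length L = n}"
    have "\<bar>\<Prod>i\<leftarrow>L. - v $ i\<bar> \<le> norm v ^ length L"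
      by (induction L) (auto simp: abs_mult mult_mono component_le_norm_cart)
    then show "\<bar>(\<Prod>i\<leftarrow>L. - v $ i) * partials L \<psi> (y - t *\<^sub>R v)\<bar> \<le> norm v ^ n * B"
      unfolding abs_mult using L B by (intro mult_mono) auto
  qed
  also have "\<dots> = (real CARD('d) * norm v) ^ n * B"
    using card_lists_length_eq[of "UNIV :: 'd set" n] by (simp add: power_mult_distrib)
  finally show ?thesis by simp
qed

lemma smooth_taylor_rem:
  assumes "smooth \<psi>" shows "smooth (taylor_rem n v \<psi>)"
proof -
  have "smooth (\<lambda>y. 1 * \<psi> (y - v) + (- 1) * (\<Sum>L | length L < n. taylor_coeff v L * partials L \<psi> y))"
    by (rule smooth_lincomb[OF smooth_translate[OF assms] smooth_sum[OF finite_lists_less]])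
      (rule smooth_partials[OF assms])
  then show ?thesis by (simp add: taylor_rem_def[abs_def])
qed

text \<open>This is where commuting partial derivatives are used: the remainder of a derivative of \<open>\<psi>\<close> is the
  derivative of a compactly supported function and can be integrated by parts.\<close>

lemma partials_taylor_rem:
  assumes "smooth \<psi>" and comm: "\<And>L. partials L (partials M \<psi>) = partials M (partials L \<psi>)"
  shows "partials M (taylor_rem n v \<psi>) = taylor_rem n v (partials M \<psi>)"
proof -
  have "partials M (taylor_rem n v \<psi>) = partials M (\<lambda>y. 1 * \<psi> (y - v) + (- 1) * (\<Sum>L | length L < n. taylor_coeff v L * partials L \<psi> y))"
    by (simp add: taylor_rem_def[abs_def])
  also have "\<dots> = (\<lambda>y. 1 * partials M \<psi> (y - v) +
      (- 1) * (\<Sum>L | length L < n. taylor_coeff v L * partials M (partials L \<psi>) y))"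
    using assms(1)
    by (subst partials_lincomb[OF smooth_translate[OF assms(1)] smooth_sum[OF finite_lists_less]])
      (simp_all add: partials_translate partials_sum finite_lists_less smooth_partials)
  finally show ?thesis by (simp add: taylor_rem_def[abs_def] comm)
qed

lemma taylor_rem_sum:
  assumes "finite I" "\<And>a. a \<in> I \<Longrightarrow> smooth (\<psi> a)"
  shows "taylor_rem n v (\<lambda>y. \<Sum>a\<in>I. c a * \<psi> a y) y = (\<Sum>a\<in>I. c a * taylor_rem n v (\<psi> a) y)"
proof -
  have "(\<Sum>L | length L < n. taylor_coeff v L * (\<Sum>a\<in>I. c a * partials L (\<psi> a) y)) =
      (\<Sum>a\<in>I. c a * (\<Sum>L | length L < n. taylor_coeff v L * partials L (\<psi> a) y))"
    unfolding sum_distrib_left by (subst sum.swap) (simp add: mult_ac)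
  moreover have "partials L (\<lambda>y. \<Sum>a\<in>I. c a * \<psi> a y) = (\<lambda>y. \<Sum>a\<in>I. c a * partials L (\<psi> a) y)" for L
    by (rule partials_sum[OF assms])
  ultimately show ?thesis
    unfolding taylor_rem_def right_diff_distrib sum_subtractf by (simp only:)
qed

lemma taylor_rem_zero_outside:
  assumes "\<And>y. y \<notin> cball z R \<Longrightarrow> \<psi> y = 0" "y \<notin> cball z (R + norm v)"
  shows "taylor_rem n v \<psi> y = 0"
proof -
  have "dist z y \<le> dist z (y - v) + norm v"
    using dist_triangle[of z y "y - v"] by (simp add: dist_norm)
  then have "y - v \<notin> cball z R" using assms(2) by auto
  moreover have "y \<notin> cball z R" using assms(2) by (auto simp: not_le) (smt (verit) norm_ge_zero)
  ultimately show ?thesis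
    unfolding taylor_rem_def using assms(1) partials_zero_outside_cball[of z R \<psi> y] by simp
qed

lemma taylor_rem_diff:
  assumes "smooth u" "smooth w"
  shows "taylor_rem n v (\<lambda>y. u y - w y) y = taylor_rem n v u y - taylor_rem n v w y"
  using taylor_rem_sum[of "{True, False}" "\<lambda>t. if t then u else w" n v "\<lambda>t. if t then 1 else - 1" y] assms
  by simp

section \<open>Polynomials of bounded total degree\<close>

lemma finite_multi_indices: "finite {\<beta> :: 'd::finite \<Rightarrow> nat. order_of \<beta> \<le> q}"
proof (rule finite_subset)
  show "{\<beta> :: 'd \<Rightarrow> nat. order_of \<beta> \<le> q} \<subseteq> (\<Pi>\<^sub>E i\<in>UNIV. {..q})"
  proof (clarsimp simp: PiE_def Pi_def extensional_def)
    fix \<beta> :: "'d \<Rightarrow> nat" and i assume "order_of \<beta> \<le> q"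
    moreover have "\<beta> i \<le> order_of \<beta>" unfolding order_of_def by (intro member_le_sum) auto
    ultimately show "\<beta> i \<le> q" by simp
  qed
qed (auto intro: finite_PiE)

lemma monomial_in_polys: "order_of \<beta> \<le> q \<Longrightarrow> monomial \<beta> \<in> polys q"
  unfolding polys_def
  by (auto intro!: exI[of _ "\<lambda>\<alpha>. if \<alpha> = \<beta> then 1 else 0"] ext
      simp: if_distrib[of "\<lambda>c. c * _"] finite_multi_indices cong: if_cong)

lemma polys_add:
  assumes "P \<in> polys q" "Q \<in> polys q" shows "(\<lambda>x. P x + Q x) \<in> polys q"
proof -
  obtain c e where "P = (\<lambda>x. \<Sum>\<beta> | order_of \<beta> \<le> q. c \<beta> * monomial \<beta> x)"
    "Q = (\<lambda>x. \<Sum>\<beta> | order_of \<beta> \<le> q. e \<beta> * monomial \<beta> x)" using assms by (auto simp: polys_def)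
  then show ?thesis unfolding polys_def
    by (auto intro!: exI[of _ "\<lambda>\<beta>. c \<beta> + e \<beta>"] simp: sum.distrib distrib_right)
qed

lemma polys_cmult:
  assumes "P \<in> polys q" shows "(\<lambda>x. a * P x) \<in> polys q"
proof -
  obtain c where "P = (\<lambda>x. \<Sum>\<beta> | order_of \<beta> \<le> q. c \<beta> * monomial \<beta> x)" using assms by (auto simp: polys_def)
  then show ?thesis unfolding polys_def
    by (auto intro!: exI[of _ "\<lambda>\<beta>. a * c \<beta>"] simp: sum_distrib_left mult.assoc)
qed

lemma const_in_polys: "(\<lambda>x. a) \<in> polys q"
  using polys_cmult[OF monomial_in_polys[of "\<lambda>_. 0" q], of a] by (simp add: order_of_def monomial_def[abs_def])

lemma polys_sum:
  assumes "\<And>i. i \<in> I \<Longrightarrow> P i \<in> polys q" shows "(\<lambda>x. \<Sum>i\<in>I. P i x) \<in> polys q"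
  using assms
proof (induction I rule: infinite_finite_induct)
  case (insert i I)
  then show ?case using polys_add[of "P i" q "\<lambda>x. \<Sum>i\<in>I. P i x"] by simp
qed (auto intro: const_in_polys)

lemma polys_mono:
  assumes "q \<le> q'" shows "polys q \<subseteq> polys q'"
proof
  fix P :: "real^'d::finite \<Rightarrow> real" assume "P \<in> polys q"
  then obtain c where P: "P = (\<lambda>x. \<Sum>\<beta> | order_of \<beta> \<le> q. c \<beta> * monomial \<beta> x)" by (auto simp: polys_def)
  show "P \<in> polys q'" unfolding P
    by (intro polys_sum polys_cmult monomial_in_polys) (use assms in auto)
qed

lemma polys_coordinate:
  assumes "P \<in> polys q" shows "(\<lambda>x. x $ i * P x) \<in> polys (Suc q)"
proof -
  obtain c where P: "P = (\<lambda>x. \<Sum>\<beta> | order_of \<beta> \<le> q. c \<beta> * monomial \<beta> x)"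
    using assms by (auto simp: polys_def)
  have "x $ i * monomial \<beta> x = monomial (\<beta>(i := Suc (\<beta> i))) x" for \<beta> and x :: "real^'a"
    unfolding monomial_def by (subst (1 2) prod.remove[of UNIV i]) auto
  then have "(\<lambda>x. x $ i * P x) = (\<lambda>x. \<Sum>\<beta> | order_of \<beta> \<le> q. c \<beta> * monomial (\<beta>(i := Suc (\<beta> i))) x)"
    unfolding P sum_distrib_left by (simp add: mult.left_commute)
  also have "\<dots> \<in> polys (Suc q)"
  proof (intro polys_sum polys_cmult monomial_in_polys)
    fix \<beta> :: "'a \<Rightarrow> nat" assume "\<beta> \<in> {\<beta>. order_of \<beta> \<le> q}"
    moreover have "order_of (\<beta>(i := Suc (\<beta> i))) = Suc (order_of \<beta>)"
      unfolding order_of_def by (subst (1 2) sum.remove[of UNIV i]) auto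
    ultimately show "order_of (\<beta>(i := Suc (\<beta> i))) \<le> Suc q" by simp
  qed
  finally show ?thesis .
qed

text \<open>Expanded at \<open>a\<close>, the coefficients are polynomials in the point at which the Taylor polynomial is
  evaluated.\<close>

lemma taylor_coeff_in_polys: "(\<lambda>x. taylor_coeff (x - a) L) \<in> polys (length L)"
proof -
  have "(\<lambda>x. \<Prod>i\<leftarrow>L. - (x - a) $ i) \<in> polys (length L)"
  proof (induction L)
    case (Cons i L)
    have "(\<lambda>x. (- 1) * (x $ i * (\<Prod>i\<leftarrow>L. - (x - a) $ i)) + a $ i * (\<Prod>i\<leftarrow>L. - (x - a) $ i)) \<in> polys (Suc (length L))"
      using Cons polys_mono[of "length L" "Suc (length L)"]
      by (intro polys_add polys_cmult polys_coordinate) auto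
    then show ?case by (simp add: algebra_simps)
  qed (simp add: const_in_polys)
  from polys_cmult[OF this, of "1 / fact (length L)"] show ?thesis
    by (simp add: taylor_coeff_def)
qed

section \<open>Integrals of compactly supported functions\<close>

text \<open>Fubini's theorem, as Lebesgue measure on \<open>real^'d\<close> is a product measure over the basis.\<close>

lemma integral_tensor:
  fixes F :: "'d::finite \<Rightarrow> real \<Rightarrow> real"
  assumes F: "\<And>j. integrable lborel (F j)"
  shows "(LINT y|lborel. tensor F y) = (\<Prod>j\<in>UNIV. LINT t|lborel. F j t)"
proof -
  interpret product_sigma_finite "\<lambda>_ :: real^'d. lborel :: real measure" ..
  define ax where "ax = (\<lambda>j :: 'd. axis j (1 :: real))"
  define H where "H b = F (inv ax b)" for b
  have inj: "inj ax" by (auto simp: inj_def ax_def axis_eq_axis)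
  have Basis: "Basis = ax ` UNIV" by (auto simp: Basis_vec_def ax_def)
  have H: "H (ax j) = F j" for j by (simp add: H_def inj)
  have [measurable]: "F j \<in> borel_measurable borel" for j
    using borel_measurable_integrable[OF F] by simp
  have meas: "tensor F \<in> borel_measurable borel"
    unfolding tensor_def[abs_def] by measurable
  have comp: "(\<Sum>b\<in>Basis. w b *\<^sub>R b) $ j = w (ax j)" for w :: "real^'d \<Rightarrow> real" and j
    by (simp add: cart_eq_inner_axis ax_def inner_sum_left_Basis axis_in_Basis_iff)
  have "(LINT y|lborel. tensor F y) =
      (LINT w|Pi\<^sub>M Basis (\<lambda>_. lborel). tensor F (\<Sum>b\<in>Basis. w b *\<^sub>R b))"
    by (subst lborel_eq, subst integral_distr) (use meas in auto)
  also have "\<dots> = (LINT w|Pi\<^sub>M Basis (\<lambda>_. lborel). (\<Prod>b\<in>Basis. H b (w b)))"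
    by (simp only: tensor_def comp) (simp add: Basis prod.reindex[OF inj] H)
  also have "\<dots> = (\<Prod>b\<in>Basis. LINT t|lborel. H b t)"
    by (rule product_integral_prod) (auto simp: Basis H F)
  also have "\<dots> = (\<Prod>j\<in>UNIV. LINT t|lborel. F j t)"
    by (simp add: Basis prod.reindex[OF inj] H)
  finally show ?thesis .
qed

lemma integral_translate:
  fixes g :: "'a::euclidean_space \<Rightarrow> real"
  assumes "g \<in> borel_measurable borel"
  shows "(LINT y|lborel. g (y - v)) = (LINT y|lborel. g y)"
proof -
  have "(LINT y|lborel. g y) = (LINT y|distr lborel borel ((+) (- v)). g y)"
    by (simp add: lborel_distr_plus)
  also have "\<dots> = (LINT y|lborel. g (- v + y))"
    using assms by (subst integral_distr) auto
  finally show ?thesis by simp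
qed

lemma integrable_smooth_cball:
  assumes "smooth \<phi>" "\<And>y. y \<notin> cball z R \<Longrightarrow> \<phi> y = 0"
  shows "integrable lborel \<phi>"
  by (rule integrable_compact_support[OF smooth_continuous[OF assms(1)] compact_cball]) (use assms in auto)

lemma integral_abs_le_cball:
  fixes g :: "real^'d::finite \<Rightarrow> real"
  assumes "\<And>y. \<bar>g y\<bar> \<le> B" "\<And>y. y \<notin> cball z R \<Longrightarrow> g y = 0"
  shows "\<bar>LINT y|lborel. g y\<bar> \<le> B * measure lborel (cball z R)"
proof (cases "integrable lborel g")
  case True
  have "\<bar>LINT y|lborel. g y\<bar> \<le> (LINT y|lborel. \<bar>g y\<bar>)"
    using integral_norm_bound[of lborel g] by simp
  also have "\<dots> \<le> (LINT y|lborel. B * indicator (cball z R) y)"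
  proof (rule integral_mono)
    show "integrable lborel (\<lambda>y. B * indicator (cball z R) y)"
      by (intro integrable_mult_right integrable_real_indicator) (auto simp: emeasure_lborel_cball_finite[unfolded infinity_ennreal_def])
  qed (use True assms in \<open>auto simp: indicator_def\<close>)
  also have "\<dots> = B * measure lborel (cball z R)" by simp
  finally show ?thesis .
next
  case False
  have "0 \<le> B" using assms(1)[of z] by linarith
  then show ?thesis using False by (simp add: not_integrable_integral_eq)
qed

text \<open>The integrals of \<open>\<phi>\<close> and of its translate by \<open>h\<close> in direction \<open>i\<close> agree, and their difference is
  \<open>h\<close> times the integral of the derivative up to a Taylor remainder of size \<open>O(h\<^sup>2)\<close>. Dividing by \<open>h\<close>
  and letting \<open>h\<close> tend to 0 leaves 0.\<close>

lemma integral_partial_zero: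
  fixes \<phi> :: "real^'d::finite \<Rightarrow> real"
  assumes sm: "smooth \<phi>" and supp: "\<And>y. y \<notin> cball z R \<Longrightarrow> \<phi> y = 0"
  shows "(LINT y|lborel. partials [i] \<phi> y) = 0"
proof (rule ccontr)
  define I where "I = (LINT y|lborel. partials [i] \<phi> y)"
  assume "(LINT y|lborel. partials [i] \<phi> y) \<noteq> 0"
  then have "\<bar>I\<bar> > 0" by (simp add: I_def)
  obtain B where B: "B \<ge> 0" "\<And>L y. length L = 2 \<Longrightarrow> \<bar>partials L \<phi> y\<bar> \<le> B"
    using smooth_bounded[OF sm supp, of z R 2] by blast
  \<comment> \<open>Translation by at most 1 keeps the support inside this ball.\<close>
  define V where "V = measure lborel (cball z (R + 1))"
  define D where "D = (real CARD('d))\<^sup>2 * B * V"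
  have "D \<ge> 0" using B by (simp add: D_def V_def)
  have est: "h * \<bar>I\<bar> \<le> h\<^sup>2 * D" if h: "0 < h" "h \<le> 1" for h
  proof -
    define v :: "real^'d" where "v = h *\<^sub>R axis i 1"
    have nv: "norm v = h" using h by (simp add: v_def)
    have set: "{L :: 'd list. length L < 2} = insert [] (range (\<lambda>j. [j]))"
      by (auto simp: less_2_cases_iff length_Suc_conv)
    have rem: "taylor_rem 2 v \<phi> y = \<phi> (y - v) - \<phi> y + h * partials [i] \<phi> y" for y
    proof -
      have "(\<Sum>j\<in>UNIV. taylor_coeff v [j] * partials [j] \<phi> y) =
          (\<Sum>j\<in>UNIV. if j = i then - h * partials [i] \<phi> y else 0)"
        by (intro sum.cong) (auto simp: taylor_coeff_def v_def axis_def)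
      then show ?thesis
        unfolding taylor_rem_def set
        by (subst sum.insert) (auto simp: sum.reindex inj_def taylor_coeff_def)
    qed
    have int: "integrable lborel \<phi>" "integrable lborel (partials [i] \<phi>)"
      using sm supp partials_zero_outside_cball[of z R \<phi>]
      by (auto intro!: integrable_smooth_cball[of _ z R] smooth_partials simp del: partials.simps)
    have supp': "\<phi> (y - v) = 0" if "y \<notin> cball (z + v) R" for y
      using that supp[of "y - v"] by (auto simp: dist_norm algebra_simps)
    have intv: "integrable lborel (\<lambda>y. \<phi> (y - v))"
      by (rule integrable_smooth_cball[OF smooth_translate[OF sm], of "z + v" R]) (rule supp')
    have "(LINT y|lborel. taylor_rem 2 v \<phi> y) = h * I"
      unfolding rem I_def using int intv
      by (subst Bochner_Integration.integral_add) (auto simp del: partials.simps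
        simp: integral_translate borel_measurable_continuous_onI smooth_continuous[OF sm])
    moreover have "\<bar>LINT y|lborel. taylor_rem 2 v \<phi> y\<bar> \<le> (real CARD('d) * h)\<^sup>2 * B * V"
      unfolding V_def
    proof (rule integral_abs_le_cball)
      show "\<bar>taylor_rem 2 v \<phi> y\<bar> \<le> (real CARD('d) * h)\<^sup>2 * B" for y
        using taylor_rem_bound[OF sm B(2), of 2 v y] by (simp add: nv)
      show "taylor_rem 2 v \<phi> y = 0" if "y \<notin> cball z (R + 1)" for y
        using that h by (intro taylor_rem_zero_outside[OF supp]) (auto simp: nv)
    qed
    ultimately show ?thesis using h by (simp add: abs_mult D_def power_mult_distrib mult_ac)
  qed
  define h where "h = min 1 (\<bar>I\<bar> / (2 * (D + 1)))"
  have h: "0 < h" "h \<le> 1" using \<open>\<bar>I\<bar> > 0\<close> \<open>D \<ge> 0\<close> by (auto simp: h_def)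
  have "\<bar>I\<bar> \<le> h * D" using est[OF h] h by (simp add: power2_eq_square)
  also have "\<dots> \<le> (\<bar>I\<bar> / (2 * (D + 1))) * (D + 1)"
    using \<open>D \<ge> 0\<close> by (intro mult_mono) (auto simp: h_def)
  also have "\<dots> = \<bar>I\<bar> / 2" using \<open>D \<ge> 0\<close> by (simp add: field_simps)
  finally show False using \<open>\<bar>I\<bar> > 0\<close> by simp
qed

lemma integral_lebesgue_on_eq_lborel:
  fixes g :: "real^'d::finite \<Rightarrow> real"
  assumes "continuous_on UNIV g" "U \<in> sets lebesgue" "\<And>y. y \<notin> U \<Longrightarrow> g y = 0"
  shows "(LINT y|lebesgue_on U. g y) = (LINT y|lborel. g y)"
proof -
  have "(\<lambda>y. indicator U y *\<^sub>R g y) = g" using assms(3) by (force simp: indicator_def)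
  moreover have "g \<in> borel_measurable lborel"
    using borel_measurable_continuous_onI[OF assms(1)] by simp
  ultimately show ?thesis
    using assms(2) by (simp add: integral_restrict_space integral_completion)
qed

lemma integrable_lebesgue_on_of_lborel:
  fixes g :: "'a::euclidean_space \<Rightarrow> real"
  assumes "integrable lborel g" "U \<in> sets lebesgue"
  shows "integrable (lebesgue_on U) g"
proof -
  have "integrable lebesgue g"
    using assms(1) borel_measurable_integrable[OF assms(1)] by (simp add: integrable_completion)
  from integrable_mult_indicator[OF assms(2) this] show ?thesis
    using assms(2) by (subst integrable_restrict_space) auto
qed

lemma ennreal_abs_integral_le:
  fixes g :: "'a \<Rightarrow> real"
  shows "ennreal \<bar>LINT y|M. g y\<bar> \<le> (\<integral>\<^sup>+y. ennreal \<bar>g y\<bar> \<partial>M)"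
proof (cases "integrable M g")
  case True
  then show ?thesis using integral_norm_bound_ennreal[OF True] by simp
qed (simp add: not_integrable_integral_eq)

lemma integrable_mult_continuous:
  fixes f g :: "'a::euclidean_space \<Rightarrow> real"
  assumes "compact U" "continuous_on U f" "continuous_on UNIV g"
  shows "integrable (lebesgue_on U) (\<lambda>y. f y * g y)"
proof -
  have "integrable lborel (\<lambda>y. indicator U y *\<^sub>R (f y * g y))"
    using assms by (intro borel_integrable_compact continuous_on_mult)
      (auto intro: continuous_on_subset)
  then have "integrable lebesgue (\<lambda>y. indicator U y *\<^sub>R (f y * g y))"
    using borel_measurable_integrable by (subst integrable_completion) auto
  moreover have "U \<in> sets lebesgue" using assms(1) by (simp add: compact_imp_closed)
  ultimately show ?thesis by (subst integrable_restrict_space) auto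
qed

lemma lebesgue_on_integral_bound:
  fixes g :: "real^'d::finite \<Rightarrow> real"
  assumes U: "U \<in> sets lebesgue" and B: "0 \<le> B" "\<And>y. y \<in> U \<Longrightarrow> \<bar>g y\<bar> \<le> B"
    and supp: "\<And>y. y \<in> U \<Longrightarrow> y \<notin> cball z R \<Longrightarrow> g y = 0"
  shows "\<bar>LINT y|lebesgue_on U. g y\<bar> \<le> B * measure lborel (cball z R)"
proof -
  have UC: "U \<inter> cball z R \<in> sets (lebesgue_on U)"
    using U by (auto simp: sets_restrict_space)
  have "ennreal \<bar>LINT y|lebesgue_on U. g y\<bar> \<le> (\<integral>\<^sup>+y. ennreal \<bar>g y\<bar> \<partial>lebesgue_on U)"
    by (rule ennreal_abs_integral_le)
  also have "\<dots> \<le> (\<integral>\<^sup>+y. ennreal B * indicator (U \<inter> cball z R) y \<partial>lebesgue_on U)"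
  proof (rule nn_integral_mono)
    fix y assume "y \<in> space (lebesgue_on U)"
    then have "y \<in> U" by simp
    then show "ennreal \<bar>g y\<bar> \<le> ennreal B * indicator (U \<inter> cball z R) y"
      using B supp by (cases "y \<in> cball z R") (auto intro: ennreal_leI)
  qed
  also have "\<dots> = ennreal B * emeasure (lebesgue_on U) (U \<inter> cball z R)"
    by (rule nn_integral_cmult_indicator[OF UC])
  also have "\<dots> \<le> ennreal B * emeasure lebesgue (cball z R)"
  proof (rule mult_left_mono)
    have "emeasure (lebesgue_on U) (U \<inter> cball z R) = emeasure lebesgue (U \<inter> cball z R)"
      using U by (intro emeasure_restrict_space) auto
    also have "\<dots> \<le> emeasure lebesgue (cball z R)" by (rule emeasure_mono) auto
    finally show "emeasure (lebesgue_on U) (U \<inter> cball z R) \<le> emeasure lebesgue (cball z R)" .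
  qed simp
  also have "emeasure lebesgue (cball z R) = ennreal (measure lborel (cball z R))"
    by (simp add: emeasure_eq_measure2 emeasure_lborel_cball_finite less_top)
  finally show ?thesis
    using B by (simp flip: ennreal_mult)
qed

section \<open>Sobolev functions tested against derivatives\<close>

text \<open>Replaces Hoelder's inequality below: integrated over a set of measure \<open>V\<close> it bounds an \<open>L\<^sup>1\<close> norm by
  \<open>l V\<close> plus a multiple of the \<open>p\<close>-th power of the \<open>L\<^sup>p\<close> norm, and the free parameter \<open>l\<close> can be adapted
  to \<open>V\<close>.\<close>

lemma le_add_powr:
  fixes a l p :: real
  assumes "0 \<le> a" "0 < l" "1 \<le> p"
  shows "a \<le> l + l powr (1 - p) * a powr p"
proof (cases "a \<le> l")
  case True
  then show ?thesis by (simp add: add_increasing2)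
next
  case False
  then have "a = a powr (1 - p) * a powr p" using assms by (simp flip: powr_add)
  also have "\<dots> \<le> l powr (1 - p) * a powr p"
    using False assms by (intro mult_right_mono powr_mono2') auto
  finally show ?thesis using assms by simp
qed

text \<open>Stated for the nonnegative integral, so that it yields integrability of the product as well as the
  bound on its integral.\<close>

lemma Lp_pairing_nn_bound:
  fixes g \<eta> :: "real^'d::finite \<Rightarrow> real"
  assumes g: "g \<in> Lp p U" and p: "1 \<le> p" and U: "U \<in> sets lebesgue" and sub: "cball z \<rho> \<subseteq> U"
    and supp: "\<And>y. y \<notin> cball z \<rho> \<Longrightarrow> \<eta> y = 0" and B: "\<And>y. \<bar>\<eta> y\<bar> \<le> B" and l: "0 < l"
  shows "(\<integral>\<^sup>+y. ennreal \<bar>g y * \<eta> y\<bar> \<partial>lebesgue_on U) \<le>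
    ennreal (B * (l * measure lborel (cball z \<rho>) + l powr (1 - p) * (LINT y|lebesgue_on U. \<bar>g y\<bar> powr p)))"
proof -
  have B0: "0 \<le> B" using B[of z] by linarith
  have [measurable]: "g \<in> borel_measurable (lebesgue_on U)"
    and gi: "integrable (lebesgue_on U) (\<lambda>x. \<bar>g x\<bar> powr p)" using g by (auto simp: Lp_def)
  have [measurable]: "cball z \<rho> \<in> sets (lebesgue_on U)"
    using sub U by (subst sets_restrict_space_iff) auto
  have "(\<integral>\<^sup>+y. ennreal \<bar>g y * \<eta> y\<bar> \<partial>lebesgue_on U) \<le>
      (\<integral>\<^sup>+y. ennreal (B * l) * indicator (cball z \<rho>) y +
        ennreal (B * l powr (1 - p)) * ennreal (\<bar>g y\<bar> powr p) \<partial>lebesgue_on U)"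
  proof (rule nn_integral_mono)
    fix y
    have "ennreal \<bar>g y * \<eta> y\<bar> \<le> ennreal (B * l) + ennreal (B * l powr (1 - p) * \<bar>g y\<bar> powr p)"
      if "y \<in> cball z \<rho>"
    proof -
      have "\<bar>g y * \<eta> y\<bar> \<le> B * (l + l powr (1 - p) * \<bar>g y\<bar> powr p)"
        using mult_mono[OF le_add_powr[of "\<bar>g y\<bar>" l p] B[of y]] l p
        by (simp add: abs_mult mult.commute)
      also have "ennreal \<dots> = ennreal (B * l) + ennreal (B * l powr (1 - p) * \<bar>g y\<bar> powr p)"
        using B0 l by (subst ennreal_plus[symmetric]) (auto simp: algebra_simps)
      finally show ?thesis by (simp add: ennreal_leI)
    qed
    then show "ennreal \<bar>g y * \<eta> y\<bar> \<le> ennreal (B * l) * indicator (cball z \<rho>) y +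
        ennreal (B * l powr (1 - p)) * ennreal (\<bar>g y\<bar> powr p)"
      using supp[of y] B0 by (cases "y \<in> cball z \<rho>") (auto simp: ennreal_mult)
  qed
  also have "\<dots> = ennreal (B * l) * emeasure (lebesgue_on U) (cball z \<rho>) +
      ennreal (B * l powr (1 - p)) * (\<integral>\<^sup>+y. ennreal (\<bar>g y\<bar> powr p) \<partial>lebesgue_on U)"
    by (subst nn_integral_add) (auto simp: nn_integral_cmult)
  also have "(\<integral>\<^sup>+y. ennreal (\<bar>g y\<bar> powr p) \<partial>lebesgue_on U) = ennreal (LINT y|lebesgue_on U. \<bar>g y\<bar> powr p)"
    by (rule nn_integral_eq_integral[OF gi]) auto
  also have "emeasure (lebesgue_on U) (cball z \<rho>) = ennreal (measure lborel (cball z \<rho>))"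
    using sub U by (subst emeasure_restrict_space)
      (auto simp: emeasure_eq_measure2 emeasure_lborel_cball_finite less_top)
  finally show ?thesis
    using B0 l by (simp add: algebra_simps flip: ennreal_mult ennreal_plus)
qed

text \<open>For every \<open>x\<close> in the ball, \<open>\<eta>\<close> having mean 0 allows \<open>g y\<close> to be replaced by \<open>g y - g x\<close> in the
  pairing. Integrating the resulting bounds over \<open>x\<close> in the ball, where
  \<open>norm (x - y) \<le> 2 \<rho>\<close>, makes the Slobodeckij double integral appear.\<close>

lemma fractional_pairing_bound:
  fixes g \<eta> :: "real^'d::finite \<Rightarrow> real"
  assumes g: "g \<in> Lp p U" and p: "1 \<le> p" and U': "U \<in> lmeasurable" and sub: "cball z \<rho> \<subseteq> U"
    and sm: "smooth \<eta>" and supp: "\<And>y. y \<notin> cball z \<rho> \<Longrightarrow> \<eta> y = 0" and B: "\<And>y. \<bar>\<eta> y\<bar> \<le> B"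
    and mean: "(LINT y|lborel. \<eta> y) = 0"
    and l: "0 < l" and \<rho>: "0 < \<rho>" and \<sigma>: "0 < \<sigma>" and fin: "slobodeckij_pow \<sigma> p U g < \<infinity>"
  defines "V \<equiv> measure lborel (cball z \<rho>)"
  shows "\<bar>LINT y|lebesgue_on U. g y * \<eta> y\<bar> * V \<le> B * (l * V\<^sup>2 +
    l powr (1 - p) * (2 * \<rho>) powr (\<sigma> * p + real CARD('d)) * enn2real (slobodeckij_pow \<sigma> p U g))"
proof -
  have U: "U \<in> sets lebesgue" using U' by auto
  define e where "e = \<sigma> * p + real CARD('d)"
  have "e > 0" using \<sigma> p by (auto simp: e_def intro!: add_pos_pos)
  define k where "k x y = \<bar>g x - g y\<bar> powr p / norm (x - y) powr e" for x y
  define c where "c = l powr (1 - p) * (2 * \<rho>) powr e"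
  have c0: "0 \<le> c" by (simp add: c_def)
  have B0: "0 \<le> B" using B[of z] by linarith
  define I where "I = (LINT y|lebesgue_on U. g y * \<eta> y)"
  define C where "C = cball z \<rho>"
  have g_meas [measurable]: "g \<in> borel_measurable (lebesgue_on U)" using g by (auto simp: Lp_def)
  have \<eta>_meas [measurable]: "\<eta> \<in> borel_measurable (lebesgue_on U)"
    using borel_measurable_continuous_onI[OF smooth_continuous[OF sm]]
    by (intro measurable_restrict_space1 measurable_completion) simp
  have [measurable]: "C \<in> sets (lebesgue_on U)"
    using sub U by (subst sets_restrict_space_iff) (auto simp: C_def)
  have id_meas [measurable]: "(\<lambda>x. x) \<in> borel_measurable (lebesgue_on U)"
    by (intro measurable_restrict_space1 measurable_completion) simp
  have emC: "emeasure (lebesgue_on U) C = ennreal V"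
    using sub U unfolding V_def C_def by (subst emeasure_restrict_space)
      (auto simp: emeasure_eq_measure2 emeasure_lborel_cball_finite less_top)
  have V0: "0 \<le> V" by (simp add: V_def)
  interpret fm: finite_measure "lebesgue_on U"
    using U' by (intro finite_measureI) (auto simp: emeasure_restrict_space fmeasurable_def)
  have k_meas: "(\<lambda>(x, y). ennreal (k x y)) \<in> borel_measurable (lebesgue_on U \<Otimes>\<^sub>M lebesgue_on U)"
    unfolding k_def by measurable
  have slob: "slobodeckij_pow \<sigma> p U g = (\<integral>\<^sup>+x. \<integral>\<^sup>+y. ennreal (k x y) \<partial>lebesgue_on U \<partial>lebesgue_on U)"
    by (simp add: slobodeckij_pow_def k_def e_def)
  have int_g\<eta>: "integrable (lebesgue_on U) (\<lambda>y. g y * \<eta> y)"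
    unfolding integrable_iff_bounded real_norm_def
    by (intro conjI le_less_trans[OF Lp_pairing_nn_bound[OF g p U sub supp B l]]) auto
  have int_\<eta>: "integrable (lebesgue_on U) \<eta>"
    by (rule integrable_lebesgue_on_of_lborel[OF integrable_smooth_cball[OF sm supp] U])
  have "\<eta> y = 0" if "y \<notin> U" for y using that supp sub by blast
  then have mean': "(LINT y|lebesgue_on U. \<eta> y) = 0"
    using integral_lebesgue_on_eq_lborel[OF smooth_continuous[OF sm] U] mean by auto
  have *: "ennreal \<bar>I\<bar> * indicator C x \<le>
      ennreal (B * l * V) * indicator C x + ennreal (B * c) * (\<integral>\<^sup>+y. ennreal (k x y) \<partial>lebesgue_on U)" for x
  proof (cases "x \<in> C")
    case True
    have "I = (LINT y|lebesgue_on U. (g y - g x) * \<eta> y)"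
      using int_g\<eta> int_\<eta> mean' by (simp add: I_def left_diff_distrib)
    then have "ennreal \<bar>I\<bar> \<le> (\<integral>\<^sup>+y. ennreal \<bar>(g y - g x) * \<eta> y\<bar> \<partial>lebesgue_on U)"
      by (simp add: ennreal_abs_integral_le)
    also have "\<dots> \<le> (\<integral>\<^sup>+y. ennreal (B * l) * indicator C y + ennreal (B * c) * ennreal (k x y) \<partial>lebesgue_on U)"
    proof (rule nn_integral_mono)
      fix y
      show "ennreal \<bar>(g y - g x) * \<eta> y\<bar> \<le> ennreal (B * l) * indicator C y + ennreal (B * c) * ennreal (k x y)"
      proof (cases "y \<in> C")
        case y: True
        have "\<bar>g x - g y\<bar> \<le> l + c * k x y"
        proof (cases "x = y")
          case False
          have "norm (x - y) \<le> 2 * \<rho>"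
            using True y dist_triangle_le[of x z y "2 * \<rho>"] by (auto simp: C_def dist_norm norm_minus_commute)
          then have "norm (x - y) powr e \<le> (2 * \<rho>) powr e" using \<open>e > 0\<close> by (intro powr_mono2) auto
          then have "norm (x - y) powr e * k x y \<le> (2 * \<rho>) powr e * k x y"
            by (intro mult_right_mono) (auto simp: k_def)
          moreover have "norm (x - y) powr e * k x y = \<bar>g x - g y\<bar> powr p"
            using False by (simp add: k_def)
          ultimately have "l powr (1 - p) * \<bar>g x - g y\<bar> powr p \<le> c * k x y"
            using mult_left_mono[of "\<bar>g x - g y\<bar> powr p" "(2 * \<rho>) powr e * k x y" "l powr (1 - p)"]
            by (simp add: c_def mult.assoc)
          then show ?thesis using le_add_powr[of "\<bar>g x - g y\<bar>" l p] l p by linarith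
        qed (use l in \<open>auto simp: k_def\<close>)
        then have "\<bar>(g y - g x) * \<eta> y\<bar> \<le> (l + c * k x y) * B"
          unfolding abs_mult using B[of y] by (intro mult_mono) (auto simp: abs_minus_commute)
        also have "ennreal \<dots> = ennreal (B * l) + ennreal (B * c) * ennreal (k x y)"
          using B0 l c0 by (subst ennreal_mult[symmetric], simp, simp add: k_def,
              subst ennreal_plus[symmetric]) (auto simp: algebra_simps k_def)
        finally show ?thesis using y by (simp add: ennreal_leI)
      qed (use supp[of y] in \<open>simp add: C_def\<close>)
    qed
    also have "\<dots> = ennreal (B * l) * ennreal V + ennreal (B * c) * (\<integral>\<^sup>+y. ennreal (k x y) \<partial>lebesgue_on U)"
    proof -
      have "(\<lambda>y. ennreal (k x y)) \<in> borel_measurable (lebesgue_on U)"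
        unfolding k_def by measurable
      then show ?thesis by (subst nn_integral_add) (auto simp: nn_integral_cmult emC)
    qed
    finally show ?thesis using True B0 l V0 by (simp add: ennreal_mult)
  qed simp
  have "ennreal (\<bar>I\<bar> * V) = (\<integral>\<^sup>+x. ennreal \<bar>I\<bar> * indicator C x \<partial>lebesgue_on U)"
    using V0 by (simp add: nn_integral_cmult emC ennreal_mult)
  also have "\<dots> \<le> (\<integral>\<^sup>+x. ennreal (B * l * V) * indicator C x +
      ennreal (B * c) * (\<integral>\<^sup>+y. ennreal (k x y) \<partial>lebesgue_on U) \<partial>lebesgue_on U)"
    by (intro nn_integral_mono *)
  also have "\<dots> = ennreal (B * l * V) * ennreal V + ennreal (B * c) * slobodeckij_pow \<sigma> p U g"
    unfolding slob using fm.borel_measurable_nn_integral[OF k_meas]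
    by (subst nn_integral_add) (auto simp: nn_integral_cmult emC)
  also have "\<dots> = ennreal (B * l * V * V + B * c * enn2real (slobodeckij_pow \<sigma> p U g))"
    using fin B0 l V0 c0 by (subst (2) ennreal_enn2real[symmetric]) (auto simp: less_top ennreal_mult ennreal_plus)
  finally have "\<bar>I\<bar> * V \<le> B * l * V * V + B * c * enn2real (slobodeckij_pow \<sigma> p U g)"
    using B0 l V0 c0 by (subst (asm) ennreal_le_iff) auto
  then show ?thesis by (simp add: I_def c_def e_def power2_eq_square algebra_simps)
qed

lemma measure_lborel_cball:
  fixes z :: "real^'d::finite"
  assumes "0 < \<rho>"
  shows "measure lborel (cball z \<rho>) = measure lborel (cball (0 :: real^'d) 1) * \<rho> powr real CARD('d)"
  using assms by (simp add: content_cball_conv_ball content_ball_conv_unit_ball[of \<rho>] powr_realpow)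

text \<open>After integration by parts \<open>\<eta>\<close> is paired with the weak derivative of \<open>f\<close>, which lies in \<open>L\<^sup>p\<close> and, if
  \<open>s\<close> is not an integer, has a finite Slobodeckij seminorm of order \<open>s - k\<close>. The exponent of \<open>\<rho>\<close> is
  the one that scaling dictates.\<close>

theorem sobolev_duality:
  fixes f :: "real^'d::finite \<Rightarrow> real"
  assumes r: "0 < r" and p: "1 \<le> p" and s: "0 < s" and f: "f \<in> sobolev s p (cball x0 r)"
  defines "k \<equiv> nat \<lfloor>s\<rfloor>"
  shows "\<exists>C\<ge>0. \<forall>i \<eta> z \<rho> B. smooth \<eta> \<longrightarrow> 0 < \<rho> \<longrightarrow> (\<forall>y. y \<notin> cball z \<rho> \<longrightarrow> \<eta> y = 0) \<longrightarrow>
     cball z \<rho> \<subseteq> ball x0 r \<longrightarrow> (\<forall>y. \<bar>\<eta> y\<bar> \<le> B) \<longrightarrow> (LINT y|lborel. \<eta> y) = 0 \<longrightarrow>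
     \<bar>LINT y|lebesgue_on (cball x0 r). f y * partials (replicate k i) \<eta> y\<bar>
       \<le> C * B * \<rho> powr (real CARD('d) + (s - real k) - real CARD('d) / p)"
proof -
  define U where "U = cball x0 r"
  define d where "d = real CARD('d)"
  define \<sigma> where "\<sigma> = s - real k"
  define w where "w = measure lborel (cball (0 :: real^'d) 1)"
  have w: "w > 0" unfolding w_def by (rule content_cball_pos) simp
  have U: "U \<in> lmeasurable" "U \<in> sets lebesgue" by (auto simp: U_def)
  have k: "real k = of_int \<lfloor>s\<rfloor>" using s by (simp add: k_def)
  have ex: "\<exists>C\<ge>0. \<forall>\<eta> z \<rho> B. smooth \<eta> \<longrightarrow> 0 < \<rho> \<longrightarrow> (\<forall>y. y \<notin> cball z \<rho> \<longrightarrow> \<eta> y = 0) \<longrightarrow>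
     cball z \<rho> \<subseteq> ball x0 r \<longrightarrow> (\<forall>y. \<bar>\<eta> y\<bar> \<le> B) \<longrightarrow> (LINT y|lborel. \<eta> y) = 0 \<longrightarrow>
     \<bar>LINT y|lebesgue_on U. f y * partials (replicate k i) \<eta> y\<bar>
       \<le> C * B * \<rho> powr (d + \<sigma> - d / p)" for i :: 'd
  proof -
    define \<beta> where "\<beta> = count_list (replicate k i)"
    have ord: "order_of \<beta> = k"
      unfolding order_of_def \<beta>_def using sum_count_set[of "replicate k i" UNIV] by simp
    have red: "\<bar>LINT y|lebesgue_on U. f y * partials (replicate k i) \<eta> y\<bar> = \<bar>LINT y|lebesgue_on U. g y * \<eta> y\<bar>"
      if wd: "weak_deriv U \<beta> f g" and sm: "smooth \<eta>" and supp: "\<And>y. y \<notin> cball z \<rho> \<Longrightarrow> \<eta> y = 0"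
        and sub: "cball z \<rho> \<subseteq> ball x0 r" for g \<eta> z \<rho>
    proof -
      have cl: "closure {y. \<eta> y \<noteq> 0} \<subseteq> cball z \<rho>"
        using supp by (intro closure_minimal) (blast, simp)
      then have "test_function (interior U) \<eta>"
        using sm sub unfolding test_function_def U_def
        by (auto simp: compact_eq_bounded_closed interior_cball intro: bounded_subset[OF bounded_cball])
      then show ?thesis
        using wd unfolding weak_deriv_def by (auto simp: \<beta>_def abs_mult)
    qed
    show ?thesis
    proof (cases "s \<in> \<int>")
      case True
      then have \<sigma>: "\<sigma> = 0" by (auto simp: \<sigma>_def k elim: Ints_cases)
      obtain g where g: "g \<in> Lp p U" "weak_deriv U \<beta> f g"
        using f ord unfolding sobolev_def sobolev_nat_def U_def k_def
        by (simp, metis order_refl)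
      define G where "G = (LINT y|lebesgue_on U. \<bar>g y\<bar> powr p)"
      have G: "0 \<le> G" by (simp add: G_def)
      show ?thesis
      proof (intro exI[of _ "w + G"] conjI allI impI)
        fix \<eta> and z :: "real^'d" and \<rho> B :: real
        assume *: "smooth \<eta>" "0 < \<rho>" "\<forall>y. y \<notin> cball z \<rho> \<longrightarrow> \<eta> y = 0" "cball z \<rho> \<subseteq> ball x0 r"
          "\<forall>y. \<bar>\<eta> y\<bar> \<le> B"
        \<comment> \<open>This choice balances the two summands of \<open>Lp_pairing_nn_bound\<close>.\<close>
        define l where "l = \<rho> powr (- d / p)"
        have l: "0 < l" using *(2) by (simp add: l_def)
        have B: "0 \<le> B" using *(5) by (meson abs_ge_zero order_trans)
        have sub: "cball z \<rho> \<subseteq> U" using *(4) by (auto simp: U_def)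
        have "ennreal \<bar>LINT y|lebesgue_on U. g y * \<eta> y\<bar> \<le>
            ennreal (B * (l * measure lborel (cball z \<rho>) + l powr (1 - p) * G))"
          unfolding G_def using *
          by (intro order_trans[OF ennreal_abs_integral_le Lp_pairing_nn_bound[OF g(1) p U(2) sub _ _ l]]) auto
        then have "\<bar>LINT y|lebesgue_on U. g y * \<eta> y\<bar> \<le> B * (l * measure lborel (cball z \<rho>) + l powr (1 - p) * G)"
          using B l G by (subst (asm) ennreal_le_iff) auto
        moreover have "l * measure lborel (cball z \<rho>) = w * \<rho> powr (d + \<sigma> - d / p)"
        proof -
          have "\<rho> powr (- d / p) * \<rho> powr d = \<rho> powr (d + \<sigma> - d / p)"
            unfolding powr_add[symmetric] \<sigma> by (simp add: algebra_simps)
          moreover have "measure lborel (cball z \<rho>) = w * \<rho> powr d"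
            by (simp only: measure_lborel_cball[OF *(2), of z] w_def d_def)
          ultimately show ?thesis by (simp add: l_def mult.left_commute)
        qed
        moreover have "l powr (1 - p) = \<rho> powr (d + \<sigma> - d / p)"
          unfolding l_def powr_powr \<sigma> using p
          by (intro arg_cong2[where f="(powr)"] refl) (simp add: field_simps)
        ultimately show "\<bar>LINT y|lebesgue_on U. f y * partials (replicate k i) \<eta> y\<bar>
            \<le> (w + G) * B * \<rho> powr (d + \<sigma> - d / p)"
          using red[OF g(2) *(1), of z \<rho>] * by (simp add: algebra_simps)
      qed (use w G in auto)
    next
      case False
      have "s \<noteq> of_int \<lfloor>s\<rfloor>" using False Ints_of_int by metis
      then have \<sigma>: "0 < \<sigma>" using of_int_floor_le[of s] unfolding \<sigma>_def k by linarith
      have "\<exists>g\<in>Lp p U. weak_deriv U \<beta> f g \<and> slobodeckij_pow (s - of_int \<lfloor>s\<rfloor>) p U g < \<infinity>"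
        using f ord False unfolding sobolev_def U_def k_def by blast
      then obtain g where g: "g \<in> Lp p U" "weak_deriv U \<beta> f g" "slobodeckij_pow \<sigma> p U g < \<infinity>"
        unfolding \<sigma>_def k by blast
      define S where "S = enn2real (slobodeckij_pow \<sigma> p U g)"
      have S: "0 \<le> S" by (simp add: S_def)
      define e where "e = \<sigma> * p + d"
      show ?thesis
      proof (intro exI[of _ "w + 2 powr e * S / w"] conjI allI impI)
        fix \<eta> and z :: "real^'d" and \<rho> B :: real
        assume *: "smooth \<eta>" "0 < \<rho>" "\<forall>y. y \<notin> cball z \<rho> \<longrightarrow> \<eta> y = 0" "cball z \<rho> \<subseteq> ball x0 r"
          "\<forall>y. \<bar>\<eta> y\<bar> \<le> B" "(LINT y|lborel. \<eta> y) = 0"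
        \<comment> \<open>This choice balances the two summands of \<open>fractional_pairing_bound\<close>.\<close>
        define l where "l = \<rho> powr (\<sigma> - d / p)"
        define V where "V = measure lborel (cball z \<rho>)"
        have V: "V = w * \<rho> powr d" by (simp only: measure_lborel_cball[OF *(2), of z] V_def w_def d_def)
        then have V0: "0 < V" using w *(2) by simp
        have l: "0 < l" using *(2) by (simp add: l_def)
        have B: "0 \<le> B" using *(5) by (meson abs_ge_zero order_trans)
        have sub: "cball z \<rho> \<subseteq> U" using *(4) by (auto simp: U_def)
        have "\<bar>LINT y|lebesgue_on U. g y * \<eta> y\<bar> * V \<le> B * (l * V\<^sup>2 + l powr (1 - p) * (2 * \<rho>) powr e * S)"
          using fractional_pairing_bound[OF g(1) p U(1) sub *(1) _ _ *(6) l *(2) \<sigma> g(3), of B] *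
          by (simp add: V_def e_def S_def d_def)
        moreover have "l * V\<^sup>2 = w * \<rho> powr (d + \<sigma> - d / p) * V"
          by (simp add: V l_def power2_eq_square powr_add powr_diff)
        moreover have "l powr (1 - p) * (2 * \<rho>) powr e * S = 2 powr e * S / w * \<rho> powr (d + \<sigma> - d / p) * V"
        proof -
          have "l powr (1 - p) * \<rho> powr e = \<rho> powr (d + \<sigma> - d / p) * \<rho> powr d"
            using p unfolding l_def powr_powr e_def powr_add[symmetric]
            by (intro arg_cong2[where f="(powr)"] refl) (simp add: field_simps)
          moreover have "(2 * \<rho>) powr e = 2 powr e * \<rho> powr e" using *(2) by (simp add: powr_mult)
          ultimately show ?thesis using w by (simp add: V mult_ac)
        qed
        ultimately have "\<bar>LINT y|lebesgue_on U. g y * \<eta> y\<bar> * V \<le>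
            ((w + 2 powr e * S / w) * B * \<rho> powr (d + \<sigma> - d / p)) * V" by (simp add: algebra_simps)
        then show "\<bar>LINT y|lebesgue_on U. f y * partials (replicate k i) \<eta> y\<bar>
            \<le> (w + 2 powr e * S / w) * B * \<rho> powr (d + \<sigma> - d / p)"
          using red[OF g(2) *(1), of z \<rho>] * V0 by simp
      qed (use w S in auto)
    qed
  qed
  from choice[OF allI[OF ex]] obtain C where C: "\<forall>i. 0 \<le> C i \<and> (\<forall>\<eta> z \<rho> B. smooth \<eta> \<longrightarrow> 0 < \<rho> \<longrightarrow>
     (\<forall>y. y \<notin> cball z \<rho> \<longrightarrow> \<eta> y = 0) \<longrightarrow> cball z \<rho> \<subseteq> ball x0 r \<longrightarrow> (\<forall>y. \<bar>\<eta> y\<bar> \<le> B) \<longrightarrow>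
     (LINT y|lborel. \<eta> y) = 0 \<longrightarrow>
     \<bar>LINT y|lebesgue_on U. f y * partials (replicate k i) \<eta> y\<bar> \<le> C i * B * \<rho> powr (d + \<sigma> - d / p))" ..
  have C0: "0 \<le> C i" for i using C by simp
  show ?thesis
  proof (intro exI[of _ "\<Sum>i\<in>UNIV. C i"] conjI allI impI)
    fix i :: 'd and \<eta> and z :: "real^'d" and \<rho> B :: real
    assume *: "smooth \<eta>" "0 < \<rho>" "\<forall>y. y \<notin> cball z \<rho> \<longrightarrow> \<eta> y = 0" "cball z \<rho> \<subseteq> ball x0 r"
      "\<forall>y. \<bar>\<eta> y\<bar> \<le> B" "(LINT y|lborel. \<eta> y) = 0"
    have B: "0 \<le> B" using *(5) by (meson abs_ge_zero order_trans)
    have "C i \<le> (\<Sum>i\<in>UNIV. C i)" using C0 by (intro member_le_sum) auto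
    then have "C i * B * \<rho> powr (d + \<sigma> - d / p) \<le> (\<Sum>i\<in>UNIV. C i) * B * \<rho> powr (d + \<sigma> - d / p)"
      using B by (intro mult_right_mono) auto
    moreover have "\<bar>LINT y|lebesgue_on U. f y * partials (replicate k i) \<eta> y\<bar> \<le> C i * B * \<rho> powr (d + \<sigma> - d / p)"
      using C[rule_format, of i, THEN conjunct2, rule_format, of \<eta> \<rho> z B] * by blast
    ultimately show "\<bar>LINT y|lebesgue_on (cball x0 r). f y * partials (replicate k i) \<eta> y\<bar>
       \<le> (\<Sum>i\<in>UNIV. C i) * B * \<rho> powr (real CARD('d) + (s - real k) - real CARD('d) / p)"
      by (simp add: U_def d_def \<sigma>_def)
  qed (use C0 in \<open>auto intro: sum_nonneg\<close>)
qed

section \<open>A tensor product kernel\<close>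

text \<open>The difference of two products, changed one factor at a time. The factors left alone come from
  either product.\<close>

lemma prod_diff_telescope:
  fixes a c :: "real \<Rightarrow> real" and y :: "real^'d::finite"
  assumes "finite I"
  shows "\<exists>E :: 'd \<Rightarrow> 'd \<Rightarrow> real \<Rightarrow> real. (\<forall>i j. E i j \<in> {a, c}) \<and>
    (\<forall>y :: real^'d. (\<Prod>j\<in>I. a (y $ j)) - (\<Prod>j\<in>I. c (y $ j)) =
       (\<Sum>i\<in>I. (a (y $ i) - c (y $ i)) * (\<Prod>j\<in>I - {i}. E i j (y $ j))))"
  using assms
proof (induction I)
  case empty
  show ?case by (intro exI[of _ "\<lambda>_ _. a"]) simp
next
  case (insert n I)
  then obtain E where E: "\<And>i j. E i j \<in> {a, c}"
    "\<And>y :: real^'d. (\<Prod>j\<in>I. a (y $ j)) - (\<Prod>j\<in>I. c (y $ j)) =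
       (\<Sum>i\<in>I. (a (y $ i) - c (y $ i)) * (\<Prod>j\<in>I - {i}. E i j (y $ j)))" by blast
  define E' where "E' i j = (if i = n then a else if j = n then c else E i j)" for i j
  have "(\<Prod>j\<in>insert n I. a (y $ j)) - (\<Prod>j\<in>insert n I. c (y $ j)) =
       (\<Sum>i\<in>insert n I. (a (y $ i) - c (y $ i)) * (\<Prod>j\<in>insert n I - {i}. E' i j (y $ j)))" for y :: "real^'d"
  proof -
    have 1: "(\<Prod>j\<in>insert n I - {n}. E' n j (y $ j)) = (\<Prod>j\<in>I. a (y $ j))"
      using insert.hyps by (intro prod.cong) (auto simp: E'_def)
    have 2: "(\<Prod>j\<in>insert n I - {i}. E' i j (y $ j)) = c (y $ n) * (\<Prod>j\<in>I - {i}. E i j (y $ j))"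
      if "i \<in> I" for i
    proof -
      have eq: "insert n I - {i} = insert n (I - {i})" using that insert.hyps by auto
      have "(\<Prod>j\<in>I - {i}. E' i j (y $ j)) = (\<Prod>j\<in>I - {i}. E i j (y $ j))"
        using that insert.hyps by (intro prod.cong) (auto simp: E'_def)
      moreover have "E' i n = c" using that insert.hyps by (auto simp: E'_def)
      ultimately show ?thesis unfolding eq using insert.hyps by simp
    qed
    have "(\<Sum>i\<in>I. (a (y $ i) - c (y $ i)) * (\<Prod>j\<in>insert n I - {i}. E' i j (y $ j))) =
        c (y $ n) * ((\<Prod>j\<in>I. a (y $ j)) - (\<Prod>j\<in>I. c (y $ j)))"
      unfolding E(2) sum_distrib_left by (intro sum.cong refl) (simp add: 2 mult_ac)
    then have "(\<Sum>i\<in>insert n I. (a (y $ i) - c (y $ i)) * (\<Prod>j\<in>insert n I - {i}. E' i j (y $ j))) =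
        (a (y $ n) - c (y $ n)) * (\<Prod>j\<in>I. a (y $ j)) +
        c (y $ n) * ((\<Prod>j\<in>I. a (y $ j)) - (\<Prod>j\<in>I. c (y $ j)))"
      unfolding sum.insert[OF insert.hyps] 1 by (simp only:)
    then show ?thesis using insert.hyps by (simp add: algebra_simps)
  qed
  moreover have "E' i j \<in> {a, c}" for i j using E(1) by (auto simp: E'_def)
  ultimately show ?case by blast
qed

text \<open>Take the tensor power of the mollifier in one variable. The difference to its dilation
  telescopes into products in which one factor is \<open>b(t) - 2 b(2t)\<close>, a derivative of order \<open>N + 1\<close>.\<close>

lemma exists_kernel:
  "\<exists>(\<phi> :: real^'d::finite \<Rightarrow> real) g A. A \<ge> 1 \<and> smooth \<phi> \<and> (\<forall>y. y \<notin> cball 0 A \<longrightarrow> \<phi> y = 0) \<and>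
     (\<forall>z \<rho>. \<rho> > 0 \<longrightarrow> (LINT y|lborel. (1 / \<rho>) ^ CARD('d) * \<phi> ((1 / \<rho>) *\<^sub>R (y - z))) = 1) \<and>
     (\<forall>i. smooth (g i) \<and> (\<forall>y. y \<notin> cball 0 A \<longrightarrow> g i y = 0) \<and>
        (\<forall>L M. partials L (partials M (g i)) = partials M (partials L (g i)))) \<and>
     (\<forall>y. \<phi> y - 2 ^ CARD('d) * \<phi> (2 *\<^sub>R y) = (\<Sum>i\<in>UNIV. partials (replicate (Suc N) i) (g i) y))"
proof -
  obtain b h A where *: "A > 0" "smooth1 b" "smooth1 h" "\<And>t. \<bar>t\<bar> \<ge> A \<Longrightarrow> b t = 0"
    "\<And>t. \<bar>t\<bar> \<ge> A \<Longrightarrow> h t = 0" "(LINT t|lborel. b t) = 1"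
    and bh: "\<And>t. b t - 2 * b (2 * t) = (deriv ^^ Suc N) h t" using exists_mollifier by blast
  define c where "c t = 2 * b (2 * t + 0) + 0 * b t" for t
  have c: "smooth1 c" unfolding c_def by (intro smooth1_lincomb smooth1_affine *)
  have c0: "c t = 0" if "\<bar>t\<bar> \<ge> A" for t using that *(1,4) by (simp add: c_def)
  have bc: "b t - c t = (deriv ^^ Suc N) h t" for t using bh[of t] by (simp add: c_def)
  obtain E :: "'d \<Rightarrow> 'd \<Rightarrow> real \<Rightarrow> real" where E: "\<And>i j. E i j \<in> {b, c}"
    "\<And>y. (\<Prod>j\<in>UNIV. b (y $ j)) - (\<Prod>j\<in>UNIV. c (y $ j)) =
       (\<Sum>i\<in>UNIV. (b (y $ i) - c (y $ i)) * (\<Prod>j\<in>UNIV - {i}. E i j (y $ j)))"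
    using prod_diff_telescope[of "UNIV :: 'd set" b c] by auto
  define G where "G i j = (if j = i then h else E i j)" for i j
  have G: "smooth1 (G i j)" for i j using E(1)[of i j] *(2,3) c by (auto simp: G_def)
  have G0: "G i j t = 0" if "\<bar>t\<bar> \<ge> A" for i j t
    using E(1)[of i j] *(4,5)[of t] c0[of t] that by (auto simp: G_def)
  define \<phi> :: "real^'d \<Rightarrow> real" where "\<phi> = tensor (\<lambda>_. b)"
  \<comment> \<open>Outside this ball some coordinate exceeds \<open>A\<close>, since the norm is at most the sum of the
    absolute values of the coordinates.\<close>
  define A' where "A' = max 1 (real CARD('d) * A)"
  have supp: "tensor F y = 0" if "y \<notin> cball 0 A'" "\<And>j t. \<bar>t\<bar> \<ge> A \<Longrightarrow> F j t = 0" for F and y :: "real^'d"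
  proof -
    have "\<exists>j. \<bar>y $ j\<bar> \<ge> A"
    proof (rule ccontr)
      assume "\<not> ?thesis"
      then have "(\<Sum>j\<in>UNIV. \<bar>y $ j\<bar>) \<le> (\<Sum>j\<in>(UNIV::'d set). A)" by (intro sum_mono) (auto simp: not_le less_imp_le)
      then have "norm y \<le> real CARD('d) * A" using norm_le_l1_cart[of y] by simp
      then show False using that(1) by (simp add: A'_def)
    qed
    then show ?thesis using that(2) unfolding tensor_def by (intro prod_zero) auto
  qed
  have mass: "(LINT y|lborel. (1 / \<rho>) ^ CARD('d) * \<phi> ((1 / \<rho>) *\<^sub>R (y - z))) = 1" if \<rho>: "\<rho> > 0" for z \<rho>
  proof -
    define F where "F j t = (1 / \<rho>) * b ((1 / \<rho>) * (t - z $ j))" for j t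
    have "(\<lambda>y. (1 / \<rho>) ^ CARD('d) * \<phi> ((1 / \<rho>) *\<^sub>R (y - z))) = tensor F"
      by (rule ext) (simp only: \<phi>_def tensor_def F_def prod.distrib, simp)
    moreover have bi: "integrable lborel b"
      by (rule integrable_compact_support[OF smooth1_continuous[OF *(2)], of "{-A..A}"])
        (use *(4) in \<open>auto simp: abs_real_def not_le\<close>)
    have "integrable lborel (F j)" for j
    proof -
      have "integrable lborel (\<lambda>t. (1 / \<rho>) * b (- (z $ j) / \<rho> + (1 / \<rho>) * t))"
        using \<rho> by (intro integrable_mult_right lborel_integrable_real_affine bi) auto
      then show ?thesis by (simp add: F_def[abs_def] diff_divide_distrib)
    qed
    moreover have "(LINT t|lborel. F j t) = 1" for j
    proof -
      have "1 = \<bar>1 / \<rho>\<bar> *\<^sub>R (LINT t|lborel. b (- (z $ j) / \<rho> + (1 / \<rho>) * t))"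
        using \<rho> *(6) lborel_integral_real_affine[of "1 / \<rho>" b "- (z $ j) / \<rho>"] by simp
      then show ?thesis using \<rho> by (simp add: F_def diff_divide_distrib)
    qed
    ultimately show ?thesis by (simp add: integral_tensor)
  qed
  have split: "\<phi> y - 2 ^ CARD('d) * \<phi> (2 *\<^sub>R y) = (\<Sum>i\<in>UNIV. partials (replicate (Suc N) i) (tensor (G i)) y)" for y
  proof -
    have "2 ^ CARD('d) * \<phi> (2 *\<^sub>R y) = (\<Prod>j\<in>UNIV. c (y $ j))"
      by (simp add: \<phi>_def tensor_def c_def prod.distrib)
    then have "\<phi> y - 2 ^ CARD('d) * \<phi> (2 *\<^sub>R y) =
        (\<Sum>i\<in>UNIV. (deriv ^^ Suc N) h (y $ i) * (\<Prod>j\<in>UNIV - {i}. E i j (y $ j)))"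
      using E(2)[of y] by (simp only: \<phi>_def tensor_def bc)
    also have "\<dots> = (\<Sum>i\<in>UNIV. partials (replicate (Suc N) i) (tensor (G i)) y)"
    proof (rule sum.cong[OF refl])
      fix i :: 'd
      let ?H = "\<lambda>j. (deriv ^^ count_list (replicate (Suc N) i) j) (G i j)"
      have count: "count_list (replicate (Suc N) i) j = (if j = i then Suc N else 0)" for j
        by (induction N) auto
      have "partials (replicate (Suc N) i) (tensor (G i)) y = (\<Prod>j\<in>UNIV. ?H j (y $ j))"
        unfolding partials_tensor(1)[OF G] tensor_def ..
      also have "\<dots> = ?H i (y $ i) * (\<Prod>j\<in>UNIV - {i}. ?H j (y $ j))"
        by (rule prod.remove) auto
      also have "?H i = (deriv ^^ Suc N) h" unfolding count by (simp add: G_def)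
      also have "(\<Prod>j\<in>UNIV - {i}. ?H j (y $ j)) = (\<Prod>j\<in>UNIV - {i}. E i j (y $ j))"
        unfolding count by (intro prod.cong) (auto simp: G_def)
      finally show "(deriv ^^ Suc N) h (y $ i) * (\<Prod>j\<in>UNIV - {i}. E i j (y $ j)) =
         partials (replicate (Suc N) i) (tensor (G i)) y" by simp
    qed
    finally show ?thesis .
  qed
  have supp_\<phi>: "\<phi> y = 0" if "y \<notin> cball 0 A'" for y
    unfolding \<phi>_def by (rule supp[OF that]) (rule *(4))
  have supp_G: "tensor (G i) y = 0" if "y \<notin> cball 0 A'" for i y
    by (rule supp[OF that]) (rule G0)
  have "A' \<ge> 1" by (simp add: A'_def)
  moreover have "smooth \<phi>" unfolding \<phi>_def by (intro smooth_tensor *)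
  ultimately show ?thesis
    by (intro exI[of _ \<phi>] exI[of _ "\<lambda>i. tensor (G i)"] exI[of _ A'] conjI allI impI
        mass split supp_\<phi> supp_G smooth_tensor[OF G] partials_tensor_commute[OF G])
qed

section \<open>Local polynomial approximation of Sobolev functions\<close>

text \<open>Dyadic scales \<open>\<rho>0 / 2\<^sup>N\<close> represent every scale up to a factor 2.\<close>

lemma dyadic_scale:
  assumes "0 < h" "h \<le> \<rho>0"
  shows "\<exists>N. h \<le> \<rho>0 / 2 ^ N \<and> \<rho>0 / 2 ^ N < 2 * (h :: real)"
proof -
  obtain M where "(1 / 2) ^ M < h / \<rho>0" using real_arch_pow_inv[of "h / \<rho>0" "1/2"] assms by auto
  then have ex: "\<exists>M. \<rho>0 / 2 ^ M < h" using assms by (auto simp: field_simps power_divide)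
  define M where "M = (LEAST M. \<rho>0 / 2 ^ M < h)"
  have M: "\<rho>0 / 2 ^ M < h" unfolding M_def by (rule LeastI_ex[OF ex])
  then have "M \<noteq> 0" using assms by (intro notI) simp
  then obtain N where N: "M = Suc N" using not0_implies_Suc by blast
  have "\<not> \<rho>0 / 2 ^ N < h" using not_less_Least[of N "\<lambda>M. \<rho>0 / 2 ^ M < h"] N by (simp add: M_def)
  moreover have "\<rho>0 / 2 ^ N < 2 * h" using M N by (simp add: field_simps)
  ultimately show ?thesis by (intro exI[of _ N]) simp
qed

text \<open>In this locale \<open>\<psi> \<rho>\<close> is the kernel \<open>\<phi>\<close> dilated by \<open>\<rho>\<close> and centred at \<open>x0\<close>, and \<open>\<gamma> \<rho> i\<close> is the dilation of
  \<open>g i\<close> with the factor that makes \<open>\<psi> \<rho> - \<psi> (\<rho> / 2)\<close> the sum of its derivatives. \<open>W n v \<rho>\<close> is the Taylor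
  remainder of order \<open>n\<close> at \<open>x0 + v\<close> of the mollification of \<open>f\<close> at scale \<open>\<rho>\<close>, expanded at \<open>x0\<close>; in
  particular \<open>W 0 v \<rho>\<close> is the mollification itself, evaluated at \<open>x0 + v\<close>.\<close>

locale sobolev_smoothing =
  fixes f :: "real^'d::finite \<Rightarrow> real" and x0 :: "real^'d" and r s p :: real
    and \<phi> :: "real^'d \<Rightarrow> real" and g :: "'d \<Rightarrow> real^'d \<Rightarrow> real" and A :: real
  assumes r: "0 < r" and p: "1 \<le> p" and s: "real CARD('d) / p < s"
    and f: "f \<in> sobolev s p (cball x0 r)" and cont: "continuous_on (cball x0 r) f"
    and A: "1 \<le> A" and smooth_\<phi>: "smooth \<phi>" and supp_\<phi>: "\<And>y. y \<notin> cball 0 A \<Longrightarrow> \<phi> y = 0"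
    and mass: "\<And>\<rho> z. 0 < \<rho> \<Longrightarrow> (LINT y|lborel. (1 / \<rho>) ^ CARD('d) * \<phi> ((1 / \<rho>) *\<^sub>R (y - z))) = 1"
    and smooth_g: "\<And>i. smooth (g i)" and supp_g: "\<And>i y. y \<notin> cball 0 A \<Longrightarrow> g i y = 0"
    and comm_g: "\<And>i L M. partials L (partials M (g i)) = partials M (partials L (g i))"
    and split: "\<And>y. \<phi> y - 2 ^ CARD('d) * \<phi> (2 *\<^sub>R y) =
      (\<Sum>i\<in>UNIV. partials (replicate (Suc (nat \<lfloor>s\<rfloor>)) i) (g i) y)"
begin

definition "k = nat \<lfloor>s\<rfloor>"
definition "d = CARD('d)"
definition "t = s - real d / p"
definition "U = cball x0 r"
definition "\<psi> \<rho> y = (1 / \<rho>) ^ d * \<phi> ((1 / \<rho>) *\<^sub>R (y - x0))"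
definition "\<gamma> \<rho> i y = (\<rho> ^ Suc k * (1 / \<rho>) ^ d) * g i ((1 / \<rho>) *\<^sub>R (y - x0))"
definition "W n v \<rho> = (LINT y|lebesgue_on U. f y * taylor_rem n v (\<psi> \<rho>) y)"

lemma t_pos: "0 < t" using s by (simp add: t_def d_def)

lemma s_pos: "0 < s"
proof -
  have "0 \<le> real CARD('d) / p" using p by simp
  then show ?thesis using s by linarith
qed

lemma U_sets: "U \<in> sets lebesgue" by (simp add: U_def)

lemma outside_scaled:
  assumes "0 < \<rho>" "y \<notin> cball x0 (A * \<rho>)" shows "(1 / \<rho>) *\<^sub>R (y - x0) \<notin> cball 0 A"
  using assms by (simp add: dist_norm norm_minus_commute pos_le_divide_eq pos_divide_le_eq)

lemma smooth_\<psi>: "smooth (\<psi> \<rho>)"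
  unfolding \<psi>_def[abs_def] by (rule smooth_cmult[OF smooth_affine[OF smooth_\<phi>]])

lemma supp_\<psi>: "0 < \<rho> \<Longrightarrow> y \<notin> cball x0 (A * \<rho>) \<Longrightarrow> \<psi> \<rho> y = 0"
  unfolding \<psi>_def using supp_\<phi>[OF outside_scaled] by simp

lemma partials_\<gamma>:
  "partials L (\<gamma> \<rho> i) =
    (\<lambda>y. (\<rho> ^ Suc k * (1 / \<rho>) ^ d) * ((1 / \<rho>) ^ length L * partials L (g i) ((1 / \<rho>) *\<^sub>R (y - x0))))"
  unfolding \<gamma>_def[abs_def] partials_cmult[OF smooth_affine[OF smooth_g]] partials_affine[OF smooth_g] ..

lemma smooth_\<gamma>: "smooth (\<gamma> \<rho> i)"
  unfolding \<gamma>_def[abs_def] by (rule smooth_cmult[OF smooth_affine[OF smooth_g]])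

lemma supp_\<gamma>: "0 < \<rho> \<Longrightarrow> y \<notin> cball x0 (A * \<rho>) \<Longrightarrow> \<gamma> \<rho> i y = 0"
  unfolding \<gamma>_def using supp_g[OF outside_scaled] by simp

lemma comm_\<gamma>: "partials L (partials M (\<gamma> \<rho> i)) = partials M (partials L (\<gamma> \<rho> i))"
proof -
  have "partials (L @ M) (\<gamma> \<rho> i) = partials (M @ L) (\<gamma> \<rho> i)"
    unfolding partials_\<gamma> by (simp add: partials_append comm_g[where L=L and M=M] add.commute)
  then show ?thesis by (simp only: partials_append)
qed

lemma \<psi>_split:
  assumes "0 < \<rho>"
  shows "\<psi> \<rho> y - \<psi> (\<rho> / 2) y = (\<Sum>i\<in>UNIV. partials (replicate (Suc k) i) (\<gamma> \<rho> i) y)"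
proof -
  define w where "w = (1 / \<rho>) *\<^sub>R (y - x0)"
  have "\<psi> (\<rho> / 2) y = (1 / \<rho>) ^ d * (2 ^ d * \<phi> (2 *\<^sub>R w))"
    by (simp add: \<psi>_def w_def power_divide)
  then have "\<psi> \<rho> y - \<psi> (\<rho> / 2) y = (1 / \<rho>) ^ d * (\<phi> w - 2 ^ d * \<phi> (2 *\<^sub>R w))"
    by (simp add: \<psi>_def w_def right_diff_distrib)
  also have "\<dots> = (\<Sum>i\<in>UNIV. (1 / \<rho>) ^ d * partials (replicate (Suc k) i) (g i) w)"
    by (simp only: split d_def k_def sum_distrib_left)
  also have "\<dots> = (\<Sum>i\<in>UNIV. partials (replicate (Suc k) i) (\<gamma> \<rho> i) y)"
  proof (rule sum.cong[OF refl])
    fix i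
    have "\<rho> ^ Suc k * (1 / \<rho>) ^ Suc k = 1" using assms by (simp only: flip: power_mult_distrib) simp
    then show "(1 / \<rho>) ^ d * partials (replicate (Suc k) i) (g i) w = partials (replicate (Suc k) i) (\<gamma> \<rho> i) y"
      unfolding partials_\<gamma> w_def[symmetric] length_replicate by (simp only: mult_ac) (metis mult.assoc mult.commute mult_1)
  qed
  finally show ?thesis .
qed

text \<open>By \<open>\<psi>_split\<close> the difference of two consecutive scales is a pairing of \<open>f\<close> with derivatives of order
  \<open>k\<close> of remainders \<open>\<eta> i\<close> that have mean 0. The duality estimate then gives the bound, with
  \<open>\<bar>v\<bar>\<^sup>n\<close> coming from Taylor's formula for the kernel.\<close>

lemma W_step:
  "\<exists>C\<ge>0. \<forall>v \<rho>. 0 < \<rho> \<longrightarrow> (n = 0 \<or> norm v \<le> \<rho>) \<longrightarrow> norm v + (A + 1) * \<rho> < r \<longrightarrow>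
     \<bar>W n v \<rho> - W n v (\<rho> / 2)\<bar> \<le> C * norm v ^ n * \<rho> powr (t - real n)"
proof -
  define E where "E = real d + (s - real k) - real d / p"
  obtain C where C: "C \<ge> 0" and dual: "\<And>i \<eta> z \<rho> B. smooth \<eta> \<Longrightarrow> 0 < \<rho> \<Longrightarrow> (\<And>y. y \<notin> cball z \<rho> \<Longrightarrow> \<eta> y = 0) \<Longrightarrow>
     cball z \<rho> \<subseteq> ball x0 r \<Longrightarrow> (\<And>y. \<bar>\<eta> y\<bar> \<le> B) \<Longrightarrow> (LINT y|lborel. \<eta> y) = 0 \<Longrightarrow>
     \<bar>LINT y|lebesgue_on U. f y * partials (replicate k i) \<eta> y\<bar> \<le> C * B * \<rho> powr E"
    using sobolev_duality[OF r p s_pos f] unfolding U_def k_def E_def d_def by blast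
  have "\<exists>B\<ge>0. \<forall>L y. length L = Suc n \<longrightarrow> \<bar>partials L (g i) y\<bar> \<le> B" for i
    by (rule smooth_bounded[OF smooth_g supp_g])
  then obtain Bi where Bi: "\<And>i. Bi i \<ge> 0" "\<And>i L y. length L = Suc n \<Longrightarrow> \<bar>partials L (g i) y\<bar> \<le> Bi i"
    by metis
  define B where "B = (\<Sum>i\<in>UNIV. Bi i)"
  have B0: "0 \<le> B" using Bi(1) by (auto simp: B_def intro: sum_nonneg)
  have B: "\<bar>partials L (g i) y\<bar> \<le> B" if "length L = Suc n" for i L y
  proof -
    have "Bi i \<le> B" unfolding B_def using Bi(1) by (intro member_le_sum) auto
    then show ?thesis using Bi(2)[OF that, of i y] by linarith
  qed
  define D where "D = real d * (C * (real d ^ n * B) * (A + 1) powr E)"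
  show ?thesis
  proof (intro exI[of _ D] conjI allI impI)
    show "0 \<le> D" using C B0 by (simp add: D_def)
    fix v :: "real^'d" and \<rho> :: real
    assume \<rho>: "0 < \<rho>" and n: "n = 0 \<or> norm v \<le> \<rho>" and small: "norm v + (A + 1) * \<rho> < r"
    \<comment> \<open>The centre of a ball that contains the support of the remainder. Without Taylor terms this is
      a translated ball, and \<open>v\<close> may be large compared with \<open>\<rho>\<close>; otherwise the kernel at \<open>x0\<close> contributes
      and \<open>norm v \<le> \<rho>\<close> keeps both supports together.\<close>
    define z where "z = (if n = 0 then x0 + v else x0)"
    have rem0: "taylor_rem n v u y = 0"
      if u: "\<And>y. y \<notin> cball x0 (A * \<rho>) \<Longrightarrow> u y = 0" and y: "y \<notin> cball z ((A + 1) * \<rho>)" for u y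
    proof (cases "n = 0")
      case True
      have "u (y - v) = 0"
        using y \<rho> True by (intro u) (auto simp: z_def dist_norm algebra_simps)
      then show ?thesis using True by (simp add: taylor_rem_def)
    next
      case False
      then show ?thesis using y n \<rho>
        by (intro taylor_rem_zero_outside[where z = x0 and R = "A * \<rho>", OF u]) (auto simp: z_def algebra_simps)
    qed
    have ball: "cball z ((A + 1) * \<rho>) \<subseteq> ball x0 r"
    proof
      fix y assume "y \<in> cball z ((A + 1) * \<rho>)"
      moreover have "dist x0 y \<le> dist x0 z + dist z y" by (rule dist_triangle)
      moreover have "dist x0 z \<le> norm v" by (simp add: z_def dist_norm)
      ultimately show "y \<in> ball x0 r" using small by simp
    qed
    define \<eta> where "\<eta> i = taylor_rem n v (partials [i] (\<gamma> \<rho> i))" for i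
    \<comment> \<open>One of the \<open>k + 1\<close> derivatives stays with the test function and gives it mean 0.\<close>
    have rep: "replicate (Suc k) i = replicate k i @ [i]" for i :: 'd
      by (simp add: replicate_append_same)
    have rem_top: "taylor_rem n v (partials (replicate (Suc k) i) (\<gamma> \<rho> i)) = partials (replicate k i) (\<eta> i)" for i
      unfolding \<eta>_def rep partials_append
      by (rule partials_taylor_rem[symmetric, OF smooth_partials[OF smooth_\<gamma>]])
        (metis comm_\<gamma> partials_append)
    have \<eta>_eq: "\<eta> i = partials [i] (taylor_rem n v (\<gamma> \<rho> i))" for i
      unfolding \<eta>_def by (rule partials_taylor_rem[symmetric, OF smooth_\<gamma> comm_\<gamma>])
    have sm_\<eta>: "smooth (\<eta> i)" for i
      unfolding \<eta>_def by (intro smooth_taylor_rem smooth_partials smooth_\<gamma>)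
    have diff: "taylor_rem n v (\<psi> \<rho>) y - taylor_rem n v (\<psi> (\<rho> / 2)) y =
        (\<Sum>i\<in>UNIV. partials (replicate k i) (\<eta> i) y)" for y
    proof -
      have "taylor_rem n v (\<psi> \<rho>) y - taylor_rem n v (\<psi> (\<rho> / 2)) y =
          taylor_rem n v (\<lambda>y. \<Sum>i\<in>UNIV. 1 * partials (replicate (Suc k) i) (\<gamma> \<rho> i) y) y"
        unfolding taylor_rem_diff[OF smooth_\<psi> smooth_\<psi>, symmetric] \<psi>_split[OF \<rho>] mult_1 ..
      also have "\<dots> = (\<Sum>i\<in>UNIV. 1 * taylor_rem n v (partials (replicate (Suc k) i) (\<gamma> \<rho> i)) y)"
        by (rule taylor_rem_sum) (auto intro!: smooth_partials smooth_\<gamma> simp del: replicate.simps)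
      finally show ?thesis by (simp only: rem_top mult_1)
    qed
    have int: "integrable (lebesgue_on U) (\<lambda>y. f y * u y)" if "smooth u" for u
      unfolding U_def by (rule integrable_mult_continuous[OF compact_cball cont smooth_continuous[OF that]])
    have "W n v \<rho> - W n v (\<rho> / 2) = (LINT y|lebesgue_on U. f y * taylor_rem n v (\<psi> \<rho>) y - f y * taylor_rem n v (\<psi> (\<rho> / 2)) y)"
      unfolding W_def by (intro Bochner_Integration.integral_diff[symmetric] int smooth_taylor_rem smooth_\<psi>)
    also have "\<dots> = (LINT y|lebesgue_on U. (\<Sum>i\<in>UNIV. f y * partials (replicate k i) (\<eta> i) y))"
      by (simp only: right_diff_distrib[symmetric] diff sum_distrib_left)
    also have "\<dots> = (\<Sum>i\<in>UNIV. (LINT y|lebesgue_on U. f y * partials (replicate k i) (\<eta> i) y))"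
      by (intro Bochner_Integration.integral_sum int smooth_partials sm_\<eta>)
    finally have W: "W n v \<rho> - W n v (\<rho> / 2) = (\<Sum>i\<in>UNIV. (LINT y|lebesgue_on U. f y * partials (replicate k i) (\<eta> i) y))" .
    define Q where "Q = (real d * norm v) ^ n * (\<rho> ^ Suc k * (1 / \<rho>) ^ d * ((1 / \<rho>) ^ Suc n * B))"
    have "\<bar>LINT y|lebesgue_on U. f y * partials (replicate k i) (\<eta> i) y\<bar> \<le> C * Q * ((A + 1) * \<rho>) powr E" for i
    proof (rule dual)
      show "smooth (\<eta> i)" by (rule sm_\<eta>)
      show "0 < (A + 1) * \<rho>" using A \<rho> by simp
      show "cball z ((A + 1) * \<rho>) \<subseteq> ball x0 r" by (rule ball)
      show "\<eta> i y = 0" if "y \<notin> cball z ((A + 1) * \<rho>)" for y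
        unfolding \<eta>_def using that
        by (intro rem0) (auto intro!: partials_zero_outside_cball[of x0 "A * \<rho>"] supp_\<gamma>[OF \<rho>] simp del: partials.simps)
      show "(LINT y|lborel. \<eta> i y) = 0"
        unfolding \<eta>_eq
        by (rule integral_partial_zero[OF smooth_taylor_rem[OF smooth_\<gamma>] rem0[OF supp_\<gamma>[OF \<rho>]]])
      show "\<bar>\<eta> i y\<bar> \<le> Q" for y
        unfolding \<eta>_def Q_def d_def
      proof (rule taylor_rem_bound[OF smooth_partials[OF smooth_\<gamma>]])
        fix L :: "'d list" and y assume L: "length L = n"
        have "\<bar>partials (L @ [i]) (\<gamma> \<rho> i) y\<bar> \<le> \<rho> ^ Suc k * (1 / \<rho>) ^ d * ((1 / \<rho>) ^ Suc n * B)"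
          unfolding partials_\<gamma> abs_mult using \<rho> L B[of "L @ [i]" i]
          by (intro mult_mono) (auto simp: abs_mult power_abs)
        then show "\<bar>partials L (partials [i] (\<gamma> \<rho> i)) y\<bar> \<le> \<rho> ^ Suc k * (1 / \<rho>) ^ CARD('d) * ((1 / \<rho>) ^ Suc n * B)"
          by (simp only: partials_append d_def)
      qed
    qed
    then have "\<bar>W n v \<rho> - W n v (\<rho> / 2)\<bar> \<le> (\<Sum>i\<in>(UNIV :: 'd set). C * Q * ((A + 1) * \<rho>) powr E)"
      unfolding W by (intro order_trans[OF sum_abs] sum_mono)
    also have "\<dots> = D * norm v ^ n * \<rho> powr (t - real n)"
    proof -
      have "\<rho> ^ Suc k * (1 / \<rho>) ^ d * (1 / \<rho>) ^ Suc n * \<rho> powr E = \<rho> powr (real (Suc k) - real d - real (Suc n) + E)"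
        using \<rho> by (simp only: powr_add powr_diff powr_realpow power_divide power_one) (simp add: field_simps)
      also have "real (Suc k) - real d - real (Suc n) + E = t - real n" by (simp add: E_def t_def)
      finally have *: "\<rho> ^ Suc k * (1 / \<rho>) ^ d * (1 / \<rho>) ^ Suc n * \<rho> powr E = \<rho> powr (t - real n)" .
      have "(\<Sum>i\<in>(UNIV :: 'd set). C * Q * ((A + 1) * \<rho>) powr E) =
          D * norm v ^ n * (\<rho> ^ Suc k * (1 / \<rho>) ^ d * (1 / \<rho>) ^ Suc n * \<rho> powr E)"
        using A \<rho> by (simp add: Q_def D_def d_def powr_mult power_mult_distrib mult_ac del: power_Suc)
      then show ?thesis by (simp only: *)
    qed
    finally show "\<bar>W n v \<rho> - W n v (\<rho> / 2)\<bar> \<le> D * norm v ^ n * \<rho> powr (t - real n)" .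
  qed
qed

lemma f_bounded: "\<exists>F\<ge>0. \<forall>y\<in>U. \<bar>f y\<bar> \<le> F"
proof -
  have "bounded (f ` U)" unfolding U_def
    by (intro compact_imp_bounded compact_continuous_image cont) simp
  then show ?thesis by (auto simp: bounded_pos intro: less_imp_le)
qed

text \<open>At the coarsest scale the kernel is fixed, and it suffices that \<open>f\<close> is bounded.\<close>

lemma W_initial:
  assumes "0 < \<rho>"
  shows "\<exists>C\<ge>0. \<forall>v. \<bar>W n v \<rho>\<bar> \<le> C * norm v ^ n"
proof -
  obtain F where F: "F \<ge> 0" "\<And>y. y \<in> U \<Longrightarrow> \<bar>f y\<bar> \<le> F" using f_bounded by blast
  obtain B where B: "B \<ge> 0" "\<And>L y. length L = n \<Longrightarrow> \<bar>partials L (\<psi> \<rho>) y\<bar> \<le> B"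
    using smooth_bounded[OF smooth_\<psi> supp_\<psi>[OF assms], where n=n] by blast
  define V where "V = measure lborel (cball x0 r)"
  show ?thesis
  proof (intro exI[of _ "F * (real d ^ n * B) * V"] conjI allI)
    show "0 \<le> F * (real d ^ n * B) * V" using F B by (simp add: V_def)
    fix v
    have "\<bar>W n v \<rho>\<bar> \<le> (F * ((real d * norm v) ^ n * B)) * V"
      unfolding W_def V_def
    proof (rule lebesgue_on_integral_bound[OF U_sets])
      show "0 \<le> F * ((real d * norm v) ^ n * B)" using F B by simp
      show "\<bar>f y * taylor_rem n v (\<psi> \<rho>) y\<bar> \<le> F * ((real d * norm v) ^ n * B)" if "y \<in> U" for y
        unfolding abs_mult using F(2)[OF that] F(1) taylor_rem_bound[OF smooth_\<psi> B(2), of n v y]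
        by (intro mult_mono) (auto simp: d_def)
    qed (simp add: U_def)
    then show "\<bar>W n v \<rho>\<bar> \<le> F * (real d ^ n * B) * V * norm v ^ n"
      by (simp add: power_mult_distrib mult_ac)
  qed
qed

text \<open>The dilated kernels form an approximate identity. They need not be nonnegative, but their \<open>L\<^sup>1\<close>
  norms are bounded independently of the scale.\<close>

lemma W_limit:
  assumes \<rho>0: "0 < \<rho>0" and v: "norm v < r"
  shows "(\<lambda>N. W 0 v (\<rho>0 / 2 ^ N)) \<longlonglongrightarrow> f (x0 + v)"
proof -
  define x where "x = x0 + v"
  have x: "x \<in> ball x0 r" using v by (simp add: x_def dist_norm)
  obtain B where B: "B \<ge> 0" "\<And>y. \<bar>\<phi> y\<bar> \<le> B"
    using smooth_bounded[OF smooth_\<phi> supp_\<phi>, where n=0] by (metis length_0_conv partials.simps(1))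
  \<comment> \<open>A bound for the \<open>L\<^sup>1\<close> norm of every dilated kernel.\<close>
  define K where "K = B * (measure lborel (cball (0 :: real^'d) 1) * A powr real d)"
  have "0 \<le> K" using B by (simp add: K_def)
  have est: "\<bar>W 0 v \<rho> - f x\<bar> \<le> \<epsilon> * K"
    if \<rho>: "0 < \<rho>" and \<epsilon>: "0 \<le> \<epsilon>" and near: "\<And>y. y \<in> cball x (A * \<rho>) \<Longrightarrow> y \<in> U \<and> \<bar>f y - f x\<bar> \<le> \<epsilon>" for \<rho> \<epsilon>
  proof -
    have sm: "smooth (\<lambda>y. \<psi> \<rho> (y - v))" by (rule smooth_translate[OF smooth_\<psi>])
    have supp: "\<psi> \<rho> (y - v) = 0" if "y \<notin> cball x (A * \<rho>)" for y
      using that by (intro supp_\<psi>[OF \<rho>]) (auto simp: x_def dist_norm algebra_simps)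
    have int: "integrable (lebesgue_on U) (\<lambda>y. f y * \<psi> \<rho> (y - v))"
      unfolding U_def by (rule integrable_mult_continuous[OF compact_cball cont smooth_continuous[OF sm]])
    have int1: "integrable (lebesgue_on U) (\<lambda>y. f x * \<psi> \<rho> (y - v))"
      unfolding U_def by (rule integrable_mult_continuous[OF compact_cball continuous_on_const smooth_continuous[OF sm]])
    have "(LINT y|lebesgue_on U. \<psi> \<rho> (y - v)) = (LINT y|lborel. \<psi> \<rho> (y - v))"
      using near supp by (intro integral_lebesgue_on_eq_lborel smooth_continuous[OF sm] U_sets) blast
    also have "\<dots> = (LINT y|lborel. \<psi> \<rho> y)"
      by (intro integral_translate borel_measurable_continuous_onI smooth_continuous smooth_\<psi>)
    also have "\<dots> = 1" using mass[OF \<rho>] by (simp add: \<psi>_def d_def)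
    finally have "f x = (LINT y|lebesgue_on U. f x * \<psi> \<rho> (y - v))" by simp
    then have "W 0 v \<rho> - f x = (LINT y|lebesgue_on U. f y * \<psi> \<rho> (y - v) - f x * \<psi> \<rho> (y - v))"
      using int int1 by (simp add: W_def taylor_rem_def)
    also have "\<bar>\<dots>\<bar> \<le> (\<epsilon> * ((1 / \<rho>) ^ d * B)) * measure lborel (cball x (A * \<rho>))"
    proof (rule lebesgue_on_integral_bound[OF U_sets])
      show "0 \<le> \<epsilon> * ((1 / \<rho>) ^ d * B)" using \<epsilon> \<rho> B by simp
      show "\<bar>f y * \<psi> \<rho> (y - v) - f x * \<psi> \<rho> (y - v)\<bar> \<le> \<epsilon> * ((1 / \<rho>) ^ d * B)" for y
      proof (cases "y \<in> cball x (A * \<rho>)")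
        case True
        have "\<bar>f y - f x\<bar> * \<bar>\<psi> \<rho> (y - v)\<bar> \<le> \<epsilon> * ((1 / \<rho>) ^ d * B)"
          using near[OF True] \<rho> B \<epsilon> by (intro mult_mono) (auto simp: \<psi>_def abs_mult intro!: mult_left_mono)
        then show ?thesis by (simp add: abs_mult flip: left_diff_distrib)
      qed (use supp \<epsilon> \<rho> B in auto)
    qed (use supp in auto)
    also have "\<dots> = \<epsilon> * K"
    proof -
      have "(1 / \<rho>) ^ d * \<rho> powr real d = 1" using \<rho> by (simp add: powr_realpow power_divide)
      moreover have "measure lborel (cball x (A * \<rho>)) = measure lborel (cball (0 :: real^'d) 1) * (A powr real d * \<rho> powr real d)"
        using measure_lborel_cball[of "A * \<rho>" x] A \<rho> by (simp add: d_def powr_mult)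
      ultimately show ?thesis by (simp add: K_def algebra_simps)
    qed
    finally show ?thesis .
  qed
  show ?thesis
  proof (rule LIMSEQ_I)
    fix e :: real assume "0 < e"
    define \<epsilon> where "\<epsilon> = e / (2 * (K + 1))"
    have \<epsilon>: "0 < \<epsilon>" using \<open>0 < e\<close> \<open>0 \<le> K\<close> by (simp add: \<epsilon>_def)
    obtain \<delta>1 where \<delta>1: "\<delta>1 > 0" "cball x \<delta>1 \<subseteq> ball x0 r"
      using x open_contains_cball[of "ball x0 r"] open_ball by blast
    have "x \<in> U" using x by (simp add: U_def)
    then obtain \<delta>2 where \<delta>2: "\<delta>2 > 0" "\<And>y. y \<in> U \<Longrightarrow> dist y x < \<delta>2 \<Longrightarrow> dist (f y) (f x) < \<epsilon>"
      using cont \<epsilon> unfolding continuous_on_iff U_def by meson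
    define \<delta> where "\<delta> = min \<delta>1 \<delta>2 / (A + 1)"
    have "\<delta> > 0" using \<delta>1 \<delta>2 A by (simp add: \<delta>_def)
    obtain N0 where N0: "(1 / 2) ^ N0 < \<delta> / \<rho>0"
      using real_arch_pow_inv[of "\<delta> / \<rho>0" "1/2"] \<open>\<delta> > 0\<close> \<rho>0 by auto
    show "\<exists>N0. \<forall>N\<ge>N0. norm (W 0 v (\<rho>0 / 2 ^ N) - f (x0 + v)) < e"
    proof (intro exI allI impI)
      fix N assume "N0 \<le> N"
      define \<rho> where "\<rho> = \<rho>0 / 2 ^ N"
      have \<rho>: "0 < \<rho>" using \<rho>0 by (simp add: \<rho>_def)
      have "(1 / 2 :: real) ^ N \<le> (1 / 2) ^ N0" using \<open>N0 \<le> N\<close> by (intro power_decreasing) auto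
      then have "(1 / 2) ^ N < \<delta> / \<rho>0" using N0 by linarith
      then have "\<rho> < \<delta>" using \<rho>0 by (simp add: \<rho>_def field_simps power_divide)
      then have "(A + 1) * \<rho> < min \<delta>1 \<delta>2" using A by (simp add: \<delta>_def pos_less_divide_eq mult.commute)
      then have small: "A * \<rho> < min \<delta>1 \<delta>2" using \<rho> by (simp add: algebra_simps)
      have "\<bar>W 0 v \<rho> - f x\<bar> \<le> \<epsilon> * K"
      proof (rule est[OF \<rho>])
        fix y assume "y \<in> cball x (A * \<rho>)"
        then have y: "dist x y < \<delta>1" "dist y x < \<delta>2" using small by (auto simp: dist_commute)
        then have "y \<in> U" using \<delta>1(2) by (auto simp: U_def subset_iff less_imp_le)
        then show "y \<in> U \<and> \<bar>f y - f x\<bar> \<le> \<epsilon>" using \<delta>2(2)[of y] y by (simp add: dist_real_def)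
      qed (use \<epsilon> in simp)
      also have "\<epsilon> * K \<le> \<epsilon> * (K + 1)" using \<epsilon> by simp
      also have "\<dots> = e / 2" using \<open>0 \<le> K\<close> by (simp add: \<epsilon>_def field_simps)
      finally show "norm (W 0 v (\<rho>0 / 2 ^ N) - f (x0 + v)) < e"
        using \<open>0 < e\<close> by (simp add: x_def \<rho>_def)
    qed
  qed
qed

text \<open>With \<open>R N\<close> the dyadic scale next to \<open>h\<close>, the polynomial is the Taylor polynomial at \<open>x0\<close> of the
  mollification of \<open>f\<close> at scale \<open>R N\<close>. The error is the sum of the mollification error
  \<open>f (x0 + v) - W 0 v (R N)\<close>, which telescopes over the scales below \<open>R N\<close>, and of the Taylor remainder
  \<open>W n v (R N)\<close>, which telescopes over the scales above.\<close>

theorem local_polynomial_approximation: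
  "\<exists>C\<ge>0. \<exists>\<rho>0>0. \<forall>h. 0 < h \<longrightarrow> h \<le> \<rho>0 \<longrightarrow>
     (\<exists>P\<in>polys (nat \<lfloor>t\<rfloor>). \<forall>x\<in>cball x0 h. \<bar>f x - P x\<bar> \<le> C * h powr t)"
proof -
  define m where "m = nat \<lfloor>t\<rfloor>"
  define n where "n = Suc m"
  have tn: "t < real n" using t_pos unfolding n_def m_def by linarith
  \<comment> \<open>Small enough that the supports of all kernels that occur below lie inside \<open>ball x0 r\<close>.\<close>
  define \<rho>0 where "\<rho>0 = r / (2 * (A + 2))"
  have \<rho>0: "0 < \<rho>0" using r A by (simp add: \<rho>0_def)
  have "(A + 2) * \<rho>0 = r / 2" using A by (simp add: \<rho>0_def field_simps)
  then have room: "(A + 2) * \<rho>0 < r" using r by simp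
  define R where "R N = \<rho>0 / 2 ^ N" for N :: nat
  have R: "0 < R N" "R N \<le> \<rho>0" "R (Suc N) = R N / 2" for N
    using \<rho>0 by (auto simp: R_def divide_le_eq)
  have small: "norm v + (A + 1) * R N < r" if "norm v \<le> \<rho>0" for v :: "real^'d" and N
  proof -
    have "(A + 1) * R N \<le> (A + 1) * \<rho>0" using R(2) A by (intro mult_left_mono) auto
    then show ?thesis using that room by (simp add: algebra_simps)
  qed
  obtain C0 where C0: "C0 \<ge> 0" and step0: "\<And>v \<rho>. 0 < \<rho> \<Longrightarrow> norm v + (A + 1) * \<rho> < r \<Longrightarrow>
     \<bar>W 0 v \<rho> - W 0 v (\<rho> / 2)\<bar> \<le> C0 * \<rho> powr t"
    using W_step[of 0] by (auto simp: n_def)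
  obtain C1 where C1: "C1 \<ge> 0" and step1: "\<And>v \<rho>. 0 < \<rho> \<Longrightarrow> norm v \<le> \<rho> \<Longrightarrow> norm v + (A + 1) * \<rho> < r \<Longrightarrow>
     \<bar>W n v \<rho> - W n v (\<rho> / 2)\<bar> \<le> C1 * norm v ^ n * \<rho> powr (t - real n)"
    using W_step[of n] by blast
  obtain C2 where C2: "C2 \<ge> 0" and init: "\<And>v. \<bar>W n v \<rho>0\<bar> \<le> C2 * norm v ^ n"
    using W_initial[OF \<rho>0, of n] by blast
  \<comment> \<open>The sum of the geometric series with ratio \<open>2 powr (- t)\<close>.\<close>
  define E where "E = 1 / (1 - 2 powr (- t))"
  have E: "0 < E" using t_pos by (simp add: E_def powr_less_one)
  have R_t: "R (Suc N) powr a = 2 powr (- a) * R N powr a" for N a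
    using R(1)[of N] by (simp add: R(3) powr_divide powr_minus_divide)
  have tail: "\<bar>f (x0 + v) - W 0 v (R N)\<bar> \<le> C0 * E * R N powr t" if v: "norm v \<le> \<rho>0" for v N
  proof -
    have tel: "\<bar>W 0 v (R (N + j)) - W 0 v (R N)\<bar> \<le> C0 * E * (R N powr t - R (N + j) powr t)" for j
    proof (induction j)
      case (Suc j)
      have "\<bar>W 0 v (R (N + j)) - W 0 v (R (Suc (N + j)))\<bar> \<le> C0 * R (N + j) powr t"
        unfolding R(3) by (rule step0[OF R(1) small[OF v]])
      also have "\<dots> = C0 * E * (R (N + j) powr t - R (Suc (N + j)) powr t)"
      proof -
        have "E * (1 - 2 powr (- t)) = 1" using t_pos powr_less_one[of 2 "- t"] by (simp add: E_def)
        then have "E * (R (N + j) powr t - R (Suc (N + j)) powr t) = R (N + j) powr t"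
          unfolding R_t by (metis (no_types, opaque_lifting) left_diff_distrib mult.assoc mult_1)
        then show ?thesis by (simp only: mult.assoc)
      qed
      finally show ?case using Suc.IH by (simp add: algebra_simps)
    qed simp
    have "(\<lambda>j. W 0 v (R (N + j))) \<longlonglongrightarrow> f (x0 + v)"
    proof -
      have "norm v < r" using v small[OF v, of 0] R(1)[of 0] A by (smt (verit) mult_nonneg_nonneg)
      from LIMSEQ_ignore_initial_segment[OF W_limit[OF \<rho>0 this], of N] show ?thesis
        by (simp add: R_def add.commute)
    qed
    then have "(\<lambda>j. \<bar>W 0 v (R (N + j)) - W 0 v (R N)\<bar>) \<longlonglongrightarrow> \<bar>f (x0 + v) - W 0 v (R N)\<bar>"
      by (intro tendsto_intros)
    moreover have "\<bar>W 0 v (R (N + j)) - W 0 v (R N)\<bar> \<le> C0 * E * R N powr t" for j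
    proof -
      have "C0 * E * (R N powr t - R (N + j) powr t) \<le> C0 * E * R N powr t"
        using C0 E by (intro mult_left_mono) auto
      then show ?thesis using tel[of j] by linarith
    qed
    ultimately show ?thesis by (intro LIMSEQ_le_const2) auto
  qed
  define q where "q = 2 powr (t - real n)"
  have q: "0 < q" "q < 1" using tn by (auto simp: q_def powr_less_one)
  \<comment> \<open>The sum of the geometric series of positive powers of \<open>q\<close>, the ratio between consecutive scales.\<close>
  define D where "D = q / (1 - q)"
  have D: "0 < D" "(D + 1) * q = D" using q by (auto simp: D_def field_simps)
  have head: "\<bar>W n v (R N) - W n v \<rho>0\<bar> \<le> C1 * norm v ^ n * (D * R N powr (t - real n))"
    if "norm v \<le> R N" for v N
    using that
  proof (induction N)
    case 0
    then show ?case using C1 D by (simp add: R_def)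
  next
    case (Suc N)
    have v: "norm v \<le> R N" using Suc.prems R(1)[of N] by (simp add: R(3))
    have "\<bar>W n v (R N) - W n v (R (Suc N))\<bar> \<le> C1 * norm v ^ n * R N powr (t - real n)"
      unfolding R(3) using v R(2)[of N] by (intro step1 R small) auto
    then have "\<bar>W n v (R (Suc N)) - W n v \<rho>0\<bar> \<le> C1 * norm v ^ n * ((D + 1) * R N powr (t - real n))"
      using Suc.IH[OF v] by (simp add: algebra_simps)
    also have "(D + 1) * R N powr (t - real n) = D * R (Suc N) powr (t - real n)"
    proof -
      have "R N powr (t - real n) = q * R (Suc N) powr (t - real n)"
        unfolding R_t q_def by (simp add: mult.assoc[symmetric] flip: powr_add)
      then show ?thesis using D(2) by (metis mult.assoc)
    qed
    finally show ?case .
  qed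
  define C where "C = C0 * E * 2 powr t + (C2 * \<rho>0 powr (real n - t) + C1 * (D * 2 powr t))"
  have "0 \<le> C" using C0 C1 C2 E D by (simp add: C_def)
  moreover have "\<exists>P\<in>polys m. \<forall>x\<in>cball x0 h. \<bar>f x - P x\<bar> \<le> C * h powr t" if h: "0 < h" "h \<le> \<rho>0" for h
  proof -
    obtain N where N: "h \<le> R N" "R N < 2 * h" using dyadic_scale[OF h] by (auto simp: R_def)
    define c where "c L = (LINT y|lebesgue_on U. f y * partials L (\<psi> (R N)) y)" for L
    define P where "P x = (\<Sum>L | length L < n. c L * taylor_coeff (x - x0) L)" for x
    have "P \<in> polys m" unfolding P_def[abs_def]
    proof (intro polys_sum polys_cmult)
      fix L :: "'d list" assume "L \<in> {L. length L < n}"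
      then have "polys (length L) \<subseteq> (polys m :: (real^'d \<Rightarrow> real) set)" by (intro polys_mono) (simp add: n_def)
      then show "(\<lambda>x. taylor_coeff (x - x0) L) \<in> polys m" using taylor_coeff_in_polys by blast
    qed
    moreover have "\<bar>f x - P x\<bar> \<le> C * h powr t" if x: "x \<in> cball x0 h" for x
    proof -
      define v where "v = x - x0"
      have v: "norm v \<le> h" using x by (simp add: v_def dist_norm norm_minus_commute)
      have int: "integrable (lebesgue_on U) (\<lambda>y. f y * u y)" if "smooth u" for u
        unfolding U_def by (rule integrable_mult_continuous[OF compact_cball cont smooth_continuous[OF that]])
      have "W 0 v (R N) - W n v (R N) =
          (LINT y|lebesgue_on U. f y * taylor_rem 0 v (\<psi> (R N)) y - f y * taylor_rem n v (\<psi> (R N)) y)"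
        unfolding W_def by (intro Bochner_Integration.integral_diff[symmetric] int smooth_taylor_rem smooth_\<psi>)
      also have "\<dots> = (LINT y|lebesgue_on U. (\<Sum>L | length L < n. taylor_coeff v L * (f y * partials L (\<psi> (R N)) y)))"
        by (simp add: taylor_rem_def sum_distrib_left mult_ac flip: right_diff_distrib)
      also have "\<dots> = P x"
        unfolding P_def c_def
        by (subst Bochner_Integration.integral_sum)
          (auto intro!: int smooth_partials smooth_\<psi> simp: v_def mult.commute)
      finally have "f x - P x = (f (x0 + v) - W 0 v (R N)) + W n v (R N)" by (simp add: v_def)
      then have "\<bar>f x - P x\<bar> \<le> \<bar>f (x0 + v) - W 0 v (R N)\<bar> + (\<bar>W n v \<rho>0\<bar> + \<bar>W n v (R N) - W n v \<rho>0\<bar>)"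
        by linarith
      also have "\<dots> \<le> C0 * E * R N powr t + (C2 * norm v ^ n + C1 * norm v ^ n * (D * R N powr (t - real n)))"
        using v h N by (intro add_mono tail init head) auto
      also have "\<dots> \<le> C0 * E * (2 powr t * h powr t) + (C2 * (\<rho>0 powr (real n - t) * h powr t) + C1 * (D * (2 powr t * h powr t)))"
      proof -
        have RN: "R N powr t \<le> 2 powr t * h powr t"
          using N R(1)[of N] t_pos h powr_mono2[of t "R N" "2 * h"] by (simp add: powr_mult)
        have vn: "norm v ^ n \<le> h powr real n" using v h power_mono[OF v, of n] by (simp add: powr_realpow)
        have hn: "h powr real n = h powr (real n - t) * h powr t" by (simp flip: powr_add)
        have h0: "h powr (real n - t) \<le> \<rho>0 powr (real n - t)" using h tn by (intro powr_mono2) auto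
        have "norm v ^ n \<le> \<rho>0 powr (real n - t) * h powr t"
          using vn mult_right_mono[OF h0, of "h powr t"] by (simp add: hn)
        moreover have "norm v ^ n * R N powr (t - real n) \<le> 2 powr t * h powr t"
        proof -
          have "norm v ^ n \<le> R N powr real n"
            using v N power_mono[of "norm v" "R N" n] R(1)[of N] by (simp add: powr_realpow)
          then have "norm v ^ n * R N powr (t - real n) \<le> R N powr real n * R N powr (t - real n)"
            by (intro mult_right_mono) auto
          also have "\<dots> = R N powr t" by (simp flip: powr_add)
          finally show ?thesis using RN by linarith
        qed
        then have "C1 * (D * (norm v ^ n * R N powr (t - real n))) \<le> C1 * (D * (2 powr t * h powr t))"
          using C1 D by (intro mult_left_mono) auto
        moreover have "C0 * E * R N powr t \<le> C0 * E * (2 powr t * h powr t)"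
          using C0 E RN by (intro mult_left_mono) auto
        moreover have "C1 * norm v ^ n * (D * R N powr (t - real n)) = C1 * (D * (norm v ^ n * R N powr (t - real n)))"
          by (simp add: mult_ac)
        ultimately show ?thesis using mult_left_mono[OF _ C2] by (smt (verit))
      qed
      also have "\<dots> = C * h powr t" by (simp add: C_def algebra_simps)
      finally show ?thesis .
    qed
    ultimately show ?thesis by blast
  qed
  ultimately show ?thesis using \<rho>0 unfolding m_def by blast
qed

end

theorem sobolev_local_polynomial_approximation:
  fixes f :: "real^'d::finite \<Rightarrow> real"
  assumes "0 < r" and "1 \<le> p" and "real CARD('d) / p < s"
    and "f \<in> sobolev s p (cball x0 r)" and "continuous_on (cball x0 r) f"
  shows "\<exists>C\<ge>0. \<exists>\<rho>0>0. \<forall>h. 0 < h \<longrightarrow> h \<le> \<rho>0 \<longrightarrow>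
     (\<exists>P\<in>polys (nat \<lfloor>s - real CARD('d) / p\<rfloor>). \<forall>x\<in>cball x0 h.
        \<bar>f x - P x\<bar> \<le> C * h powr (s - real CARD('d) / p))"
proof -
  obtain \<phi> :: "real^'d \<Rightarrow> real" and g A where "A \<ge> 1" "smooth \<phi>" "\<forall>y. y \<notin> cball 0 A \<longrightarrow> \<phi> y = 0"
     "\<forall>z \<rho>. \<rho> > 0 \<longrightarrow> (LINT y|lborel. (1 / \<rho>) ^ CARD('d) * \<phi> ((1 / \<rho>) *\<^sub>R (y - z))) = 1"
     "\<forall>i. smooth (g i) \<and> (\<forall>y. y \<notin> cball 0 A \<longrightarrow> g i y = 0) \<and>
        (\<forall>L M. partials L (partials M (g i)) = partials M (partials L (g i)))"
     "\<forall>y. \<phi> y - 2 ^ CARD('d) * \<phi> (2 *\<^sub>R y) = (\<Sum>i\<in>UNIV. partials (replicate (Suc (nat \<lfloor>s\<rfloor>)) i) (g i) y)"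
    using exists_kernel[where 'd='d and N="nat \<lfloor>s\<rfloor>"] by blast
  with assms interpret sobolev_smoothing f x0 r s p \<phi> g A
    unfolding sobolev_smoothing_def by blast
  show ?thesis using local_polynomial_approximation by (simp add: t_def d_def)
qed

section \<open>Orthonormality and support of samplets\<close>

lemma nodes_rec: "nodes T = insert T (\<Union>c\<in>set (children T). nodes c)"
proof (rule set_eqI)
  fix S
  have "(\<exists>j. S \<in> nodes_at j T) \<longleftrightarrow> S \<in> nodes_at 0 T \<or> (\<exists>j. S \<in> nodes_at (Suc j) T)"
    by (metis not0_implies_Suc)
  then show "S \<in> nodes T \<longleftrightarrow> S \<in> insert T (\<Union>c\<in>set (children T). nodes c)"
    unfolding nodes_def by auto
qed

text \<open>Orthonormality of a list with respect to the inner product on weight functions; \<open>pairing X\<close> is this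
  inner product when its second argument is a weight function as well. The condition is on
  positions, so that a function occurring twice violates it.\<close>

definition orthonormal :: "(real^'d::finite) set \<Rightarrow> 'd functional list \<Rightarrow> bool" where
  "orthonormal X l \<longleftrightarrow> sorted_wrt (\<lambda>u v. pairing X u v = 0) l \<and> (\<forall>u\<in>set l. pairing X u u = 1)"

definition supported :: "(real^'d::finite) set \<Rightarrow> 'd functional list \<Rightarrow> bool" where
  "supported Y l \<longleftrightarrow> (\<forall>u\<in>set l. \<forall>x. x \<notin> Y \<longrightarrow> u x = 0)"

lemma pairing_commute: "pairing X u v = pairing X v u"
  by (simp add: pairing_def mult.commute)

lemma orthonormal_nth:
  assumes "orthonormal X l" "i < length l" "j < length l"
  shows "pairing X (l ! i) (l ! j) = (if i = j then 1 else 0)"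
proof -
  have "pairing X (l ! a) (l ! b) = 0" if "a < b" "b < length l" for a b
    using assms(1) that unfolding orthonormal_def sorted_wrt_iff_nth_less by blast
  moreover have "pairing X (l ! i) (l ! i) = 1"
    using assms(1,2) unfolding orthonormal_def by simp
  ultimately show ?thesis
    using assms(2,3) pairing_commute[of X "l ! i" "l ! j"] by (metis nat_neq_iff)
qed

text \<open>An orthogonal matrix maps orthonormal functionals to orthonormal functionals, and linear
  combinations do not enlarge the common support.\<close>

lemma samplet_step_orthonormal:
  assumes step: "samplet_step q X \<Gamma> \<phi> \<sigma>" and \<Gamma>: "orthonormal X \<Gamma>" "supported Y \<Gamma>"
  shows "orthonormal X (\<phi> @ \<sigma>)" and "supported Y (\<phi> @ \<sigma>)"
proof -
  let ?n = "length \<Gamma>"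
  obtain \<beta>s Q R where QR: "is_QR ?n (length \<beta>s) (\<lambda>i l. pairing X (\<Gamma> ! i) (monomial (\<beta>s ! l))) Q R"
    and eq: "\<phi> @ \<sigma> = map (\<lambda>l x. \<Sum>i<?n. Q i l * (\<Gamma> ! i) x) [0..<?n]"
    using step unfolding samplet_step_def by blast
  have Q: "(\<Sum>i<?n. Q i l * Q i m) = (if l = m then 1 else 0)" if "l < ?n" "m < ?n" for l m
    using QR that unfolding is_QR_def by blast
  have ip: "pairing X (\<lambda>x. \<Sum>i<?n. Q i l * (\<Gamma> ! i) x) (\<lambda>x. \<Sum>i<?n. Q i m * (\<Gamma> ! i) x) = (if l = m then 1 else 0)"
    if lm: "l < ?n" "m < ?n" for l m
  proof -
    have "pairing X (\<lambda>x. \<Sum>i<?n. Q i l * (\<Gamma> ! i) x) (\<lambda>x. \<Sum>i<?n. Q i m * (\<Gamma> ! i) x) =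
        (\<Sum>x\<in>X. \<Sum>i<?n. \<Sum>j<?n. (Q i l * Q j m) * ((\<Gamma> ! i) x * (\<Gamma> ! j) x))"
      unfolding pairing_def sum_product by (simp add: mult_ac)
    also have "\<dots> = (\<Sum>i<?n. \<Sum>j<?n. (Q i l * Q j m) * pairing X (\<Gamma> ! i) (\<Gamma> ! j))"
      unfolding pairing_def sum_distrib_left
      by (subst sum.swap, rule sum.cong[OF refl], subst sum.swap) rule
    also have "\<dots> = (\<Sum>i<?n. \<Sum>j<?n. if i = j then Q i l * Q i m else 0)"
      by (intro sum.cong refl) (auto simp: orthonormal_nth[OF \<Gamma>(1)])
    also have "\<dots> = (\<Sum>i<?n. Q i l * Q i m)" by simp
    finally show ?thesis using Q[OF lm] by simp
  qed
  show "orthonormal X (\<phi> @ \<sigma>)"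
    unfolding eq orthonormal_def sorted_wrt_iff_nth_less by (auto simp: ip)
  show "supported Y (\<phi> @ \<sigma>)"
    using \<Gamma>(2) unfolding eq supported_def by (auto intro!: sum.neutral)
qed

text \<open>Functionals of different children are orthogonal because their supports are disjoint.\<close>

lemma orthonormal_concat:
  assumes "\<And>c. c \<in> set cs \<Longrightarrow> orthonormal X (\<Phi> c) \<and> supported (sites c) (\<Phi> c)"
    and "sorted_wrt (\<lambda>c c'. sites c \<inter> sites c' = {}) cs"
  shows "orthonormal X (concat (map \<Phi> cs))"
  using assms
proof (induction cs)
  case Nil
  then show ?case by (simp add: orthonormal_def)
next
  case (Cons c cs)
  have "pairing X u v = 0" if "u \<in> set (\<Phi> c)" "v \<in> set (concat (map \<Phi> cs))" for u v
  proof -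
    obtain c' where c': "c' \<in> set cs" "v \<in> set (\<Phi> c')" using \<open>v \<in> _\<close> by auto
    have dis: "sites c \<inter> sites c' = {}" using Cons.prems(2) c'(1) by simp
    have "u x * v x = 0" for x
    proof (cases "x \<in> sites c")
      case True
      then have "v x = 0"
        using dis c' Cons.prems(1)[of c'] unfolding supported_def by auto
      then show ?thesis by simp
    next
      case False
      then have "u x = 0" using that(1) Cons.prems(1)[of c] unfolding supported_def by auto
      then show ?thesis by simp
    qed
    then show ?thesis unfolding pairing_def by (intro sum.neutral ballI)
  qed
  moreover have "orthonormal X (concat (map \<Phi> cs))" using Cons by auto
  moreover have "orthonormal X (\<Phi> c)" using Cons.prems(1) by simp
  ultimately show ?case by (simp add: orthonormal_def sorted_wrt_append) blast
qed

text \<open>Structural induction over the tree: the indicators of the sites of a leaf are orthonormal, and so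
  are the scaling distributions collected from the children of a node.\<close>

lemma samplets_orthonormal:
  fixes T :: "'d::finite cluster_tree"
  assumes fin: "finite X"
    and "\<forall>S\<in>nodes T. children S \<noteq> [] \<longrightarrow>
        disjoint_family_on (\<lambda>i. sites (children S ! i)) {..<length (children S)} \<and>
        sites S = (\<Union>c\<in>set (children S). sites c)"
    and "sites T \<subseteq> X" and "samplet_system q X T \<Phi> \<Psi>"
  shows "\<forall>S\<in>nodes T. orthonormal X (\<Phi> S @ \<Psi> S) \<and> supported (sites S) (\<Phi> S @ \<Psi> S) \<and> sites S \<subseteq> X"
  using assms(2-)
proof (induction T)
  case (Cluster Y cs)
  let ?T = "Cluster Y cs"
  have sub: "nodes c \<subseteq> nodes ?T" if "c \<in> set cs" for c
    using that by (subst (2) nodes_rec) auto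
  have T: "?T \<in> nodes ?T" by (subst nodes_rec) simp
  have childs: "cs \<noteq> [] \<Longrightarrow> disjoint_family_on (\<lambda>i. sites (cs ! i)) {..<length cs} \<and> Y = (\<Union>c\<in>set cs. sites c)"
    using Cluster.prems(1) T by force
  have IH: "\<forall>S\<in>nodes c. orthonormal X (\<Phi> S @ \<Psi> S) \<and> supported (sites S) (\<Phi> S @ \<Psi> S) \<and> sites S \<subseteq> X"
    if c: "c \<in> set cs" for c
  proof (rule Cluster.IH)
    show "c \<in> set cs" by (rule c)
    show "\<forall>S\<in>nodes c. children S \<noteq> [] \<longrightarrow>
        disjoint_family_on (\<lambda>i. sites (children S ! i)) {..<length (children S)} \<and>
        sites S = (\<Union>c\<in>set (children S). sites c)" using Cluster.prems(1) sub[OF c] by blast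
    show "sites c \<subseteq> X" using Cluster.prems(2) childs c by (cases cs) auto
    show "samplet_system q X c \<Phi> \<Psi>" using Cluster.prems(3) sub[OF c] unfolding samplet_system_def by blast
  qed
  have IHc: "orthonormal X (\<Phi> c)" "supported (sites c) (\<Phi> c)" if "c \<in> set cs" for c
    using IH[OF that] nodes_rec[of c] by (auto simp: orthonormal_def supported_def sorted_wrt_append)
  have "orthonormal X (\<Phi> ?T @ \<Psi> ?T) \<and> supported Y (\<Phi> ?T @ \<Psi> ?T)"
  proof (cases "cs = []")
    case True
    then obtain xs where xs: "distinct xs" "set xs = Y"
      and step: "samplet_step q X (map (\<lambda>x. indicator {x}) xs) (\<Phi> ?T) (\<Psi> ?T)"
      using Cluster.prems(3) T unfolding samplet_system_def by force
    have ip: "pairing X (indicator {x}) (indicator {y}) = (if x = y then 1 else 0)" if "x \<in> Y" for x y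
    proof -
      have "pairing X (indicator {x}) (indicator {y}) = (\<Sum>z\<in>X. if z = x then indicator {y} x else 0)"
        unfolding pairing_def by (intro sum.cong) (auto simp: indicator_def)
      also have "\<dots> = indicator {y} x" using fin that Cluster.prems(2) by auto
      finally show ?thesis by (auto simp: indicator_def)
    qed
    have "orthonormal X (map (\<lambda>x. indicator {x}) xs)"
      unfolding orthonormal_def using xs
      by (auto simp: ip sorted_wrt_iff_nth_less nth_eq_iff_index_eq)
    moreover have "supported Y (map (\<lambda>x. indicator {x}) xs)"
      unfolding supported_def using xs by (auto simp: indicator_def)
    ultimately show ?thesis using samplet_step_orthonormal[OF step] by blast
  next
    case False
    then have step: "samplet_step q X (concat (map \<Phi> cs)) (\<Phi> ?T) (\<Psi> ?T)"
      using Cluster.prems(3) T unfolding samplet_system_def by force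
    have "sorted_wrt (\<lambda>c c'. sites c \<inter> sites c' = {}) cs"
      using childs[OF False] unfolding sorted_wrt_iff_nth_less disjoint_family_on_def by auto
    then have "orthonormal X (concat (map \<Phi> cs))"
      using IHc by (intro orthonormal_concat) auto
    moreover have "supported Y (concat (map \<Phi> cs))"
      using IHc(2) childs[OF False] unfolding supported_def by fastforce
    ultimately show ?thesis using samplet_step_orthonormal[OF step] by blast
  qed
  then show ?case
    using IH Cluster.prems(2) by (subst nodes_rec) auto
qed

text \<open>The Cauchy--Schwarz inequality on the sites of the cluster, where the weights of a samplet have
  Euclidean norm 1.\<close>

lemma samplet_pairing_bound:
  assumes fin: "finite X" and tree: "is_cluster_tree X T" and sys: "samplet_system q X T \<Phi> \<Psi>"
    and S: "S \<in> nodes T" and \<sigma>: "\<sigma> \<in> set (\<Psi> S)" and B: "0 \<le> B" "\<And>x. x \<in> sites S \<Longrightarrow> \<bar>h x\<bar> \<le> B"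
  shows "\<bar>pairing X \<sigma> h\<bar> \<le> B * sqrt (real (card (sites S)))"
proof -
  have *: "orthonormal X (\<Phi> S @ \<Psi> S)" "supported (sites S) (\<Phi> S @ \<Psi> S)" "sites S \<subseteq> X"
    using samplets_orthonormal[OF fin _ _ sys] tree S unfolding is_cluster_tree_def by auto
  have restrict: "pairing X \<sigma> u = (\<Sum>x\<in>sites S. \<sigma> x * u x)" for u
    unfolding pairing_def using fin * \<sigma> by (intro sum.mono_neutral_right) (auto simp: supported_def)
  have "(\<Sum>x\<in>sites S. (\<sigma> x)\<^sup>2) = 1"
    using *(1) \<sigma> restrict[of \<sigma>] by (auto simp: orthonormal_def power2_eq_square)
  then have L2: "L2_set \<sigma> (sites S) = 1" by (simp add: L2_set_def)
  have "\<bar>pairing X \<sigma> h\<bar> \<le> (\<Sum>x\<in>sites S. \<bar>\<sigma> x\<bar> * \<bar>B\<bar>)"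
    unfolding restrict using B by (intro order_trans[OF sum_abs] sum_mono) (auto simp: abs_mult intro!: mult_left_mono)
  also have "\<dots> \<le> L2_set \<sigma> (sites S) * L2_set (\<lambda>_. B) (sites S)"
    by (rule L2_set_mult_ineq)
  also have "\<dots> = B * sqrt (real (card (sites S)))"
    using B(1) unfolding L2 by (simp add: L2_set_def real_sqrt_mult mult.commute)
  finally show ?thesis .
qed

section \<open>Diameters of dyadic clusters\<close>

text \<open>Each level halves the side length of the cube.\<close>

lemma geometric_sites:
  assumes "geometric a h T" and "S \<in> nodes_at j T"
  shows "\<exists>b. sites S \<subseteq> cbox b (b + (h / 2 ^ j) *\<^sub>R 1)"
  using assms
proof (induction j arbitrary: a h T)
  case 0
  from 0(1) show ?case using 0(2) by cases auto
next
  case (Suc j)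
  then obtain c where c: "c \<in> set (children T)" "S \<in> nodes_at j c" by auto
  from Suc.prems(1) obtain b where "geometric b (h / 2) c"
  proof cases
    case leaf
    then show ?thesis using c by simp
  next
    case (node Y v cs)
    then obtain k where "k < length cs" "c = cs ! k" using c by (auto simp: in_set_conv_nth)
    then show ?thesis using node that by blast
  qed
  from Suc.IH[OF this c(2)] show ?case by (simp add: divide_divide_eq_left)
qed

lemma geometric_diameter:
  assumes "geometric a 1 T" and "S \<in> nodes_at j T"
  shows "diameter (sites (S :: 'd::finite cluster_tree)) \<le> sqrt (real CARD('d)) * 2 powr (- real j)"
proof -
  obtain b where b: "sites S \<subseteq> cbox b (b + (1 / 2 ^ j) *\<^sub>R 1)"
    using geometric_sites[OF assms] by blast
  have n1: "norm (1 :: real^'d) = sqrt (real CARD('d))"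
    by (simp add: norm_vec_def L2_set_def)
  have "norm (x - y) \<le> sqrt (real CARD('d)) * 2 powr (- real j)" if "x \<in> sites S" "y \<in> sites S" for x y
  proof -
    have "norm (x - y) \<le> norm ((1 / 2 ^ j) *\<^sub>R (1 :: real^'d))"
    proof (rule norm_le_componentwise_cart)
      fix i
      have "b $ i \<le> x $ i" "x $ i \<le> b $ i + 1 / 2 ^ j" "b $ i \<le> y $ i" "y $ i \<le> b $ i + 1 / 2 ^ j"
        using b that by (auto simp: mem_box_cart subset_iff)
      then show "norm ((x - y) $ i) \<le> norm (((1 / 2 ^ j) *\<^sub>R (1 :: real^'d)) $ i)"
        by (simp add: abs_le_iff)
    qed
    then show ?thesis by (simp add: n1 powr_minus powr_realpow divide_inverse mult.commute)
  qed
  then show ?thesis by (intro diameter_le) auto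
qed

section \<open>Decay of samplet coefficients\<close>

theorem corollary3p5:
  fixes \<Omega> :: "(real^'d::finite) set" and f :: "real^'d \<Rightarrow> real" and x0 :: "real^'d"
    and r s p \<kappa> M :: real
  assumes "region \<Omega>" and "x0 \<in> \<Omega>" and "0 < r" and "cball x0 r \<subseteq> \<Omega>"
    and "1 \<le> p" and "real CARD('d) / p < s"
    and "f \<in> sobolev s p (cball x0 r)" and "continuous_on (cball x0 r) f"
  shows
    "(\<exists>C>0. \<forall>q X T \<Phi> \<Psi> j S \<sigma> \<epsilon>.
       \<lfloor>s - real CARD('d) / p\<rfloor> \<le> int q \<longrightarrow>
       data_sites \<kappa> \<Omega> X \<longrightarrow> is_cluster_tree X T \<longrightarrow>
       samplet_system q X T \<Phi> \<Psi> \<longrightarrow> vanishing_moments q X T \<Psi> \<longrightarrow>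
       S \<in> nodes_at j T \<longrightarrow> x0 \<in> sites S \<longrightarrow> \<sigma> \<in> set (\<Psi> S) \<longrightarrow>
       (\<forall>x\<in>sites S - cball x0 r. \<bar>f x\<bar> \<le> M) \<longrightarrow>
       0 < \<epsilon> \<longrightarrow> \<epsilon> < s - real CARD('d) / p - of_int \<lfloor>s - real CARD('d) / p\<rfloor> \<longrightarrow>
       \<bar>pairing X \<sigma> f\<bar>
         \<le> C * (diameter (sites S) powr (s - real CARD('d) / p - \<epsilon>) * sqrt (real (card (sites S)))))
     \<and>
     (\<Omega> = cbox 0 1 \<longrightarrow> p = 2 \<longrightarrow>
     (\<forall>K. \<exists>C>0. \<forall>q X T \<Phi> \<Psi> j S \<sigma> \<epsilon>.
       \<lfloor>s - real CARD('d) / 2\<rfloor> \<le> int q \<longrightarrow>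
       data_sites \<kappa> \<Omega> X \<longrightarrow> is_cluster_tree X T \<longrightarrow>
       is_2d_tree T \<longrightarrow> geometric 0 1 T \<longrightarrow> balanced K T \<longrightarrow>
       samplet_system q X T \<Phi> \<Psi> \<longrightarrow> vanishing_moments q X T \<Psi> \<longrightarrow>
       S \<in> nodes_at j T \<longrightarrow> x0 \<in> sites S \<longrightarrow> \<sigma> \<in> set (\<Psi> S) \<longrightarrow>
       (\<forall>x\<in>sites S - cball x0 r. \<bar>f x\<bar> \<le> M) \<longrightarrow>
       0 < \<epsilon> \<longrightarrow> \<epsilon> < s - real CARD('d) / 2 - of_int \<lfloor>s - real CARD('d) / 2\<rfloor> \<longrightarrow>
       \<bar>pairing X \<sigma> f\<bar>
         \<le> C * (sqrt (real (card X) * real CARD('d) powr (s - real CARD('d) / 2 - \<epsilon>))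
                * 2 powr (- real j * (s - \<epsilon>)))))"
proof -
  define t where "t = s - real CARD('d) / p"
  define U where "U = cball x0 r"
  obtain C0 \<rho>0 where C0: "C0 \<ge> 0" and \<rho>0: "\<rho>0 > 0" and approx: "\<And>h. 0 < h \<Longrightarrow> h \<le> \<rho>0 \<Longrightarrow>
     \<exists>P\<in>polys (nat \<lfloor>t\<rfloor>). \<forall>x\<in>cball x0 h. \<bar>f x - P x\<bar> \<le> C0 * h powr t"
    using sobolev_local_polynomial_approximation[OF assms(3,5,6,7,8)] unfolding t_def by blast
  have "0 < t" using assms(6) by (simp add: t_def)
  have "bounded (f ` U)" unfolding U_def
    by (intro compact_imp_bounded compact_continuous_image assms(8)) simp
  then obtain F where F: "\<And>x. x \<in> U \<Longrightarrow> \<bar>f x\<bar> \<le> F" by (auto simp: bounded_iff)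
  define G where "G = max 0 (max F M)"
  \<comment> \<open>Below this diameter the cluster lies in the ball on which \<open>f\<close> is approximated, and powers of the
    diameter decrease in the exponent.\<close>
  define \<rho> where "\<rho> = min (min \<rho>0 r) 1"
  have \<rho>: "0 < \<rho>" "\<rho> \<le> \<rho>0" "\<rho> \<le> r" "\<rho> \<le> 1" using \<rho>0 assms(3) by (auto simp: \<rho>_def)
  \<comment> \<open>\<open>C0\<close> serves the clusters of diameter at most \<open>\<rho>\<close> and \<open>G / \<rho> powr t\<close> the larger ones.\<close>
  define C where "C = 1 + C0 + G / \<rho> powr t"
  have C: "0 < C" "C0 \<le> C" "G / \<rho> powr t \<le> C" using C0 by (auto simp: C_def G_def add_pos_nonneg)
  have main: "\<bar>pairing X \<sigma> f\<bar> \<le> C * (diameter (sites S) powr (t - \<epsilon>) * sqrt (real (card (sites S))))"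
    if q: "\<lfloor>t\<rfloor> \<le> int q" and X: "data_sites \<kappa> \<Omega> X" and tree: "is_cluster_tree X T"
      and sys: "samplet_system q X T \<Phi> \<Psi>" and van: "vanishing_moments q X T \<Psi>"
      and "S \<in> nodes_at j T" and x0: "x0 \<in> sites S" and \<sigma>: "\<sigma> \<in> set (\<Psi> S)"
      and M: "\<forall>x\<in>sites S - cball x0 r. \<bar>f x\<bar> \<le> M"
      and \<epsilon>: "0 < \<epsilon>" "\<epsilon> < t - of_int \<lfloor>t\<rfloor>"
    for q X T \<Phi> \<Psi> j S \<sigma> \<epsilon>
  proof -
    define h where "h = diameter (sites S)"
    have S: "S \<in> nodes T" using \<open>S \<in> nodes_at j T\<close> by (auto simp: nodes_def)
    have fin: "finite X" using X by (simp add: data_sites_def)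
    have "sites S \<subseteq> X"
      using samplets_orthonormal[OF fin _ _ sys] tree S unfolding is_cluster_tree_def by auto
    then have "bounded (sites S)" using fin by (meson finite_imp_bounded finite_subset)
    then have near: "x \<in> cball x0 h" if "x \<in> sites S" for x
      using diameter_bounded_bound[OF _ x0 that] by (simp add: h_def)
    have "0 \<le> h" using near[OF x0] by simp
    have "0 \<le> real_of_int \<lfloor>t\<rfloor>" using \<open>0 < t\<close> by simp
    then have t\<epsilon>: "0 < t - \<epsilon>" "t - \<epsilon> \<le> t" using \<epsilon> by linarith+
    have bound: "\<bar>pairing X \<sigma> u\<bar> \<le> B * sqrt (real (card (sites S)))"
      if "0 \<le> B" "\<And>x. x \<in> sites S \<Longrightarrow> \<bar>u x\<bar> \<le> B" for u B
      by (rule samplet_pairing_bound[OF fin tree sys S \<sigma> that])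
    have subtract: "pairing X \<sigma> f = pairing X \<sigma> (\<lambda>x. f x - P x)" if "P \<in> polys q" for P
      using van S \<sigma> that unfolding vanishing_moments_def pairing_def
      by (simp add: right_diff_distrib sum_subtractf)
    have "\<bar>pairing X \<sigma> f\<bar> \<le> (C * h powr (t - \<epsilon>)) * sqrt (real (card (sites S)))"
    proof -
      consider "h = 0" | "0 < h" "h \<le> \<rho>" | "\<rho> < h" using \<open>0 \<le> h\<close> by linarith
      then show ?thesis
      proof cases
        case 1
        have "\<bar>pairing X \<sigma> (\<lambda>x. f x - f x0)\<bar> \<le> 0 * sqrt (real (card (sites S)))"
          using near 1 by (intro bound) auto
        then show ?thesis using subtract[OF const_in_polys[of "f x0"]] 1 by simp
      next
        case 2
        obtain P where P: "P \<in> polys (nat \<lfloor>t\<rfloor>)" "\<And>x. x \<in> cball x0 h \<Longrightarrow> \<bar>f x - P x\<bar> \<le> C0 * h powr t"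
          using approx[of h] 2 \<rho> by auto
        have "nat \<lfloor>t\<rfloor> \<le> q" using q by (simp add: nat_le_iff)
        then have "P \<in> polys q" using P(1) polys_mono by blast
        have "C0 * h powr t \<le> C * h powr (t - \<epsilon>)"
          using C C0 t\<epsilon> 2 \<rho> by (intro mult_mono powr_mono') auto
        then have "\<bar>pairing X \<sigma> (\<lambda>x. f x - P x)\<bar> \<le> (C * h powr (t - \<epsilon>)) * sqrt (real (card (sites S)))"
          using P(2) near C by (intro bound) (auto intro: order_trans)
        then show ?thesis using subtract[OF \<open>P \<in> polys q\<close>] by simp
      next
        case 3
        have "\<rho> powr t \<le> \<rho> powr (t - \<epsilon>)" using \<rho> t\<epsilon> by (intro powr_mono') auto
        also have "\<dots> \<le> h powr (t - \<epsilon>)" using \<rho> t\<epsilon> 3 by (intro powr_mono2) auto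
        finally have "G / \<rho> powr t * \<rho> powr t \<le> C * h powr (t - \<epsilon>)"
          using C by (intro mult_mono) auto
        then have GC: "G \<le> C * h powr (t - \<epsilon>)" using \<rho> by simp
        have "\<bar>f x\<bar> \<le> G" if "x \<in> sites S" for x
        proof (cases "x \<in> U")
          case True
          then show ?thesis using F[of x] by (simp add: G_def)
        next
          case False
          then have "\<bar>f x\<bar> \<le> M" using M that unfolding U_def by blast
          then show ?thesis by (simp add: G_def)
        qed
        then show ?thesis using GC C by (intro bound) (auto intro: order_trans)
      qed
    qed
    then show ?thesis by (simp add: h_def mult.assoc)
  qed
  have second: "\<exists>C'>0. \<forall>q X T \<Phi> \<Psi> j S \<sigma> \<epsilon>.
       \<lfloor>s - real CARD('d) / 2\<rfloor> \<le> int q \<longrightarrow>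
       data_sites \<kappa> \<Omega> X \<longrightarrow> is_cluster_tree X T \<longrightarrow>
       is_2d_tree T \<longrightarrow> geometric 0 1 T \<longrightarrow> balanced K T \<longrightarrow>
       samplet_system q X T \<Phi> \<Psi> \<longrightarrow> vanishing_moments q X T \<Psi> \<longrightarrow>
       S \<in> nodes_at j T \<longrightarrow> x0 \<in> sites S \<longrightarrow> \<sigma> \<in> set (\<Psi> S) \<longrightarrow>
       (\<forall>x\<in>sites S - cball x0 r. \<bar>f x\<bar> \<le> M) \<longrightarrow>
       0 < \<epsilon> \<longrightarrow> \<epsilon> < s - real CARD('d) / 2 - of_int \<lfloor>s - real CARD('d) / 2\<rfloor> \<longrightarrow>
       \<bar>pairing X \<sigma> f\<bar>
         \<le> C' * (sqrt (real (card X) * real CARD('d) powr (s - real CARD('d) / 2 - \<epsilon>))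
                * 2 powr (- real j * (s - \<epsilon>)))" if "p = 2" for K
  proof (intro exI[of _ "C * sqrt (max K 1)"] conjI allI impI)
    show "0 < C * sqrt (max K 1)" using C by simp
    fix q X T \<Phi> \<Psi> j S \<sigma> \<epsilon>
    assume *: "\<lfloor>s - real CARD('d) / 2\<rfloor> \<le> int q" "data_sites \<kappa> \<Omega> X" "is_cluster_tree X T"
      and geo: "geometric 0 1 T" and bal: "balanced K T"
      and **: "samplet_system q X T \<Phi> \<Psi>" "vanishing_moments q X T \<Psi>"
       "S \<in> nodes_at j T" "x0 \<in> sites S" "\<sigma> \<in> set (\<Psi> S)"
       "\<forall>x\<in>sites S - cball x0 r. \<bar>f x\<bar> \<le> M"
       "0 < \<epsilon>" "\<epsilon> < s - real CARD('d) / 2 - of_int \<lfloor>s - real CARD('d) / 2\<rfloor>"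
    define d where "d = real CARD('d)"
    define N where "N = real (card X)"
    define a where "a = t - \<epsilon>"
    have t: "t = s - d / 2" using \<open>p = 2\<close> by (simp add: t_def d_def)
    have "0 \<le> real_of_int \<lfloor>t\<rfloor>" using \<open>0 < t\<close> by simp
    then have a: "0 < a" using **(8) unfolding a_def t d_def by linarith
    have "0 < d" by (simp add: d_def)
    have fin: "finite X" using *(2) by (simp add: data_sites_def)
    have "\<bar>pairing X \<sigma> f\<bar> \<le> C * (diameter (sites S) powr a * sqrt (real (card (sites S))))"
      unfolding a_def by (rule main[OF _ *(2,3) **(1-7)]) (use * ** in \<open>simp_all add: t d_def\<close>)
    also have "\<dots> \<le> C * ((d powr (a / 2) * 2 powr (- real j * a)) * (sqrt (max K 1) * (sqrt N * 2 powr (- real j * d / 2))))"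
    proof (intro mult_left_mono mult_mono)
      have "diameter (sites S) \<le> sqrt d * 2 powr (- real j)"
        unfolding d_def by (rule geometric_diameter[OF geo **(3)])
      moreover have "0 \<le> diameter (sites S)"
        by (rule diameter_ge_0)
          (use samplets_orthonormal[OF fin _ _ **(1)] *(3) **(3) fin in
            \<open>auto simp: is_cluster_tree_def nodes_def intro!: finite_imp_bounded dest: finite_subset\<close>)
      ultimately have "diameter (sites S) powr a \<le> (sqrt d * 2 powr (- real j)) powr a"
        using a by (intro powr_mono2) auto
      also have "\<dots> = d powr (a / 2) * 2 powr (- real j * a)"
        using \<open>0 < d\<close> by (simp add: powr_mult powr_powr flip: powr_half_sqrt)
      finally show "diameter (sites S) powr a \<le> d powr (a / 2) * 2 powr (- real j * a)" .
      have "real (card (sites S)) \<le> K * (N * 2 powr (- real j * d))"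
        using bal **(3) *(3) unfolding balanced_def is_cluster_tree_def N_def d_def by blast
      also have "\<dots> \<le> max K 1 * (N * 2 powr (- real j * d))"
        by (intro mult_right_mono) (auto simp: N_def)
      finally have "sqrt (real (card (sites S))) \<le> sqrt (max K 1 * (N * 2 powr (- real j * d)))"
        by simp
      also have "\<dots> = sqrt (max K 1) * (sqrt N * 2 powr (- real j * d / 2))"
        by (simp add: real_sqrt_mult powr_powr flip: powr_half_sqrt[of "2 powr _"])
      finally show "sqrt (real (card (sites S))) \<le> sqrt (max K 1) * (sqrt N * 2 powr (- real j * d / 2))" .
    qed (use C in auto)
    also have "\<dots> = C * sqrt (max K 1) * (sqrt (N * d powr a) * 2 powr (- real j * (s - \<epsilon>)))"
    proof -
      have "2 powr (- real j * a) * 2 powr (- real j * d / 2) = (2 :: real) powr (- real j * (s - \<epsilon>))"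
        unfolding powr_add[symmetric] a_def t by (intro arg_cong2[where f="(powr)"] refl) (simp add: field_simps)
      moreover have "sqrt (N * d powr a) = sqrt N * d powr (a / 2)"
        using \<open>0 < d\<close> by (simp add: real_sqrt_mult powr_powr flip: powr_half_sqrt[of "d powr a"])
      ultimately show ?thesis by (simp add: mult_ac)
    qed
    finally show "\<bar>pairing X \<sigma> f\<bar> \<le> C * sqrt (max K 1) *
        (sqrt (real (card X) * real CARD('d) powr (s - real CARD('d) / 2 - \<epsilon>)) * 2 powr (- real j * (s - \<epsilon>)))"
      unfolding N_def a_def t d_def .
  qed
  show ?thesis
  proof (intro conjI impI allI)
    show "\<exists>C>0. \<forall>q X T \<Phi> \<Psi> j S \<sigma> \<epsilon>.
       \<lfloor>s - real CARD('d) / p\<rfloor> \<le> int q \<longrightarrow>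
       data_sites \<kappa> \<Omega> X \<longrightarrow> is_cluster_tree X T \<longrightarrow>
       samplet_system q X T \<Phi> \<Psi> \<longrightarrow> vanishing_moments q X T \<Psi> \<longrightarrow>
       S \<in> nodes_at j T \<longrightarrow> x0 \<in> sites S \<longrightarrow> \<sigma> \<in> set (\<Psi> S) \<longrightarrow>
       (\<forall>x\<in>sites S - cball x0 r. \<bar>f x\<bar> \<le> M) \<longrightarrow>
       0 < \<epsilon> \<longrightarrow> \<epsilon> < s - real CARD('d) / p - of_int \<lfloor>s - real CARD('d) / p\<rfloor> \<longrightarrow>
       \<bar>pairing X \<sigma> f\<bar>
         \<le> C * (diameter (sites S) powr (s - real CARD('d) / p - \<epsilon>) * sqrt (real (card (sites S))))"
      using main C(1) unfolding t_def by (intro exI[of _ C] conjI allI impI)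
  qed (rule second)
qed

end
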